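(* Let $\Omega\subset\mathbb{R}^2$ be a bounded open set with Lipschitz boundary. If $\Omega$ is convex, then every minimal curve $\gamma$ for $\Omega$ surrounds a convex set, i.e. the closed set surrounded by $\gamma$ is convex.
   Context: $\mathbb{S}^1$ is the circle. A regular curve is a closed curve $\gamma:\mathbb{S}^1\to\mathbb{R}^2$ with $\gamma,\gamma',\gamma''\in L^2(\mathbb{S}^1,\mathbb{R}^2)$ (so $\gamma\in C^1$) and $|\gamma'(t)|>0$ for all $t$; $(\gamma)$ denotes its image. Writing $\gamma:[0,L]\to\mathbb{R}^2$ for its arc-length parametrization, the bending energy is $\mathcal{W}(\gamma)=\int_0^L|\gamma''(s)|^2\,ds$. The set $\mathcal{A}$ of admissible curves is the set of regular closed curves with $(\gamma)\subset\overline\Omega$ all of whose self-intersections (if any) are tangential: if $\gamma(t)=\gamma(s)$ with $t\ne s$, then $\gamma'(t)$ and $\gamma'(s)$ are parallel (same or opposite directions). A minimal (or optimal) curve is a $\gamma\in\mathcal{A}$ with $\mathcal{W}(\gamma)=\min_{\tilde\gamma\in\mathcal{A}}\mathcal{W}(\tilde\gamma)$. Minimal curves are taken with a constant speed parametrization for which distinct branches do not cross at self-contact points: if $\gamma(t)=\gamma(s)$ with $t\ne s$, then, writing the two branches of $\gamma$ near $t$ and near $s$ as graphs of functions $f,g$ over their common tangent line near $\gamma(t)$, one has $f\le g$ or $f\ge g$ near that point. (Any minimal curve admits such a parametrization, with the same image and the same multiplicities.) The closed set surrounded by $\gamma$ is $(\gamma)\cup\{z\in\mathbb{R}^2\smallsetminus(\gamma):\operatorname{ind}_\gamma(z)\neq0\}$,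 where $\operatorname{ind}_\gamma(z)$ is the winding number of $\gamma$ around $z$. *)

theory Defs
  imports "HOL-Complex_Analysis.Complex_Analysis"
begin

text \<open>
  The plane is identified with the complex numbers, so that the library's winding number
  applies. The circle of length \<open>T\<close> is \<open>\<real>/T\<int>\<close>: a function on it is a \<open>T\<close>-periodic function on
  \<open>\<real>\<close>, and closed curves are parametrized by the circle of length 1.
\<close>

definition periodic :: "real \<Rightarrow> (real \<Rightarrow> 'a) \<Rightarrow> bool" where
  "periodic T f \<longleftrightarrow> (\<forall>t. f (t + T) = f t)"


section \<open>Sobolev functions on the circle\<close>

definition smooth :: "(real \<Rightarrow> real) \<Rightarrow> bool" where
  "smooth \<phi> \<longleftrightarrow> (\<forall>n. (deriv ^^ n) \<phi> differentiable_on UNIV)"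

definition L2_circle :: "real \<Rightarrow> (real \<Rightarrow> complex) \<Rightarrow> bool" where
  "L2_circle T f \<longleftrightarrow> f \<in> borel_measurable (lebesgue_on {0..T}) \<and>
     integrable (lebesgue_on {0..T}) (\<lambda>t. (norm (f t))\<^sup>2)"

text \<open>
  Distributional derivative on the circle. Integrability is part of the definition because
  the Bochner integral of a non-integrable function is 0 by convention.
\<close>

definition has_weak_deriv :: "real \<Rightarrow> (real \<Rightarrow> complex) \<Rightarrow> (real \<Rightarrow> complex) \<Rightarrow> bool" where
  "has_weak_deriv T f g \<longleftrightarrow>
     integrable (lebesgue_on {0..T}) f \<and> integrable (lebesgue_on {0..T}) g \<and>
     (\<forall>\<phi>. smooth \<phi> \<and> periodic T \<phi> \<longrightarrow>
        (LINT t|lebesgue_on {0..T}. deriv \<phi> t *\<^sub>R f t) =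
        - (LINT t|lebesgue_on {0..T}. \<phi> t *\<^sub>R g t))"

text \<open>Determined up to a null set, whenever it exists.\<close>

definition weak_deriv :: "real \<Rightarrow> (real \<Rightarrow> complex) \<Rightarrow> real \<Rightarrow> complex" where
  "weak_deriv T f = (SOME g. has_weak_deriv T f g)"

definition H2_circle :: "real \<Rightarrow> (real \<Rightarrow> complex) \<Rightarrow> bool" where
  "H2_circle T f \<longleftrightarrow> L2_circle T f \<and>
     (\<exists>g h. has_weak_deriv T f g \<and> L2_circle T g \<and>
            has_weak_deriv T g h \<and> L2_circle T h)"


section \<open>Regular closed curves and the bending energy\<close>

abbreviation velocity :: "(real \<Rightarrow> complex) \<Rightarrow> real \<Rightarrow> complex" where
  "velocity \<gamma> t \<equiv> vector_derivative \<gamma> (at t)"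

text \<open>
  The continuous differentiability only fixes the representative of the Sobolev function:
  every element of \<open>H\<^sup>2\<close> of the circle has exactly one \<open>C\<^sup>1\<close> representative.
\<close>

definition regular_closed_curve :: "(real \<Rightarrow> complex) \<Rightarrow> bool" where
  "regular_closed_curve \<gamma> \<longleftrightarrow> periodic 1 \<gamma> \<and> H2_circle 1 \<gamma> \<and>
     \<gamma> C1_differentiable_on UNIV \<and> (\<forall>t. norm (velocity \<gamma> t) > 0)"

text \<open>Signed for negative \<open>t\<close>; an increasing bijection of \<open>\<real>\<close> if \<open>\<gamma>\<close> is a regular closed curve.\<close>

definition arc_length :: "(real \<Rightarrow> complex) \<Rightarrow> real \<Rightarrow> real" where
  "arc_length \<gamma> t = (LBINT u=ereal 0..ereal t. norm (velocity \<gamma> u))"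

definition curve_length :: "(real \<Rightarrow> complex) \<Rightarrow> real" where
  "curve_length \<gamma> = arc_length \<gamma> 1"

definition arc_length_param :: "(real \<Rightarrow> complex) \<Rightarrow> real \<Rightarrow> complex" where
  "arc_length_param \<gamma> = \<gamma> \<circ> inv (arc_length \<gamma>)"

definition bending_energy :: "(real \<Rightarrow> complex) \<Rightarrow> real" where
  "bending_energy \<gamma> = (let L = curve_length \<gamma> in
     LINT s|lebesgue_on {0..L}. (norm (weak_deriv L (weak_deriv L (arc_length_param \<gamma>)) s))\<^sup>2)"


section \<open>Admissible and minimal curves\<close>

definition tangential_self_intersections :: "(real \<Rightarrow> complex) \<Rightarrow> bool" where
  "tangential_self_intersections \<gamma> \<longleftrightarrow>
     (\<forall>s\<in>{0..<1}. \<forall>t\<in>{0..<1}. s \<noteq> t \<and> \<gamma> s = \<gamma> t \<longrightarrow>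
        (\<exists>c::real. velocity \<gamma> s = c *\<^sub>R velocity \<gamma> t))"

definition admissible :: "complex set \<Rightarrow> (real \<Rightarrow> complex) set" where
  "admissible \<Omega> = {\<gamma>. regular_closed_curve \<gamma> \<and> path_image \<gamma> \<subseteq> closure \<Omega> \<and>
     tangential_self_intersections \<gamma>}"

definition minimal_curve :: "complex set \<Rightarrow> (real \<Rightarrow> complex) \<Rightarrow> bool" where
  "minimal_curve \<Omega> \<gamma> \<longleftrightarrow> \<gamma> \<in> admissible \<Omega> \<and>
     (\<forall>\<gamma>'\<in>admissible \<Omega>. bending_energy \<gamma> \<le> bending_energy \<gamma>')"

definition constant_speed :: "(real \<Rightarrow> complex) \<Rightarrow> bool" where
  "constant_speed \<gamma> \<longleftrightarrow> (\<exists>c. \<forall>t. norm (velocity \<gamma> t) = c)"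

text \<open>
  In the coordinates centred at \<open>\<gamma> t\<close> whose real axis is spanned by the unit vector \<open>\<tau>\<close>, the
  branch of \<open>\<gamma>\<close> near parameter \<open>t\<close> is the graph of \<open>f\<close>. If \<open>\<tau>\<close> is tangent to \<open>\<gamma>\<close> at \<open>t\<close> and the
  velocity there is nonzero, the abscissae of that branch fill a neighbourhood of 0, so such an
  \<open>f\<close> exists and is uniquely determined near 0.
\<close>

definition branch_is_graph ::
    "(real \<Rightarrow> complex) \<Rightarrow> real \<Rightarrow> complex \<Rightarrow> (real \<Rightarrow> real) \<Rightarrow> bool" where
  "branch_is_graph \<gamma> t \<tau> f \<longleftrightarrow>
     (\<forall>\<^sub>F u in nhds t. Im ((\<gamma> u - \<gamma> t) / \<tau>) = f (Re ((\<gamma> u - \<gamma> t) / \<tau>)))"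

definition noncrossing :: "(real \<Rightarrow> complex) \<Rightarrow> bool" where
  "noncrossing \<gamma> \<longleftrightarrow>
     (\<forall>s\<in>{0..<1}. \<forall>t\<in>{0..<1}. s \<noteq> t \<and> \<gamma> s = \<gamma> t \<longrightarrow>
        (\<exists>f g. branch_is_graph \<gamma> t (sgn (velocity \<gamma> t)) f \<and>
               branch_is_graph \<gamma> s (sgn (velocity \<gamma> t)) g \<and>
               ((\<forall>\<^sub>F x in nhds 0. f x \<le> g x) \<or> (\<forall>\<^sub>F x in nhds 0. g x \<le> f x))))"

definition surrounded_set :: "(real \<Rightarrow> complex) \<Rightarrow> complex set" where
  "surrounded_set \<gamma> = path_image \<gamma> \<union> {z. z \<notin> path_image \<gamma> \<and> winding_number \<gamma> z \<noteq> 0}"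


section \<open>Domains with Lipschitz boundary\<close>

text \<open>
  Near each boundary point, after a rigid motion moving that point to the origin, the set is
  the part of a ball lying strictly below the graph of a Lipschitz function.
\<close>

definition lipschitz_boundary :: "complex set \<Rightarrow> bool" where
  "lipschitz_boundary \<Omega> \<longleftrightarrow>
     (\<forall>p\<in>frontier \<Omega>. \<exists>u r C f. norm u = 1 \<and> r > 0 \<and> lipschitz_on C (UNIV :: real set) f \<and>
        (\<forall>z\<in>ball 0 r. p + u * z \<in> \<Omega> \<longleftrightarrow> Im z < f (Re z)))"

end

theory Submission
  imports Defs
begin

text \<open>
  Let \<open>C\<close> be the convex hull of the minimal curve \<open>\<gamma>\<close>. Its boundary consists of points of \<open>\<gamma>\<close>, where
  it has the same tangent line as \<open>\<gamma>\<close>, and of segments. Hence it is a regular curve in the closure of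
  \<open>\<Omega>\<close> without self-intersections, and its energy is at most the part of the energy of \<open>\<gamma>\<close> carried by
  the contact parameters, each contact point being counted once. By minimality \<open>\<gamma>\<close> has no curvature
  off the contact set: leaving the boundary of \<open>C\<close>, it would follow the supporting line, which is
  impossible. So \<open>\<gamma>\<close> runs in the boundary of \<open>C\<close>, always turning in the same direction around each
  interior point of \<open>C\<close>, and it surrounds exactly \<open>C\<close>.

  For the energy estimate, the boundary is parametrized by arc length. A component of its unit tangent
  maps an interval onto a set covered by a countable set (the segments) and by the values, up to sign,
  of the same component of the tangent of \<open>\<gamma>\<close> at the contact parameters. Since arc lengths agree on
  the contact set, this bounds the increments of the tangent by an integral of the curvature of \<open>\<gamma>\<close>.
\<close>

section \<open>Smooth periodic test functions\<close>

text \<open>The contact parameters can form a Cantor-like set of positive measure, with infinitely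
  many boundary segments in between. The curvature of the boundary therefore cannot be assembled
  piece by piece, and agreement of the tangents on the contact set would not by itself exclude
  growth like that of the Cantor function. Measures of images decide the matter: a continuous real
  function grows by at most the measure of its range, while an absolutely continuous one maps a set
  to a set of measure at most the integral of the modulus of its density there. The first fact
  forces the passage to real components; the second works for every Borel set, however irregular.
  Nothing is lost in the energy, because each component of the new density is dominated pointwise by
  the same component of the old one. Keeping one parameter per contact point makes the change of
  variables injective. Convexity of \<Omega> keeps the competitor, which is drawn in the hull,
  inside the closure of \<Omega>.\<close>

definition smooth_upto :: "nat \<Rightarrow> (real \<Rightarrow> real) \<Rightarrow> bool" where
  "smooth_upto n f \<longleftrightarrow> (\<forall>k\<le>n. (deriv ^^ k) f differentiable_on UNIV)"

lemma smooth_iff_upto: "smooth f \<longleftrightarrow> (\<forall>n. smooth_upto n f)"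
  unfolding smooth_def smooth_upto_def by blast

lemma smooth_upto_0: "smooth_upto 0 f \<longleftrightarrow> f differentiable_on UNIV"
  by (simp add: smooth_upto_def)

lemma smooth_upto_Suc:
  "smooth_upto (Suc n) f \<longleftrightarrow> f differentiable_on UNIV \<and> smooth_upto n (deriv f)"
proof -
  have "(deriv ^^ Suc k) f = (deriv ^^ k) (deriv f)" for k
    by (simp add: funpow_Suc_right del: funpow.simps)
  moreover have "(\<forall>k\<le>Suc n. P k) \<longleftrightarrow> P 0 \<and> (\<forall>k\<le>n. P (Suc k))" for P :: "nat \<Rightarrow> bool"
    by (metis Suc_le_mono not0_implies_Suc zero_le)
  ultimately show ?thesis
    by (simp add: smooth_upto_def)
qed

lemma smooth_upto_Suc_D: "smooth_upto (Suc n) f \<Longrightarrow> smooth_upto n f"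
  by (simp add: smooth_upto_def)

lemma smooth_iff_deriv:
  "smooth f \<longleftrightarrow> f differentiable_on UNIV \<and> smooth (deriv f)"
proof
  assume f: "smooth f"
  then have "smooth_upto 0 f" "smooth_upto (Suc n) f" for n by (auto simp: smooth_iff_upto)
  then show "f differentiable_on UNIV \<and> smooth (deriv f)"
    by (simp add: smooth_iff_upto smooth_upto_Suc)
next
  assume f: "f differentiable_on UNIV \<and> smooth (deriv f)"
  have "smooth_upto n f" for n
    using f by (cases n) (auto simp: smooth_iff_upto smooth_upto_Suc smooth_upto_0)
  then show "smooth f" by (simp add: smooth_iff_upto)
qed

lemma differentiable_on_UNIV_has_deriv:
  fixes f :: "real \<Rightarrow> real"
  assumes "f differentiable_on UNIV" shows "(f has_real_derivative deriv f x) (at x)"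
  using assms by (simp add: DERIV_deriv_iff_real_differentiable differentiable_on_def)

lemma smooth_has_deriv:
  "smooth f \<Longrightarrow> (f has_real_derivative deriv f x) (at x)"
  by (rule differentiable_on_UNIV_has_deriv) (metis smooth_iff_deriv)

lemma smooth_upto_add:
  "smooth_upto n f \<Longrightarrow> smooth_upto n g \<Longrightarrow> smooth_upto n (\<lambda>x. f x + g x)"
proof (induction n arbitrary: f g)
  case 0 then show ?case by (simp add: smooth_upto_0 differentiable_on_add)
next
  case (Suc n)
  then have "f differentiable_on UNIV" "g differentiable_on UNIV" by (auto simp: smooth_upto_Suc)
  then have "deriv (\<lambda>x. f x + g x) = (\<lambda>x. deriv f x + deriv g x)"
    by (intro ext DERIV_imp_deriv derivative_intros differentiable_on_UNIV_has_deriv)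
  with Suc show ?case by (auto simp: smooth_upto_Suc differentiable_on_add)
qed

text \<open>Working with a finite order makes induction possible: the product rule reduces order
  \<open>n + 1\<close> to products of order \<open>n\<close>, in which the undifferentiated factor
  is lowered by \<open>smooth_upto_Suc_D\<close>.\<close>

lemma smooth_upto_mult:
  "smooth_upto n f \<Longrightarrow> smooth_upto n g \<Longrightarrow> smooth_upto n (\<lambda>x. f x * g x)"
proof (induction n arbitrary: f g)
  case 0 then show ?case by (simp add: smooth_upto_0 differentiable_on_mult)
next
  case (Suc n)
  then have d: "f differentiable_on UNIV" "g differentiable_on UNIV" by (auto simp: smooth_upto_Suc)
  have "deriv (\<lambda>x. f x * g x) = (\<lambda>x. deriv f x * g x + deriv g x * f x)"
    by (intro ext DERIV_imp_deriv) (metis DERIV_mult d differentiable_on_UNIV_has_deriv)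
  with Suc d smooth_upto_Suc_D[of n f] smooth_upto_Suc_D[of n g] show ?case
    by (auto simp: smooth_upto_Suc differentiable_on_mult intro!: smooth_upto_add)
qed

lemma smooth_upto_const: "smooth_upto n (\<lambda>x. c)"
proof (induction n arbitrary: c)
  case (Suc n)
  have "deriv (\<lambda>x::real. c) = (\<lambda>x. 0)" by (intro ext) simp
  with Suc[of 0] show ?case by (simp add: smooth_upto_Suc)
qed (simp add: smooth_upto_0)

lemma smooth_const: "smooth (\<lambda>x. c)"
  unfolding smooth_iff_upto by (intro allI smooth_upto_const)

lemma smooth_add: "smooth f \<Longrightarrow> smooth g \<Longrightarrow> smooth (\<lambda>x. f x + g x)"
  unfolding smooth_iff_upto by (intro allI smooth_upto_add) auto

lemma smooth_mult: "smooth f \<Longrightarrow> smooth g \<Longrightarrow> smooth (\<lambda>x. f x * g x)"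
  unfolding smooth_iff_upto by (intro allI smooth_upto_mult) auto

lemma smooth_sincos: "smooth_upto n (\<lambda>x. sin (a * x)) \<and> smooth_upto n (\<lambda>x. cos (a * x))"
proof (induction n)
  case 0 show ?case
    unfolding smooth_upto_0 differentiable_on_def real_differentiable_def
    by (auto intro!: exI derivative_eq_intros)
next
  case (Suc n)
  have "deriv (\<lambda>x. sin (a * x)) = (\<lambda>x. a * cos (a * x))"
    by (intro ext DERIV_imp_deriv) (auto intro!: derivative_eq_intros)
  moreover have "deriv (\<lambda>x. cos (a * x)) = (\<lambda>x. (- a) * sin (a * x))"
    by (intro ext DERIV_imp_deriv) (auto intro!: derivative_eq_intros)
  moreover have "(\<lambda>x. sin (a * x)) differentiable_on UNIV" "(\<lambda>x. cos (a * x)) differentiable_on UNIV"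
    unfolding differentiable_on_def real_differentiable_def
    by (auto intro!: exI derivative_eq_intros)
  ultimately show ?case
    using Suc smooth_upto_mult[OF smooth_upto_const[of n a]] smooth_upto_mult[OF smooth_upto_const[of n "- a"]]
    by (auto simp: smooth_upto_Suc)
qed

text \<open>Trigonometric approximation: because \<open>f 0 = f T\<close>, the function descends to
  the unit circle, where Stone-Weierstrass supplies a polynomial in the two coordinates. Composed
  with \<open>cis\<close> it is smooth and periodic.\<close>

lemma smooth_periodic_approx:
  fixes f :: "real \<Rightarrow> real"
  assumes T: "T > 0" and f0: "f 0 = f T" and cont: "continuous_on {0..T} f" and e: "e > 0"
  obtains \<phi> where "smooth \<phi>" "periodic T \<phi>" "\<And>x. x \<in> {0..T} \<Longrightarrow> \<bar>f x - \<phi> x\<bar> < e"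
proof -
  define a where "a = 2 * pi / T"
  have a: "a > 0" using T by (simp add: a_def)
  have aT: "a * T = 2 * pi" using T by (simp add: a_def)
  \<comment> \<open>Two points of a single period with the same image on the circle are equal or are
    the two endpoints, so only three values of \<open>m\<close> remain.\<close>
  have f_eq: "f x = f y"
    if "cis (a * x) = cis (a * y)" "x \<in> {0..T}" "y \<in> {0..T}" for x y
  proof -
    from that(1) obtain m :: int where "a * x = a * y + 2 * of_int m * pi"
      unfolding cis_conv_exp exp_eq by (auto simp: complex_eq_iff)
    then have "a * x = a * (y + of_int m * T)" using aT by (simp add: algebra_simps)
    then have m: "x = y + of_int m * T" using a by simp
    then have "\<bar>of_int m * T\<bar> \<le> 1 * T" using that by auto
    then have "\<bar>of_int m :: real\<bar> \<le> 1" using T by (simp add: abs_mult)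
    then have "m = 0 \<or> m = 1 \<or> m = -1" by linarith
    then show ?thesis using m that f0 by auto
  qed
  define p where "p x = cis (a * x)" for x
  define g where "g z = f (Arg2pi z / a)" for z
  have Arg: "cis (a * (Arg2pi z / a)) = z" if "norm z = 1" for z
    using a that complex_norm_eq_1_exp[of z] by (simp add: cis_conv_exp)
  have Arg_in: "Arg2pi z / a \<in> {0..T}" for z
    using a aT Arg2pi_ge_0[of z] Arg2pi_lt_2pi[of z] by (simp add: field_simps)
  have g_eq: "g (p x) = f x" if "x \<in> {0..T}" for x
    unfolding g_def p_def using that by (intro f_eq Arg Arg_in) auto
  \<comment> \<open>\<open>Arg2pi\<close> jumps at the positive axis, so continuity is not inherited
    from a composition. Instead, the preimage of a closed set under \<open>g\<close> is the image of
    a compact set under \<open>p\<close>.\<close>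
  have "continuous_on (sphere 0 1) g"
    unfolding continuous_on_closed_vimage[OF closed_sphere]
  proof (intro allI impI)
    fix B :: "real set" assume "closed B"
    have "g -` B \<inter> sphere 0 1 = p ` (f -` B \<inter> {0..T})"
    proof (intro set_eqI iffI)
      fix z assume z: "z \<in> g -` B \<inter> sphere 0 1"
      then have "z = p (Arg2pi z / a)" using Arg[of z] by (simp add: p_def)
      moreover have "f (Arg2pi z / a) \<in> B" using z by (simp add: g_def)
      ultimately show "z \<in> p ` (f -` B \<inter> {0..T})" using Arg_in[of z] by blast
    next
      fix z assume "z \<in> p ` (f -` B \<inter> {0..T})"
      then show "z \<in> g -` B \<inter> sphere 0 1" using g_eq by (auto simp: p_def)
    qed
    moreover have "compact (f -` B \<inter> {0..T})"
      using \<open>closed B\<close> cont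
      by (metis bounded_Int bounded_closed_interval box_real(2) closed_atLeastAtMost
          closed_vimage_Int compact_eq_bounded_closed inf_commute)
    moreover have "continuous_on (f -` B \<inter> {0..T}) p"
      unfolding p_def cis_conv_exp by (intro continuous_intros)
    ultimately show "closed (g -` B \<inter> sphere 0 1)"
      using compact_continuous_image compact_imp_closed by metis
  qed
  then obtain q where q: "real_polynomial_function q" "\<And>z. z \<in> sphere 0 1 \<Longrightarrow> \<bar>g z - q z\<bar> < e"
    using Stone_Weierstrass_real_polynomial_function[OF compact_sphere _ e] by metis
  show ?thesis
  proof
    show "smooth (\<lambda>x. q (cis (a * x)))"
      using q(1)
    proof induction
      case (linear h)
      have h: "h (cis (a * x)) = cos (a * x) * h 1 + sin (a * x) * h \<i>" for x
      proof -
        have "cis (a * x) = cos (a * x) *\<^sub>R 1 + sin (a * x) *\<^sub>R \<i>"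
          by (simp add: complex_eq_iff)
        then show ?thesis
          by (simp only: linear_add[OF bounded_linear.linear[OF linear]]
              linear_scale[OF bounded_linear.linear[OF linear]] real_scaleR_def)
      qed
      have "smooth (\<lambda>x. cos (a * x))" "smooth (\<lambda>x. sin (a * x))"
        using smooth_sincos by (auto simp: smooth_iff_upto)
      then show ?case unfolding h by (intro smooth_add smooth_mult smooth_const)
    next
      case (const c) show ?case by (rule smooth_const)
    next
      case (add f g) then show ?case by (intro smooth_add)
    next
      case (mult f g) then show ?case by (intro smooth_mult)
    qed
    show "periodic T (\<lambda>x. q (cis (a * x)))"
      using aT by (simp add: periodic_def distrib_left cis_mult[symmetric])
    show "\<bar>f x - q (cis (a * x))\<bar> < e" if "x \<in> {0..T}" for x
      using q(2)[of "p x"] g_eq[OF that] by (simp add: p_def)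
  qed
qed

section \<open>Absolutely continuous functions given by a density\<close>

text \<open>Absolute continuity, expressed by integrals instead of derivatives; Lebesgue
  differentiation then enters only in the uniqueness of \<open>k\<close>.\<close>

definition has_density :: "(real \<Rightarrow> 'a::euclidean_space) \<Rightarrow> (real \<Rightarrow> 'a) \<Rightarrow> real \<Rightarrow> real \<Rightarrow> bool" where
  "has_density F k a b \<longleftrightarrow> k absolutely_integrable_on {a..b} \<and>
     (\<forall>x\<in>{a..b}. F x = F a + integral {a..x} k)"

lemma has_density_abs_integrable: "has_density F k a b \<Longrightarrow> k absolutely_integrable_on {a..b}"
  unfolding has_density_def by (rule conjunct1)

lemma has_density_integrable:
  assumes "has_density F k a b" "a \<le> x" "y \<le> b"
  shows "k integrable_on {x..y}" "(\<lambda>t. norm (k t)) integrable_on {x..y}"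
proof -
  have "k absolutely_integrable_on {x..y}"
    using assms unfolding has_density_def
    by (auto intro: set_integrable_subset)
  then show "k integrable_on {x..y}" "(\<lambda>t. norm (k t)) integrable_on {x..y}"
    by (auto simp: absolutely_integrable_on_def)
qed

lemma has_density_diff:
  assumes "has_density F k a b" "a \<le> x" "x \<le> y" "y \<le> b"
  shows "F y - F x = integral {x..y} k"
proof -
  have "k integrable_on {a..y}" using has_density_integrable(1)[OF assms(1)] assms by auto
  then have "integral {a..x} k + integral {x..y} k = integral {a..y} k"
    using assms by (intro Henstock_Kurzweil_Integration.integral_combine) auto
  moreover have "F z = F a + integral {a..z} k" if "z \<in> {a..b}" for z
    using assms(1) that unfolding has_density_def by blast
  from this[of x] this[of y] have "F x = F a + integral {a..x} k" "F y = F a + integral {a..y} k"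
    using assms by simp_all
  ultimately show ?thesis by (metis add_diff_cancel_left add_diff_cancel_left')
qed

lemma has_densityI:
  assumes "k absolutely_integrable_on {a..b}"
    and "\<And>x. x \<in> {a..b} \<Longrightarrow> F x - F a = integral {a..x} k"
  shows "has_density F k a b"
  using assms unfolding has_density_def by (metis add.commute diff_eq_eq)

lemma has_density_diff_le:
  assumes "has_density F k a b" "a \<le> x" "x \<le> y" "y \<le> b"
  shows "norm (F y - F x) \<le> integral {x..y} (\<lambda>t. norm (k t))"
  unfolding has_density_diff[OF assms]
  using has_density_integrable[OF assms(1,2,4)]
  by (intro integral_norm_bound_integral) auto

lemma has_density_continuous:
  assumes "has_density F k a b"
  shows "continuous_on {a..b} F"
proof (cases "a \<le> b")
  case True
  have "continuous_on {a..b} (\<lambda>x. F a + integral {a..x} k)"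
    using has_density_integrable(1)[OF assms, of a b] True
    by (intro continuous_intros indefinite_integral_continuous_1) auto
  then show ?thesis
    by (rule continuous_on_eq) (use assms in \<open>unfold has_density_def, metis\<close>)
qed auto

lemma absolutely_integrable_scaleR_continuous:
  fixes k :: "real \<Rightarrow> 'a::euclidean_space"
  assumes "continuous_on {a..b} \<phi>" "k absolutely_integrable_on {a..b}"
  shows "(\<lambda>x. \<phi> x *\<^sub>R k x) absolutely_integrable_on {a..b}"
proof (rule absolutely_integrable_bounded_measurable_product[of scaleR])
  show "bilinear (scaleR :: real \<Rightarrow> 'a \<Rightarrow> 'a)"
    by (simp add: bilinear_def linear_iff algebra_simps)
  show "\<phi> \<in> borel_measurable (lebesgue_on {a..b})"
    by (intro continuous_imp_measurable_on_sets_lebesgue assms) auto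
  show "bounded (\<phi> ` {a..b})"
    by (intro compact_imp_bounded compact_continuous_image assms) auto
qed (use assms in auto)

text \<open>
  The candidate identity, as a function of the upper limit, has increments that are small compared
  with the length of the interval, hence zero derivative.
\<close>

lemma has_density_by_parts:
  fixes F k :: "real \<Rightarrow> 'a::euclidean_space"
  assumes F: "has_density F k a b" and ab: "a \<le> b"
    and \<phi>: "\<And>x. (\<phi> has_real_derivative \<phi>' x) (at x)" and \<phi>'c: "continuous_on UNIV \<phi>'"
  shows "integral {a..b} (\<lambda>x. \<phi>' x *\<^sub>R F x) =
     \<phi> b *\<^sub>R F b - \<phi> a *\<^sub>R F a - integral {a..b} (\<lambda>x. \<phi> x *\<^sub>R k x)"
proof -
  have \<phi>c: "continuous_on S \<phi>" for S
    using \<phi> by (meson DERIV_isCont continuous_at_imp_continuous_on)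
  have \<phi>'c: "continuous_on S \<phi>'" for S using \<phi>'c continuous_on_subset by blast
  have Fc: "continuous_on {a..b} F" by (rule has_density_continuous[OF F])
  have "bounded (\<phi>' ` {a..b})"
    by (intro compact_imp_bounded compact_continuous_image \<phi>'c) auto
  then obtain M where M: "\<And>x. x \<in> {a..b} \<Longrightarrow> \<bar>\<phi>' x\<bar> \<le> M"
    unfolding bounded_iff by (metis imageI real_norm_def)
  have M0: "M \<ge> 0" using M[of a] ab by auto
  have \<phi>L: "\<bar>\<phi> x - \<phi> y\<bar> \<le> M * \<bar>x - y\<bar>" if "x \<in> {a..b}" "y \<in> {a..b}" for x y
    using field_differentiable_bound[of "{a..b}" \<phi> \<phi>' M y x] M \<phi> that
    by (auto intro: has_field_derivative_at_within simp: abs_minus_commute)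
  have \<phi>k: "(\<lambda>x. \<phi> x *\<^sub>R k x) absolutely_integrable_on {a..b}"
    by (rule absolutely_integrable_scaleR_continuous[OF \<phi>c has_density_abs_integrable[OF F]])
  have int1: "(\<lambda>t. \<phi>' t *\<^sub>R F t) integrable_on {a..b}"
    by (intro integrable_continuous_interval continuous_intros \<phi>'c Fc)
  have int2: "(\<lambda>t. \<phi> t *\<^sub>R k t) integrable_on {a..b}"
    using \<phi>k by (auto simp: absolutely_integrable_on_def)
  define H where "H x = \<phi> x *\<^sub>R F x - integral {a..x} (\<lambda>t. \<phi>' t *\<^sub>R F t) -
     integral {a..x} (\<lambda>t. \<phi> t *\<^sub>R k t)" for x
  define V where "V x = integral {a..x} (\<lambda>t. norm (k t))" for x
  have V: "V y - V x = integral {x..y} (\<lambda>t. norm (k t))" if "a \<le> x" "x \<le> y" "y \<le> b" for x y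
    unfolding V_def
    using Henstock_Kurzweil_Integration.integral_combine[of a x y "\<lambda>t. norm (k t)"]
      has_density_integrable(2)[OF F, of a y] that by auto
  have Hle: "norm (H y - H x) \<le> 2 * M * (y - x) * (V y - V x)" if "a \<le> x" "x \<le> y" "y \<le> b" for x y
  proof -
    have i1: "(\<lambda>t. \<phi>' t *\<^sub>R F t) integrable_on {x..y}" "(\<lambda>t. \<phi> t *\<^sub>R k t) integrable_on {x..y}"
      using int1 int2 that by (auto intro: integrable_subinterval_real)
    have i2: "(\<lambda>t. \<phi>' t *\<^sub>R F y) integrable_on {x..y}"
      by (intro integrable_continuous_interval continuous_intros \<phi>'c)
    have i3: "(\<lambda>t. \<phi> x *\<^sub>R k t) integrable_on {x..y}"
      using has_density_integrable(1)[OF F that(1,3)] by (rule integrable_cmul)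
    have e1: "integral {a..y} f - integral {a..x} f = integral {x..y} f"
      if "f integrable_on {a..b}" for f :: "real \<Rightarrow> 'a"
    proof -
      have "f integrable_on {a..y}" using that \<open>y \<le> b\<close> by (auto intro: integrable_subinterval_real)
      then show ?thesis
        using Henstock_Kurzweil_Integration.integral_combine[of a x y f] \<open>a \<le> x\<close> \<open>x \<le> y\<close>
        by (auto simp: algebra_simps)
    qed
    have f1: "(\<phi> y - \<phi> x) *\<^sub>R F y = integral {x..y} (\<lambda>t. \<phi>' t *\<^sub>R F y)"
    proof -
      have "((\<lambda>t. \<phi>' t *\<^sub>R F y) has_integral (\<phi> y *\<^sub>R F y - \<phi> x *\<^sub>R F y)) {x..y}"
      proof (rule fundamental_theorem_of_calculus)
        show "((\<lambda>t. \<phi> t *\<^sub>R F y) has_vector_derivative \<phi>' t *\<^sub>R F y) (at t within {x..y})" for t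
          using has_vector_derivative_scaleR[OF has_field_derivative_at_within[OF \<phi>[of t]]
              has_vector_derivative_const[of "F y"]] by simp
      qed (use that in auto)
      then show ?thesis by (simp add: integral_unique scaleR_diff_left)
    qed
    have f2: "\<phi> x *\<^sub>R (F y - F x) = integral {x..y} (\<lambda>t. \<phi> x *\<^sub>R k t)"
      using has_density_diff[OF F that] by simp
    \<comment> \<open>Splitting with \<open>F\<close> at the right end and \<phi> at the left end
      turns both remainders into integrals of an oscillation, each at most
      \<open>M * (y - x) * (V y - V x)\<close>.\<close>
    have "H y - H x = (\<phi> y - \<phi> x) *\<^sub>R F y + \<phi> x *\<^sub>R (F y - F x)
        - integral {x..y} (\<lambda>t. \<phi>' t *\<^sub>R F t) - integral {x..y} (\<lambda>t. \<phi> t *\<^sub>R k t)"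
      unfolding H_def e1[OF int1, symmetric] e1[OF int2, symmetric] by (simp add: algebra_simps)
    also have "\<dots> = integral {x..y} (\<lambda>t. \<phi>' t *\<^sub>R (F y - F t)) + integral {x..y} (\<lambda>t. (\<phi> x - \<phi> t) *\<^sub>R k t)"
    proof -
      have J1: "integral {x..y} (\<lambda>t. \<phi>' t *\<^sub>R (F y - F t)) =
          integral {x..y} (\<lambda>t. \<phi>' t *\<^sub>R F y) - integral {x..y} (\<lambda>t. \<phi>' t *\<^sub>R F t)"
        using Henstock_Kurzweil_Integration.integral_diff[OF i2 i1(1)] by (simp add: scaleR_diff_right)
      have J2: "integral {x..y} (\<lambda>t. (\<phi> x - \<phi> t) *\<^sub>R k t) =
          integral {x..y} (\<lambda>t. \<phi> x *\<^sub>R k t) - integral {x..y} (\<lambda>t. \<phi> t *\<^sub>R k t)"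
        using Henstock_Kurzweil_Integration.integral_diff[OF i3 i1(2)] by (simp add: scaleR_diff_left)
      have "p + q - r - s = (p - r) + (q - s)" for p q r s :: 'a by simp
      then show ?thesis unfolding f1 f2 J1 J2 .
    qed
    finally have eq: "H y - H x = integral {x..y} (\<lambda>t. \<phi>' t *\<^sub>R (F y - F t)) + integral {x..y} (\<lambda>t. (\<phi> x - \<phi> t) *\<^sub>R k t)" .
    have nk: "(\<lambda>t. norm (k t)) integrable_on {x..y}"
      using has_density_integrable(2)[OF F that(1,3)] .
    have Vt: "norm (F y - F t) \<le> V y - V x" if "t \<in> {x..y}" for t
    proof -
      have t: "a \<le> t" "t \<le> y" "x \<le> t" "t \<le> b" using that \<open>a \<le> x\<close> \<open>y \<le> b\<close> by simp_all
      have "norm (F y - F t) \<le> V y - V t"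
        unfolding V[OF t(1,2) \<open>y \<le> b\<close>] by (rule has_density_diff_le[OF F t(1,2) \<open>y \<le> b\<close>])
      moreover have "0 \<le> V t - V x"
        unfolding V[OF \<open>a \<le> x\<close> t(3,4)]
        by (rule integral_nonneg[OF has_density_integrable(2)[OF F \<open>a \<le> x\<close> t(4)]]) simp
      ultimately show ?thesis by linarith
    qed
    have "norm (integral {x..y} (\<lambda>t. \<phi>' t *\<^sub>R (F y - F t))) \<le> integral {x..y} (\<lambda>t. M * (V y - V x))"
    proof (rule integral_norm_bound_integral)
      show "(\<lambda>t. \<phi>' t *\<^sub>R (F y - F t)) integrable_on {x..y}"
        using i1 i2 by (auto simp: scaleR_diff_right intro: Henstock_Kurzweil_Integration.integrable_diff)
      show "norm (\<phi>' t *\<^sub>R (F y - F t)) \<le> M * (V y - V x)" if "t \<in> {x..y}" for t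
        using Vt[OF that] M[of t] that \<open>a \<le> x\<close> \<open>y \<le> b\<close> M0 by (auto intro!: mult_mono)
    qed auto
    moreover have "norm (integral {x..y} (\<lambda>t. (\<phi> x - \<phi> t) *\<^sub>R k t))
        \<le> integral {x..y} (\<lambda>t. (M * (y - x)) * norm (k t))"
    proof (rule integral_norm_bound_integral)
      show "(\<lambda>t. (\<phi> x - \<phi> t) *\<^sub>R k t) integrable_on {x..y}"
        using i1 i3 by (auto simp: scaleR_diff_left intro: Henstock_Kurzweil_Integration.integrable_diff)
      show "(\<lambda>t. M * (y - x) * norm (k t)) integrable_on {x..y}"
        using integrable_cmul[OF nk, of "M * (y - x)"] by simp
      show "norm ((\<phi> x - \<phi> t) *\<^sub>R k t) \<le> M * (y - x) * norm (k t)" if "t \<in> {x..y}" for t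
      proof -
        have "\<bar>\<phi> x - \<phi> t\<bar> \<le> M * \<bar>x - t\<bar>"
          using that \<open>a \<le> x\<close> \<open>x \<le> y\<close> \<open>y \<le> b\<close> by (intro \<phi>L) auto
        also have "\<dots> \<le> M * (y - x)" using that M0 by (intro mult_left_mono) auto
        finally show ?thesis by (simp add: mult_right_mono)
      qed
    qed
    ultimately have "norm (integral {x..y} (\<lambda>t. \<phi>' t *\<^sub>R (F y - F t))) +
        norm (integral {x..y} (\<lambda>t. (\<phi> x - \<phi> t) *\<^sub>R k t)) \<le> 2 * M * (y - x) * (V y - V x)"
      using that unfolding integral_mult_right V[OF that, symmetric] by simp
    then show ?thesis
      unfolding eq by (rule order_trans[OF norm_triangle_ineq])
  qed
  have "\<exists>c. \<forall>x\<in>{a..b}. H x = c"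
  proof (rule has_derivative_zero_constant)
    fix x assume x: "x \<in> {a..b}"
    have "continuous_on {a..b} V"
      unfolding V_def
      by (rule indefinite_integral_continuous_1[OF has_density_integrable(2)[OF F order_refl order_refl]])
    then have "(V \<longlongrightarrow> V x) (at x within {a..b})" using x by (simp only: continuous_on)
    then have "((\<lambda>y. 2 * M * \<bar>V y - V x\<bar>) \<longlongrightarrow> 2 * M * \<bar>V x - V x\<bar>) (at x within {a..b})"
      by (intro tendsto_mult tendsto_rabs tendsto_diff tendsto_const)
    then have lim: "((\<lambda>y. 2 * M * \<bar>V y - V x\<bar>) \<longlongrightarrow> 0) (at x within {a..b})" by simp
    have "((\<lambda>y. norm (H y - H x) / norm (y - x)) \<longlongrightarrow> 0) (at x within {a..b})"
    proof (rule Lim_null_comparison[OF _ lim])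
      show "\<forall>\<^sub>F y in at x within {a..b}. norm (norm (H y - H x) / norm (y - x)) \<le> 2 * M * \<bar>V y - V x\<bar>"
        unfolding eventually_at_filter
      proof (rule always_eventually, intro allI impI)
        fix y assume y: "y \<noteq> x" "y \<in> {a..b}"
        have B: "norm (H v - H u) \<le> 2 * M * \<bar>v - u\<bar> * \<bar>V v - V u\<bar>"
          if "a \<le> u" "u \<le> v" "v \<le> b" for u v
        proof (rule order_trans[OF Hle[OF that]])
          have "2 * M * \<bar>v - u\<bar> * (V v - V u) \<le> 2 * M * \<bar>v - u\<bar> * \<bar>V v - V u\<bar>"
            using M0 by (intro mult_left_mono abs_ge_self) simp
          then show "2 * M * (v - u) * (V v - V u) \<le> 2 * M * \<bar>v - u\<bar> * \<bar>V v - V u\<bar>"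
            using that(2) by simp
        qed
        have "norm (H y - H x) \<le> 2 * M * \<bar>y - x\<bar> * \<bar>V y - V x\<bar>"
        proof (cases "x \<le> y")
          case True then show ?thesis using x y by (intro B) simp_all
        next
          case False
          have "norm (H x - H y) \<le> 2 * M * \<bar>x - y\<bar> * \<bar>V x - V y\<bar>"
            using False x y by (intro B) simp_all
          then show ?thesis
            by (simp only: norm_minus_commute[of "H x"] abs_minus_commute[of x] abs_minus_commute[of "V x"])
        qed
        then have "norm (H y - H x) / \<bar>y - x\<bar> \<le> 2 * M * \<bar>V y - V x\<bar>"
          using y(1) by (simp add: divide_le_eq ac_simps)
        then show "norm (norm (H y - H x) / norm (y - x)) \<le> 2 * M * \<bar>V y - V x\<bar>" by simp
      qed
    qed
    then show "(H has_derivative (\<lambda>h. 0)) (at x within {a..b})"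
      by (subst has_derivative_iff_norm) (auto intro: bounded_linear_zero)
  qed auto
  then have "H b = H a" using ab by auto
  then show "integral {a..b} (\<lambda>x. \<phi>' x *\<^sub>R F x) =
     \<phi> b *\<^sub>R F b - \<phi> a *\<^sub>R F a - integral {a..b} (\<lambda>x. \<phi> x *\<^sub>R k x)"
    by (simp add: H_def algebra_simps)
qed

text \<open>The difference of two densities integrates to zero over every subinterval, so it
  vanishes at each of its Lebesgue points.\<close>

lemma has_density_unique:
  fixes k k' :: "real \<Rightarrow> 'a::euclidean_space"
  assumes k: "has_density F k a b" and k': "has_density F k' a b"
  obtains N where "negligible N" "\<And>x. x \<in> {a..b} - N \<Longrightarrow> k x = k' x"
proof -
  define d where "d x = (if x \<in> {a..b} then k x - k' x else 0)" for x
  have "(\<lambda>x. k x - k' x) absolutely_integrable_on {a..b}"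
    using k k' by (intro set_integral_diff has_density_abs_integrable)
  then have "d absolutely_integrable_on UNIV"
    unfolding d_def by (simp only: absolutely_integrable_restrict_UNIV)
  then have int: "d integrable_on cbox x y" for x y
    by (meson absolutely_integrable_on_def integrable_on_subcbox subset_UNIV)
  obtain N where N: "negligible N" "\<And>x e. \<lbrakk>x \<notin> N; 0 < e\<rbrakk> \<Longrightarrow> \<exists>r>0. \<forall>h. 0 < h \<and> h < r \<longrightarrow>
      norm (integral (cbox x (x + h *\<^sub>R One)) d /\<^sub>R h ^ DIM(real) - d x) < e"
    using integrable_ccontinuous_explicit[OF int] by metis
  show ?thesis
  proof
    \<comment> \<open>The averages are taken to the right of \<open>x\<close>, so \<open>b\<close>
      has no admissible interval and joins the null set.\<close>
    show "negligible (insert b N)" using N(1) by (simp add: negligible_insert)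
    fix x assume x: "x \<in> {a..b} - insert b N"
    have "norm (d x) < e" if e: "e > 0" for e
    proof -
      obtain r where r: "r > 0" "\<And>h. 0 < h \<Longrightarrow> h < r \<Longrightarrow> norm (integral {x..x + h} d /\<^sub>R h - d x) < e"
        using N(2)[of x e] x e by auto
      define h where "h = min (r / 2) (b - x)"
      have h: "0 < h" "h < r" "x + h \<le> b" using r x unfolding h_def by auto
      have "integral {x..x + h} d = integral {x..x + h} (\<lambda>x. k x - k' x)"
        by (rule integral_cong) (use x h in \<open>auto simp: d_def\<close>)
      also have "\<dots> = integral {x..x + h} k - integral {x..x + h} k'"
        using has_density_integrable(1)[OF k] has_density_integrable(1)[OF k'] x h
        by (intro Henstock_Kurzweil_Integration.integral_diff) auto
      also have "\<dots> = 0"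
        using has_density_diff[OF k, of x "x + h"] has_density_diff[OF k', of x "x + h"] x h by simp
      finally show ?thesis using r(2)[OF h(1,2)] by simp
    qed
    then have "norm (d x) = 0" by (metis less_irrefl norm_ge_zero not_less_iff_gr_or_eq order_le_less)
    then show "k x = k' x" using x by (simp add: d_def)
  qed
qed

lemma has_density_C1:
  fixes F :: "real \<Rightarrow> 'a::euclidean_space"
  assumes "\<And>x. (F has_vector_derivative F' x) (at x)" "continuous_on UNIV F'"
  shows "has_density F F' a b"
proof (rule has_densityI)
  have c: "continuous_on S F'" for S using assms(2) continuous_on_subset by blast
  show "F' absolutely_integrable_on {a..b}"
    by (rule absolutely_integrable_continuous_real[OF c])
  fix x assume "x \<in> {a..b}"
  then have "(F' has_integral F x - F a) {a..x}"
    using assms(1) by (intro fundamental_theorem_of_calculus) (auto intro: has_vector_derivative_at_within)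
  then show "F x - F a = integral {a..x} F'" by (simp add: integral_unique)
qed

section \<open>Weak derivatives on the circle\<close>

lemma smooth_antiderivative:
  assumes "smooth \<psi>" obtains \<phi> where "smooth \<phi>" "deriv \<phi> = \<psi>"
proof
  define \<phi> where "\<phi> u = (LBINT y=ereal 0..ereal u. \<psi> y)" for u
  have cont: "continuous_on S \<psi>" for S
    using smooth_has_deriv[OF assms] by (meson DERIV_isCont continuous_at_imp_continuous_on)
  have d: "(\<phi> has_real_derivative \<psi> x) (at x)" for x
  proof -
    have "(\<phi> has_vector_derivative \<psi> x) (at x within {- \<bar>x\<bar> - 1..\<bar>x\<bar> + 1})"
      unfolding \<phi>_def by (rule interval_integral_FTC2[OF _ _ cont]) auto
    then show ?thesis
      by (simp add: at_within_Icc_at has_real_derivative_iff_has_vector_derivative)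
  qed
  then show "deriv \<phi> = \<psi>" by (intro ext DERIV_imp_deriv)
  moreover have "\<phi> differentiable_on UNIV"
    using d by (auto simp: differentiable_on_def real_differentiable_def)
  ultimately show "smooth \<phi>" using assms smooth_iff_deriv[of \<phi>] by simp
qed

lemma periodic_deriv:
  assumes "periodic T \<phi>" "\<And>x. (\<phi> has_vector_derivative \<phi>' x) (at x)"
  shows "periodic T \<phi>'"
  unfolding periodic_def
proof
  fix t
  have "((\<lambda>s. \<phi> (s + T)) has_vector_derivative \<phi>' (t + T)) (at t)"
    using vector_diff_chain_at[of "\<lambda>s. s + T" 1 t \<phi>] assms(2)[of "t + T"]
    by (force simp: o_def intro!: derivative_eq_intros)
  moreover have "(\<lambda>s. \<phi> (s + T)) = \<phi>" using assms(1) by (simp add: periodic_def)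
  ultimately show "\<phi>' (t + T) = \<phi>' t"
    using vector_derivative_unique_at[OF _ assms(2)[of t]] by simp
qed

text \<open>The derivatives of periodic test functions are exactly those of mean zero. They
  approximate \<open>f\<close> minus its mean uniformly, so this difference is orthogonal to
  itself.\<close>

lemma du_bois_reymond:
  fixes f :: "real \<Rightarrow> real"
  assumes T: "T > 0" and cont: "continuous_on {0..T} f" and f0: "f 0 = f T"
    and orth: "\<And>\<phi>. smooth \<phi> \<Longrightarrow> periodic T \<phi> \<Longrightarrow> integral {0..T} (\<lambda>x. deriv \<phi> x * f x) = 0"
    and x: "x \<in> {0..T}"
  shows "f x = f 0"
proof -
  define m where "m = integral {0..T} f / T"
  define h where "h x = f x - m" for x
  have hc: "continuous_on {0..T} h" unfolding h_def by (intro continuous_intros cont)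
  have h_int: "integral {0..T} h = 0"
    unfolding h_def using T integrable_continuous_interval[OF cont]
    by (subst Henstock_Kurzweil_Integration.integral_diff) (auto simp: m_def)
  have "bounded (h ` {0..T})"
    by (intro compact_imp_bounded compact_continuous_image hc) auto
  then obtain B where B: "\<And>x. x \<in> {0..T} \<Longrightarrow> \<bar>h x\<bar> \<le> B"
    unfolding bounded_iff by (metis imageI real_norm_def)
  have B0: "B \<ge> 0" using B[of 0] T by auto
  have hh: "(\<lambda>x. h x * h x) integrable_on {0..T}"
    by (intro integrable_continuous_interval continuous_intros hc)
  have small: "integral {0..T} (\<lambda>x. h x * h x) \<le> 2 * e * B * T" if e: "e > 0" for e
  proof -
    obtain \<psi> where \<psi>: "smooth \<psi>" "periodic T \<psi>" "\<And>x. x \<in> {0..T} \<Longrightarrow> \<bar>h x - \<psi> x\<bar> < e"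
      using smooth_periodic_approx[of T h e] T f0 hc e unfolding h_def by auto
    have \<psi>c: "continuous_on S \<psi>" for S
      using smooth_has_deriv[OF \<psi>(1)] by (meson DERIV_isCont continuous_at_imp_continuous_on)
    have \<psi>i: "\<psi> integrable_on {0..T}" by (intro integrable_continuous_interval \<psi>c)
    \<comment> \<open>Without its mean, \<psi> has a periodic antiderivative \<phi>, which is an
      allowed test function.\<close>
    define \<mu> where "\<mu> = integral {0..T} \<psi> / T"
    have mean0: "integral {0..T} (\<lambda>x. \<psi> x - \<mu>) = 0"
      using T \<psi>i by (subst Henstock_Kurzweil_Integration.integral_diff) (auto simp: \<mu>_def)
    have "smooth (\<lambda>x. \<psi> x + (- \<mu>))" by (intro smooth_add smooth_const \<psi>)
    then obtain \<phi> where \<phi>1: "smooth \<phi>" "deriv \<phi> = (\<lambda>x. \<psi> x + (- \<mu>))"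
      by (rule smooth_antiderivative)
    then have \<phi>: "smooth \<phi>" "deriv \<phi> = (\<lambda>x. \<psi> x - \<mu>)" by simp_all
    have \<phi>d: "(\<phi> has_real_derivative \<psi> x - \<mu>) (at x)" for x
      using smooth_has_deriv[OF \<phi>(1), of x] \<phi>(2) by simp
    have "periodic T \<phi>"
    proof -
      have "((\<lambda>t. \<phi> (t + T) - \<phi> t) has_real_derivative 0) (at t)" for t
      proof -
        have "((\<lambda>t. \<phi> (t + T)) has_real_derivative \<psi> (t + T) - \<mu>) (at t)"
          using \<phi>d[of "t + T"] by (simp add: DERIV_shift)
        moreover have "\<psi> (t + T) = \<psi> t" using \<psi>(2) by (simp add: periodic_def)
        ultimately show ?thesis using DERIV_diff[OF _ \<phi>d[of t]] by fastforce
      qed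
      then have "\<phi> (t + T) - \<phi> t = \<phi> (0 + T) - \<phi> 0" for t
        using DERIV_isconst_all[of "\<lambda>t. \<phi> (t + T) - \<phi> t" t 0] by blast
      moreover have "((\<lambda>x. \<psi> x - \<mu>) has_integral \<phi> T - \<phi> 0) {0..T}"
        using T \<phi>d by (intro fundamental_theorem_of_calculus)
          (auto simp: has_real_derivative_iff_has_vector_derivative intro: has_vector_derivative_at_within)
      then have "\<phi> T - \<phi> 0 = 0" using mean0 by (simp add: integral_unique)
      ultimately show ?thesis by (simp add: periodic_def)
    qed
    then have o1: "integral {0..T} (\<lambda>x. (\<psi> x - \<mu>) * f x) = 0"
      using orth[OF \<phi>(1)] \<phi>(2) by simp
    have o2: "integral {0..T} (\<lambda>x. (\<psi> x - \<mu>) * h x) = 0"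
    proof -
      have "integral {0..T} (\<lambda>x. (\<psi> x - \<mu>) * h x) =
          integral {0..T} (\<lambda>x. (\<psi> x - \<mu>) * f x - m * (\<psi> x - \<mu>))"
        by (rule integral_cong) (simp add: h_def algebra_simps)
      also have "\<dots> = integral {0..T} (\<lambda>x. (\<psi> x - \<mu>) * f x) - integral {0..T} (\<lambda>x. m * (\<psi> x - \<mu>))"
        by (intro Henstock_Kurzweil_Integration.integral_diff integrable_continuous_interval
            continuous_intros cont \<psi>c)
      finally show ?thesis by (simp only: o1 integral_mult_right mean0)
    qed
    \<comment> \<open>The correction is harmless: \<open>h\<close> has mean zero and \<psi> is
      \<open>e\<close>-close to it, so the mean of \<psi> is at most \<open>e\<close>. This accounts
      for the factor 2 in the error.\<close>
    have "\<bar>\<mu> * T\<bar> = \<bar>integral {0..T} (\<lambda>x. \<psi> x - h x)\<bar>"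
      using T h_int \<psi>i integrable_continuous_interval[OF hc]
      by (subst Henstock_Kurzweil_Integration.integral_diff) (auto simp: \<mu>_def)
    also have "\<dots> \<le> integral {0..T} (\<lambda>x. e)"
      unfolding real_norm_def[symmetric]
    proof (rule integral_norm_bound_integral)
      show "norm (\<psi> x - h x) \<le> e" if "x \<in> {0..T}" for x
        using \<psi>(3)[OF that] by simp
    qed (auto intro!: integrable_continuous_interval continuous_intros \<psi>c hc)
    finally have \<mu>: "\<bar>\<mu>\<bar> \<le> e" using T by (simp add: abs_mult)
    have "integral {0..T} (\<lambda>x. h x * h x) = integral {0..T} (\<lambda>x. h x * h x) - integral {0..T} (\<lambda>x. (\<psi> x - \<mu>) * h x)"
      using o2 by simp
    also have "\<dots> = integral {0..T} (\<lambda>x. h x * h x - (\<psi> x - \<mu>) * h x)"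
      by (intro Henstock_Kurzweil_Integration.integral_diff[symmetric] hh integrable_continuous_interval
            continuous_intros hc \<psi>c)
    also have "\<dots> \<le> integral {0..T} (\<lambda>x. 2 * e * B)"
    proof (rule integral_le)
      fix x assume x: "x \<in> {0..T}"
      have "(h x - \<psi> x + \<mu>) * h x \<le> \<bar>h x - \<psi> x + \<mu>\<bar> * \<bar>h x\<bar>"
        by (metis abs_ge_self abs_mult)
      also have "\<dots> \<le> (2 * e) * B"
        using \<psi>(3)[OF x] B[OF x] \<mu> e by (intro mult_mono) auto
      finally show "h x * h x - (\<psi> x - \<mu>) * h x \<le> 2 * e * B" by (simp add: algebra_simps)
    qed (intro integrable_continuous_interval continuous_intros hc \<psi>c)+
    finally show ?thesis using T by (simp add: algebra_simps)
  qed
  have "integral {0..T} (\<lambda>x. h x * h x) \<le> 0"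
  proof (rule field_le_epsilon)
    fix e :: real assume e: "e > 0"
    \<comment> \<open>The accuracy is chosen to make the bound at most \<open>e\<close>;
      \<open>B + 1\<close> replaces \<open>B\<close> since the bound \<open>B\<close> may be
      zero.\<close>
    have "integral {0..T} (\<lambda>x. h x * h x) \<le> 2 * (e / (2 * (B + 1) * T)) * B * T"
      using e T B0 by (intro small) auto
    also have "\<dots> = e * (B / (B + 1))"
      using T B0 add_pos_nonneg[of 1 B] by (simp add: divide_simps)
    also have "\<dots> \<le> e * 1" using e B0 by (intro mult_left_mono) simp_all
    finally show "integral {0..T} (\<lambda>x. h x * h x) \<le> 0 + e" by simp
  qed
  moreover have "integral {0..T} (\<lambda>x. h x * h x) \<ge> 0"
    by (rule integral_nonneg[OF hh]) simp
  ultimately have "\<forall>x\<in>{0..T}. h x * h x = 0"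
    using T by (subst integral_eq_0_iff[symmetric]) (auto intro!: continuous_intros hc)
  then show ?thesis using x T unfolding h_def by fastforce
qed

lemma integrable_lebesgue_on_iff:
  fixes f :: "real \<Rightarrow> 'a::euclidean_space"
  assumes "S \<in> sets lebesgue"
  shows "integrable (lebesgue_on S) f \<longleftrightarrow> f absolutely_integrable_on S"
  using assms by (simp add: set_integrable_def integrable_restrict_space)

text \<open>Integration by parts shows that \<open>F\<close> minus the indefinite integral of
  \<open>k\<close> is orthogonal to all derivatives of test functions, hence constant.\<close>

lemma weak_deriv_pairing_density:
  fixes F k :: "real \<Rightarrow> complex"
  assumes T: "T > 0" and F: "continuous_on {0..T} F" "F 0 = F T"
    and k: "k absolutely_integrable_on {0..T}"
    and weak: "\<And>\<phi>. smooth \<phi> \<Longrightarrow> periodic T \<phi> \<Longrightarrow>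
      integral {0..T} (\<lambda>t. deriv \<phi> t *\<^sub>R F t) = - integral {0..T} (\<lambda>t. \<phi> t *\<^sub>R k t)"
  shows "has_density F k 0 T"
proof (rule has_densityI[OF k])
  define G where "G x = integral {0..x} k" for x
  have G: "has_density G k 0 T"
    by (rule has_densityI[OF k]) (simp add: G_def)
  \<comment> \<open>The constant test function shows that \<open>k\<close> has mean zero, which
    makes its indefinite integral \<open>G\<close> periodic.\<close>
  have "deriv (\<lambda>x::real. 1::real) = (\<lambda>x. 0)" by (intro ext) simp
  then have "integral {0..T} k = 0"
    using weak[OF smooth_const[of 1]] by (simp add: periodic_def)
  then have G0: "G 0 = 0" "G T = 0" by (simp_all add: G_def)
  define f where "f x = F x - G x" for x
  have fc: "continuous_on {0..T} f"
    unfolding f_def by (intro continuous_intros F has_density_continuous[OF G])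
  have orth: "((\<lambda>x. deriv \<phi> x *\<^sub>R f x) has_integral 0) {0..T}"
    if \<phi>: "smooth \<phi>" "periodic T \<phi>" for \<phi>
  proof -
    have d: "continuous_on S (deriv \<phi>)" for S
      using \<phi>(1) smooth_has_deriv[of "deriv \<phi>"] smooth_iff_deriv[of \<phi>]
      by (meson DERIV_isCont continuous_at_imp_continuous_on)
    have i: "(\<lambda>x. deriv \<phi> x *\<^sub>R F x) integrable_on {0..T}" "(\<lambda>x. deriv \<phi> x *\<^sub>R G x) integrable_on {0..T}"
      by (intro integrable_continuous_interval continuous_intros d F has_density_continuous[OF G])+
    have "integral {0..T} (\<lambda>x. deriv \<phi> x *\<^sub>R G x) = - integral {0..T} (\<lambda>t. \<phi> t *\<^sub>R k t)"
      using has_density_by_parts[OF G _ smooth_has_deriv[OF \<phi>(1)] d] T G0 by simp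
    then show ?thesis
      using has_integral_diff[OF integrable_integral[OF i(1)] integrable_integral[OF i(2)]] weak[OF \<phi>]
      by (simp add: f_def scaleR_diff_right)
  qed
  have f0: "f 0 = f T" using F(2) G0 by (simp add: f_def)
  fix x assume x: "x \<in> {0..T}"
  have "Re (f x) = Re (f 0)"
  proof (rule du_bois_reymond[OF T _ _ _ x])
    show "integral {0..T} (\<lambda>x. deriv \<phi> x * Re (f x)) = 0" if "smooth \<phi>" "periodic T \<phi>" for \<phi>
      using has_integral_linear[OF orth[OF that] bounded_linear_Re] by (simp add: o_def integral_unique)
  qed (use fc f0 in \<open>auto intro!: continuous_intros\<close>)
  moreover have "Im (f x) = Im (f 0)"
  proof (rule du_bois_reymond[OF T _ _ _ x])
    show "integral {0..T} (\<lambda>x. deriv \<phi> x * Im (f x)) = 0" if "smooth \<phi>" "periodic T \<phi>" for \<phi>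
      using has_integral_linear[OF orth[OF that] bounded_linear_Im] by (simp add: o_def integral_unique)
  qed (use fc f0 in \<open>auto intro!: continuous_intros\<close>)
  ultimately have "f x = f 0" by (simp add: complex_eq_iff)
  then show "F x - F 0 = integral {0..x} k" using G0 by (simp add: f_def G_def algebra_simps)
qed

lemma smooth_continuous: "smooth \<phi> \<Longrightarrow> continuous_on S \<phi>"
  using smooth_has_deriv by (meson DERIV_isCont continuous_at_imp_continuous_on)

lemma smooth_deriv: "smooth \<phi> \<Longrightarrow> smooth (deriv \<phi>)"
  using smooth_iff_deriv[of \<phi>] by simp

lemma smooth_periodic_deriv: "smooth \<phi> \<Longrightarrow> periodic T \<phi> \<Longrightarrow> periodic T (deriv \<phi>)"
  by (rule periodic_deriv)
    (auto simp: has_real_derivative_iff_has_vector_derivative[symmetric] intro: smooth_has_deriv)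

text \<open>Continuous multiples of integrable functions are integrable, so the Bochner integrals
  can be exchanged for the gauge integrals used from here on.\<close>

lemma has_weak_deriv_iff:
  fixes f g :: "real \<Rightarrow> complex"
  shows "has_weak_deriv T f g \<longleftrightarrow> f absolutely_integrable_on {0..T} \<and> g absolutely_integrable_on {0..T} \<and>
     (\<forall>\<phi>. smooth \<phi> \<and> periodic T \<phi> \<longrightarrow>
       integral {0..T} (\<lambda>t. deriv \<phi> t *\<^sub>R f t) = - integral {0..T} (\<lambda>t. \<phi> t *\<^sub>R g t))"
proof -
  have eq: "(LINT t|lebesgue_on {0..T}. \<psi> t *\<^sub>R f t) = integral {0..T} (\<lambda>t. \<psi> t *\<^sub>R f t)"
    if "f absolutely_integrable_on {0..T}" "smooth \<psi>" for f :: "real \<Rightarrow> complex" and \<psi>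
    using absolutely_integrable_scaleR_continuous[OF smooth_continuous[OF that(2)] that(1)]
    by (intro lebesgue_integral_eq_integral) (auto simp: integrable_lebesgue_on_iff)
  have "integrable (lebesgue_on {0..T}) f \<longleftrightarrow> f absolutely_integrable_on {0..T}" for f :: "real \<Rightarrow> complex"
    by (rule integrable_lebesgue_on_iff) simp
  then show ?thesis
    unfolding has_weak_deriv_def
    by (intro conj_cong refl all_cong1 imp_cong) (auto simp: eq smooth_deriv)
qed

lemma has_weak_deriv_pairing:
  fixes f g :: "real \<Rightarrow> complex"
  assumes "has_weak_deriv T f g" "smooth \<phi>" "periodic T \<phi>"
  shows "integral {0..T} (\<lambda>t. deriv \<phi> t *\<^sub>R f t) = - integral {0..T} (\<lambda>t. \<phi> t *\<^sub>R g t)"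
  using assms unfolding has_weak_deriv_iff by blast

lemma has_weak_deriv_of_density:
  fixes F k :: "real \<Rightarrow> complex"
  assumes T: "T > 0" and per: "F 0 = F T" and F: "has_density F k 0 T"
  shows "has_weak_deriv T F k"
  unfolding has_weak_deriv_iff
proof (intro conjI allI impI)
  show "F absolutely_integrable_on {0..T}"
    by (intro absolutely_integrable_continuous_real has_density_continuous[OF F])
  show "k absolutely_integrable_on {0..T}" by (rule has_density_abs_integrable[OF F])
  fix \<phi> assume \<phi>: "smooth \<phi> \<and> periodic T \<phi>"
  have "\<phi> T = \<phi> 0" using \<phi> unfolding periodic_def by (metis add_0)
  then show "integral {0..T} (\<lambda>t. deriv \<phi> t *\<^sub>R F t) = - integral {0..T} (\<lambda>t. \<phi> t *\<^sub>R k t)"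
    using has_density_by_parts[OF F less_imp_le[OF T], of \<phi> "deriv \<phi>"] \<phi> per
    by (simp add: smooth_has_deriv smooth_continuous smooth_deriv)
qed

text \<open>A weak derivative \<open>g\<close> is known only up to a null set. Against derivatives
  of test functions it acts like the continuous \<open>\<alpha>'\<close>, so \<open>h\<close> is
  also a weak derivative of \<open>\<alpha>'\<close>.\<close>

lemma weak_deriv_twice_density:
  fixes \<alpha> :: "real \<Rightarrow> complex"
  assumes T: "T > 0" and per: "periodic T \<alpha>"
    and d: "\<And>x. (\<alpha> has_vector_derivative \<alpha>' x) (at x)" and c: "continuous_on UNIV \<alpha>'"
    and g: "has_weak_deriv T \<alpha> g" and h: "has_weak_deriv T g h"
  shows "has_density \<alpha>' h 0 T"
proof (rule weak_deriv_pairing_density[OF T])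
  show "continuous_on {0..T} \<alpha>'" using c continuous_on_subset by blast
  show "\<alpha>' 0 = \<alpha>' T" using periodic_deriv[OF per d] unfolding periodic_def by (metis add_0)
  show "h absolutely_integrable_on {0..T}" using h unfolding has_weak_deriv_iff by blast
  have "\<alpha> 0 = \<alpha> T" using per unfolding periodic_def by (metis add_0)
  then have \<alpha>': "has_weak_deriv T \<alpha> \<alpha>'"
    by (intro has_weak_deriv_of_density T has_density_C1 d c)
  fix \<phi> assume \<phi>: "smooth \<phi>" "periodic T \<phi>"
  note \<phi>' = smooth_deriv[OF \<phi>(1)] smooth_periodic_deriv[OF \<phi>]
  have "integral {0..T} (\<lambda>t. deriv \<phi> t *\<^sub>R \<alpha>' t) = integral {0..T} (\<lambda>t. deriv \<phi> t *\<^sub>R g t)"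
    using has_weak_deriv_pairing[OF \<alpha>' \<phi>'] has_weak_deriv_pairing[OF g \<phi>'] by (simp only: neg_equal_iff_equal)
  also have "\<dots> = - integral {0..T} (\<lambda>t. \<phi> t *\<^sub>R h t)"
    by (rule has_weak_deriv_pairing[OF h \<phi>])
  finally show "integral {0..T} (\<lambda>t. deriv \<phi> t *\<^sub>R \<alpha>' t) = - integral {0..T} (\<lambda>t. \<phi> t *\<^sub>R h t)" .
qed

text \<open>\<open>weak_deriv\<close> picks arbitrary representatives. Whatever is picked in the two
  steps, the second choice is again a density of \<open>\<alpha>'\<close> and agrees with
  \<open>k\<close> almost everywhere.\<close>

lemma energy_density:
  fixes \<alpha> :: "real \<Rightarrow> complex"
  assumes T: "T > 0" and per: "periodic T \<alpha>"
    and d: "\<And>x. (\<alpha> has_vector_derivative \<alpha>' x) (at x)" and c: "continuous_on UNIV \<alpha>'"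
    and k: "has_density \<alpha>' k 0 T" and L2: "(\<lambda>s. (norm (k s))\<^sup>2) integrable_on {0..T}"
  shows "(LINT s|lebesgue_on {0..T}. (norm (weak_deriv T (weak_deriv T \<alpha>) s))\<^sup>2) =
    integral {0..T} (\<lambda>s. (norm (k s))\<^sup>2)"
proof -
  define w where "w = weak_deriv T \<alpha>"
  define k2 where "k2 = weak_deriv T w"
  have "\<alpha> 0 = \<alpha> T" using per unfolding periodic_def by (metis add_0)
  then have \<alpha>': "has_weak_deriv T \<alpha> \<alpha>'"
    by (intro has_weak_deriv_of_density T has_density_C1 d c)
  then have w: "has_weak_deriv T \<alpha> w" unfolding w_def weak_deriv_def by (rule someI[of "has_weak_deriv T \<alpha>"])
  have "\<alpha>' 0 = \<alpha>' T" using periodic_deriv[OF per d] unfolding periodic_def by (metis add_0)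
  then have k': "has_weak_deriv T \<alpha>' k" by (intro has_weak_deriv_of_density T k)
  have "has_weak_deriv T w k"
    unfolding has_weak_deriv_iff
  proof (intro conjI allI impI)
    show "w absolutely_integrable_on {0..T}" "k absolutely_integrable_on {0..T}"
      using w k' unfolding has_weak_deriv_iff by blast+
    fix \<phi> assume \<phi>: "smooth \<phi> \<and> periodic T \<phi>"
    then have \<phi>': "smooth (deriv \<phi>)" "periodic T (deriv \<phi>)"
      by (simp_all add: smooth_deriv smooth_periodic_deriv)
    have "integral {0..T} (\<lambda>t. deriv \<phi> t *\<^sub>R w t) = integral {0..T} (\<lambda>t. deriv \<phi> t *\<^sub>R \<alpha>' t)"
      using has_weak_deriv_pairing[OF \<alpha>' \<phi>'] has_weak_deriv_pairing[OF w \<phi>'] by (simp only: neg_equal_iff_equal)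
    also have "\<dots> = - integral {0..T} (\<lambda>t. \<phi> t *\<^sub>R k t)"
      using \<phi> by (intro has_weak_deriv_pairing[OF k']) simp_all
    finally show "integral {0..T} (\<lambda>t. deriv \<phi> t *\<^sub>R w t) = - integral {0..T} (\<lambda>t. \<phi> t *\<^sub>R k t)" .
  qed
  then have "has_weak_deriv T w k2" unfolding k2_def weak_deriv_def by (rule someI[of "has_weak_deriv T w"])
  then have k2: "has_density \<alpha>' k2 0 T" by (rule weak_deriv_twice_density[OF T per d c w])
  obtain N where N: "negligible N" "\<And>x. x \<in> {0..T} - N \<Longrightarrow> k x = k2 x"
    using has_density_unique[OF k k2] by metis
  have i: "(\<lambda>s. (norm (k2 s))\<^sup>2) integrable_on {0..T}"
    by (rule integrable_spike[OF L2 N(1)]) (use N(2) in auto)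
  have "integral {0..T} (\<lambda>s. (norm (k s))\<^sup>2) = integral {0..T} (\<lambda>s. (norm (k2 s))\<^sup>2)"
    by (rule integral_spike[OF N(1)]) (use N(2) in auto)
  moreover have "(\<lambda>s. (norm (k2 s))\<^sup>2) absolutely_integrable_on {0..T}"
    by (rule nonnegative_absolutely_integrable_1[OF i]) simp
  then have "(LINT s|lebesgue_on {0..T}. (norm (k2 s))\<^sup>2) = integral {0..T} (\<lambda>s. (norm (k2 s))\<^sup>2)"
    by (intro lebesgue_integral_eq_integral) (simp_all add: integrable_lebesgue_on_iff)
  ultimately show ?thesis by (simp add: k2_def w_def)
qed

lemma L2_circle_continuous:
  assumes "continuous_on {0..T} f" shows "L2_circle T f"
  unfolding L2_circle_def using assms
  by (auto intro!: continuous_imp_measurable_on_sets_lebesgue absolutely_integrable_continuous_real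
      continuous_intros simp: integrable_lebesgue_on_iff)

lemma H2_circle_of_density:
  fixes \<alpha> :: "real \<Rightarrow> complex"
  assumes T: "T > 0" and per: "periodic T \<alpha>"
    and d: "\<And>x. (\<alpha> has_vector_derivative \<alpha>' x) (at x)" and c: "continuous_on UNIV \<alpha>'"
    and k: "has_density \<alpha>' k 0 T" and L2: "(\<lambda>s. (norm (k s))\<^sup>2) integrable_on {0..T}"
  shows "H2_circle T \<alpha>"
proof -
  have "\<alpha> 0 = \<alpha> T" using per unfolding periodic_def by (metis add_0)
  then have 1: "has_weak_deriv T \<alpha> \<alpha>'"
    by (intro has_weak_deriv_of_density T has_density_C1 d c)
  have "\<alpha>' 0 = \<alpha>' T" using periodic_deriv[OF per d] unfolding periodic_def by (metis add_0)
  then have 2: "has_weak_deriv T \<alpha>' k" by (intro has_weak_deriv_of_density T k)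
  have "continuous_on {0..T} \<alpha>"
    using d by (meson continuous_at_imp_continuous_on has_vector_derivative_continuous)
  then have 3: "L2_circle T \<alpha>" by (rule L2_circle_continuous)
  have "continuous_on {0..T} \<alpha>'" using c continuous_on_subset by blast
  then have 4: "L2_circle T \<alpha>'" by (rule L2_circle_continuous)
  have "(\<lambda>s. (norm (k s))\<^sup>2) absolutely_integrable_on {0..T}"
    by (rule nonnegative_absolutely_integrable_1[OF L2]) simp
  then have 5: "L2_circle T k"
    using absolutely_integrable_measurable[of "{0..T}" k] has_density_abs_integrable[OF k]
    unfolding L2_circle_def by (simp add: integrable_lebesgue_on_iff)
  show ?thesis unfolding H2_circle_def using 1 2 3 4 5 by blast
qed

text \<open>The factor \<open>c\<close> is for velocities: with \<open>c = r\<close> the function is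
  the derivative of a curve whose parameter has been stretched by \<open>r\<close>. It is used with
  both equal to \<open>L\<close> and both equal to \<open>1 / L\<close>.\<close>

lemma has_density_rescale:
  fixes F k :: "real \<Rightarrow> 'a::euclidean_space"
  assumes F: "has_density F k 0 T" and r: "r > 0"
  shows "has_density (\<lambda>s. c *\<^sub>R F (r * s)) (\<lambda>s. (c * r) *\<^sub>R k (r * s)) 0 (T / r)"
proof -
  have sub: "(\<lambda>s. \<bar>r\<bar> *\<^sub>R f (r * s)) absolutely_integrable_on {0..x} \<and>
      integral {0..x} (\<lambda>s. \<bar>r\<bar> *\<^sub>R f (r * s)) = integral {0..r * x} f"
    if "f absolutely_integrable_on {0..r * x}" "0 \<le> x" for x and f :: "real \<Rightarrow> 'a"
  proof -
    have "(\<lambda>s. r * s) ` {0..x} = {0..r * x}" using r that by (simp add: image_mult_atLeastAtMost)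
    then show ?thesis
      using has_absolute_integral_change_of_variables_real[of "{0..x}" "\<lambda>s. r * s" "\<lambda>s. r" f "integral {0..r * x} f"]
        that r by (auto intro!: derivative_eq_intros simp: inj_on_def)
  qed
  have k: "k absolutely_integrable_on {0..T}" by (rule has_density_abs_integrable[OF F])
  have k': "k absolutely_integrable_on {0..r * x}" if "x \<le> T / r" for x
  proof (rule set_integrable_subset[OF k])
    have "r * x \<le> T" using that r by (simp add: field_simps)
    then show "{0..r * x} \<subseteq> {0..T}" by auto
  qed auto
  show ?thesis
  proof (cases "0 \<le> T / r")
    case True
    show ?thesis
    proof (rule has_densityI)
      have "(\<lambda>s. c *\<^sub>R (\<bar>r\<bar> *\<^sub>R k (r * s))) absolutely_integrable_on {0..T / r}"
        by (intro absolutely_integrable_scaleR_continuous continuous_on_const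
            conjunct1[OF sub[OF k'[OF order_refl] True]])
      then show "(\<lambda>s. (c * r) *\<^sub>R k (r * s)) absolutely_integrable_on {0..T / r}" using r by simp
      fix x assume x: "x \<in> {0..T / r}"
      have rx: "0 \<le> r * x" "r * x \<le> T" using x r by (simp_all add: field_simps)
      have "c *\<^sub>R F (r * x) - c *\<^sub>R F (r * 0) = c *\<^sub>R integral {0..r * x} k"
        using has_density_diff[OF F order_refl rx] by (simp flip: scaleR_diff_right)
      also have "\<dots> = c *\<^sub>R integral {0..x} (\<lambda>s. r *\<^sub>R k (r * s))"
        using sub[OF k'[of x]] x r by simp
      finally show "c *\<^sub>R F (r * x) - c *\<^sub>R F (r * 0) = integral {0..x} (\<lambda>s. (c * r) *\<^sub>R k (r * s))"
        by (simp flip: integral_cmul)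
    qed
  next
    case False then show ?thesis by (auto intro!: has_densityI)
  qed
qed

lemma square_integrable_rescale:
  fixes f :: "real \<Rightarrow> real"
  assumes "f integrable_on {0..T}" "T \<ge> 0" and r: "r > 0" and nn: "\<And>x. f x \<ge> 0"
  shows "(\<lambda>s. f (r * s)) integrable_on {0..T / r}"
proof -
  have "f absolutely_integrable_on {0..T}"
    by (rule nonnegative_absolutely_integrable_1) (use assms in auto)
  moreover have "(\<lambda>s. r * s) ` {0..T / r} = {0..T}" using r assms by (simp add: image_mult_atLeastAtMost)
  ultimately have "(\<lambda>s. \<bar>r\<bar> *\<^sub>R f (r * s)) absolutely_integrable_on {0..T / r}"
    using absolutely_integrable_change_of_variables_real[of "{0..T / r}" "\<lambda>s. r * s" "\<lambda>s. r" f] r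
    by (auto intro!: derivative_eq_intros simp: inj_on_def)
  then have "(\<lambda>s. r * f (r * s)) integrable_on {0..T / r}"
    using r by (simp add: absolutely_integrable_on_def)
  then show ?thesis using r by (simp add: integrable_on_cmult_iff)
qed

section \<open>Measures with a Lebesgue density\<close>

text \<open>
  A density is only Lebesgue measurable, while regularity is available for Borel measures; the
  image under the identity forgets the completion.
\<close>

definition density_measure :: "(real \<Rightarrow> real) \<Rightarrow> real \<Rightarrow> real measure" where
  "density_measure g T = distr (density lebesgue (\<lambda>x. ennreal (indicator {0..T} x * g x))) borel (\<lambda>x. x)"

lemma sets_density_measure [simp]: "sets (density_measure g T) = sets borel"
  by (simp add: density_measure_def)

lemma space_density_measure [simp]: "space (density_measure g T) = UNIV"
  by (simp add: density_measure_def)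

lemma emeasure_density_measure:
  assumes g: "g absolutely_integrable_on {0..T}" and nn: "\<And>x. g x \<ge> 0" and B: "B \<in> sets borel"
  shows "emeasure (density_measure g T) B = ennreal (integral (B \<inter> {0..T}) g)"
proof -
  let ?f = "\<lambda>x. indicator {0..T} x * g x"
  have fi: "integrable lebesgue ?f" using g by (simp add: set_integrable_def)
  then have fm: "?f \<in> borel_measurable lebesgue" by simp
  have BL: "B \<in> sets lebesgue" using B by simp
  have idm: "(\<lambda>x. x) \<in> measurable (density lebesgue (\<lambda>x. ennreal (?f x))) borel"
    by (simp add: measurable_completion)
  have gB: "set_integrable lebesgue (B \<inter> {0..T}) g"
    by (rule set_integrable_subset[OF g]) (use BL in auto)
  have "emeasure (density_measure g T) B = emeasure (density lebesgue (\<lambda>x. ennreal (?f x))) B"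
    unfolding density_measure_def using idm B by (subst emeasure_distr) auto
  also have "\<dots> = (\<integral>\<^sup>+x. ennreal (?f x) * indicator B x \<partial>lebesgue)"
    using fm BL by (subst emeasure_density) auto
  also have "\<dots> = (\<integral>\<^sup>+x. ennreal (indicator (B \<inter> {0..T}) x * g x) \<partial>lebesgue)"
    by (intro nn_integral_cong) (auto simp: indicator_def)
  also have "\<dots> = ennreal (LINT x|lebesgue. indicator (B \<inter> {0..T}) x * g x)"
    using gB nn by (intro nn_integral_eq_integral) (auto simp: set_integrable_def)
  also have "(LINT x|lebesgue. indicator (B \<inter> {0..T}) x * g x) = integral (B \<inter> {0..T}) g"
    using set_lebesgue_integral_eq_integral(2)[OF gB] by (simp add: set_lebesgue_integral_def)
  finally show ?thesis .
qed

lemma interval_image_cover: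
  fixes F :: "real \<Rightarrow> real"
  assumes "S \<noteq> {}" and d: "\<And>x y. x \<in> S \<Longrightarrow> y \<in> S \<Longrightarrow> \<bar>F x - F y\<bar> \<le> d"
  obtains lo hi where "F ` S \<subseteq> {lo..hi}" "hi - lo \<le> d" "lo \<le> hi"
proof
  obtain x0 where x0: "x0 \<in> S" using assms(1) by blast
  have bd: "bdd_above (F ` S)" "bdd_below (F ` S)"
    using d[OF x0] by (auto intro!: bdd_aboveI[of _ "F x0 + d"] bdd_belowI[of _ "F x0 - d"] simp: abs_le_iff) force+
  show "F ` S \<subseteq> {Inf (F ` S)..Sup (F ` S)}"
    using bd by (auto intro: cINF_lower cSUP_upper)
  have "Sup (F ` S) \<le> Inf (F ` S) + d"
  proof (rule cSUP_least[OF assms(1)])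
    fix x assume x: "x \<in> S"
    have "F x - d \<le> Inf (F ` S)"
      by (rule cINF_greatest[OF assms(1)]) (use d[OF x] in \<open>fastforce simp: abs_le_iff\<close>)
    then show "F x \<le> Inf (F ` S) + d" by simp
  qed
  then show "Sup (F ` S) - Inf (F ` S) \<le> d" by simp
  show "Inf (F ` S) \<le> Sup (F ` S)"
    using bd x0 by (meson cINF_lower cSUP_upper order_trans)
qed

text \<open>
  Cover the set by an open set of almost the same measure, and that one by its components.
\<close>

lemma has_density_image_cover:
  fixes F k :: "real \<Rightarrow> real"
  assumes F: "has_density F k 0 T" and E: "E \<in> sets borel" "E \<subseteq> {0..T}" and e: "e > 0"
  obtains W where "W \<in> sets lebesgue" "F ` E \<subseteq> W"
    "emeasure lebesgue W \<le> ennreal (integral E (\<lambda>x. \<bar>k x\<bar>) + e)"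
proof -
  define N where "N = density_measure (\<lambda>x. \<bar>k x\<bar>) T"
  have k: "(\<lambda>x. \<bar>k x\<bar>) absolutely_integrable_on {0..T}"
    using set_integrable_abs[OF has_density_abs_integrable[OF F]] .
  have N: "emeasure N B = ennreal (integral (B \<inter> {0..T}) (\<lambda>x. \<bar>k x\<bar>))" if "B \<in> sets borel" for B
    unfolding N_def using that by (intro emeasure_density_measure[OF k]) auto
  have "emeasure N E = (INF U\<in>{U. E \<subseteq> U \<and> open U}. emeasure N U)"
    by (rule outer_regular) (use E(1) N[of UNIV] in \<open>auto simp: N_def\<close>)
  moreover have "emeasure N E < emeasure N E + ennreal e"
    using e N[OF E(1)] by (simp add: ennreal_add_eq_top less_top flip: ennreal_plus)
  ultimately obtain U where U: "E \<subseteq> U" "open U" "emeasure N U < emeasure N E + ennreal e"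
    by (auto simp: INF_less_iff)
  \<comment> \<open>Components of \<open>U\<close> may stick out of \<open>{0..T}\<close>, where
    \<open>F\<close> is not controlled; only their traces on that interval count.\<close>
  define P where "P = {I \<in> components U. I \<inter> {0..T} \<noteq> {}}"
  have Po: "open I" if "I \<in> P" for I using that U(2) open_components by (auto simp: P_def)
  have "pairwise disjnt P"
    using pairwise_disjoint_components[of U] by (auto simp: P_def pairwise_def disjnt_def)
  then have cP: "countable P" using Po by (intro countable_disjoint_open_subsets)
  have dia: "\<bar>F x - F y\<bar> \<le> integral (I \<inter> {0..T}) (\<lambda>x. \<bar>k x\<bar>)"
    if I: "I \<in> P" and x: "x \<in> I \<inter> {0..T}" and y: "y \<in> I \<inter> {0..T}" for I x y
  proof -
    have main: "\<bar>F y - F x\<bar> \<le> integral (I \<inter> {0..T}) (\<lambda>x. \<bar>k x\<bar>)"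
      if "x \<le> y" "x \<in> I \<inter> {0..T}" "y \<in> I \<inter> {0..T}" for x y
    proof -
      have "connected I" using I in_components_connected by (auto simp: P_def)
      then have sub: "{x..y} \<subseteq> I \<inter> {0..T}" using that connected_contains_Icc by fastforce
      have "norm (F y - F x) \<le> integral {x..y} (\<lambda>t. norm (k t))"
        using that by (intro has_density_diff_le[OF F]) auto
      also have "\<dots> \<le> integral (I \<inter> {0..T}) (\<lambda>t. norm (k t))"
      proof (rule integral_subset_le[OF sub])
        show "(\<lambda>t. norm (k t)) integrable_on {x..y}"
          using that by (intro has_density_integrable(2)[OF F]) auto
        have "set_integrable lebesgue (I \<inter> {0..T}) (\<lambda>x. \<bar>k x\<bar>)"
          by (rule set_integrable_subset[OF k]) (use Po[OF I] in auto)
        then show "(\<lambda>t. norm (k t)) integrable_on I \<inter> {0..T}"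
          using set_lebesgue_integral_eq_integral(1) by (simp add: set_lebesgue_integral_eq_integral(1))
      qed auto
      finally show ?thesis by simp
    qed
    show ?thesis using main[of x y] main[of y x] x y by (cases "x \<le> y") (auto simp: abs_minus_commute)
  qed
  have "\<exists>J. J \<in> sets lebesgue \<and> F ` (I \<inter> {0..T}) \<subseteq> J \<and> emeasure lebesgue J \<le> emeasure N I"
    if I: "I \<in> P" for I
  proof -
    have "I \<inter> {0..T} \<noteq> {}" using I by (simp add: P_def)
    then obtain lo hi where lh: "F ` (I \<inter> {0..T}) \<subseteq> {lo..hi}"
        "hi - lo \<le> integral (I \<inter> {0..T}) (\<lambda>x. \<bar>k x\<bar>)" "lo \<le> hi"
      by (rule interval_image_cover[OF _ dia[OF I]])
    have "emeasure lebesgue {lo..hi} = ennreal (hi - lo)" using lh(3) by simp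
    also have "\<dots> \<le> emeasure N I"
      using lh(2) Po[OF I] by (subst N) (auto intro: ennreal_leI)
    finally show ?thesis using lh(1) by (intro exI[of _ "{lo..hi}"]) auto
  qed
  then obtain J where J: "\<And>I. I \<in> P \<Longrightarrow> J I \<in> sets lebesgue"
      "\<And>I. I \<in> P \<Longrightarrow> F ` (I \<inter> {0..T}) \<subseteq> J I" "\<And>I. I \<in> P \<Longrightarrow> emeasure lebesgue (J I) \<le> emeasure N I"
    by metis
  define idx where "idx = to_nat_on P"
  have inj: "inj_on idx P" unfolding idx_def by (rule inj_on_to_nat_on[OF cP])
  define pc where "pc n = (if n \<in> idx ` P then the_inv_into P idx n else {})" for n
  define jc where "jc n = (if n \<in> idx ` P then J (pc n) else {})" for n
  have pc: "pc n \<in> P" if "n \<in> idx ` P" for n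
    using that the_inv_into_into[OF inj that order_refl] by (simp add: pc_def)
  have pc_idx: "pc (idx I) = I" if "I \<in> P" for I
    using that the_inv_into_f_f[OF inj that] by (simp add: pc_def)
  have pc_open: "open (pc n)" for n
    using pc[of n] Po by (cases "n \<in> idx ` P") (auto simp: pc_def)
  have disj: "disjoint_family pc"
    unfolding disjoint_family_on_def
  proof (intro ballI impI)
    fix m n :: nat assume "m \<noteq> n"
    show "pc m \<inter> pc n = {}"
    proof (cases "m \<in> idx ` P \<and> n \<in> idx ` P")
      case True
      then obtain I I' where I: "I \<in> P" "m = idx I" "I' \<in> P" "n = idx I'" by blast
      with \<open>m \<noteq> n\<close> have "I \<noteq> I'" by blast
      then show ?thesis using I pc_idx \<open>pairwise disjnt P\<close> by (auto simp: pairwise_def disjnt_def)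
    qed (auto simp: pc_def)
  qed
  show thesis
  proof
    show meas: "(\<Union>n. jc n) \<in> sets lebesgue"
      using J(1) pc by (intro sets.countable_UN) (auto simp: jc_def)
    show "F ` E \<subseteq> (\<Union>n. jc n)"
    proof
      fix y assume "y \<in> F ` E"
      then obtain x where x: "x \<in> E" "y = F x" by blast
      then have "x \<in> U" "x \<in> {0..T}" using U(1) E(2) by auto
      then obtain I where I: "I \<in> components U" "x \<in> I" using Union_components[of U] by blast
      then have "I \<in> P" using \<open>x \<in> {0..T}\<close> by (auto simp: P_def)
      moreover have "y \<in> J I" using J(2)[OF \<open>I \<in> P\<close>] x I \<open>x \<in> {0..T}\<close> by blast
      ultimately show "y \<in> (\<Union>n. jc n)" using pc_idx by (intro UN_I[of "idx I"]) (auto simp: jc_def)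
    qed
    have "emeasure lebesgue (\<Union>n. jc n) \<le> (\<Sum>n. emeasure lebesgue (jc n))"
      by (rule emeasure_subadditive_countably) (use J(1) pc in \<open>auto simp: jc_def\<close>)
    also have "\<dots> \<le> (\<Sum>n. emeasure N (pc n))"
      using J(3) pc by (intro suminf_le) (auto simp: jc_def)
    also have "\<dots> = emeasure N (\<Union>n. pc n)"
      using disj pc_open by (intro suminf_emeasure) (auto simp: N_def)
    also have "\<dots> \<le> emeasure N U"
    proof (rule emeasure_mono)
      show "(\<Union>n. pc n) \<subseteq> U"
      proof
        fix x assume "x \<in> (\<Union>n. pc n)"
        then obtain n where n: "x \<in> pc n" by blast
        then have "n \<in> idx ` P" by (auto simp: pc_def split: if_splits)
        from pc[OF this] n show "x \<in> U" using in_components_subset by (auto simp: P_def)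
      qed
    qed (use U(2) in \<open>auto simp: N_def\<close>)
    also have "\<dots> \<le> emeasure N E + ennreal e" using U(3) by simp
    also have "\<dots> = ennreal (integral E (\<lambda>x. \<bar>k x\<bar>) + e)"
    proof -
      have "E \<inter> {0..T} = E" using E(2) by blast
      moreover have "(\<lambda>x. \<bar>k x\<bar>) integrable_on E"
        using set_lebesgue_integral_eq_integral(1)[OF set_integrable_subset[OF k _ E(2)]] E(1) by simp
      then have "integral E (\<lambda>x. \<bar>k x\<bar>) \<ge> 0" by (rule integral_nonneg) simp
      ultimately show ?thesis using e by (simp add: N[OF E(1)] flip: ennreal_plus)
    qed
    finally show "emeasure lebesgue (\<Union>n. jc n) \<le> ennreal (integral E (\<lambda>x. \<bar>k x\<bar>) + e)" .
  qed
qed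

lemma emeasure_interval_measure_cont:
  assumes "\<And>x y. x \<le> y \<Longrightarrow> V x \<le> V y" "continuous_on UNIV V" "a \<le> b"
  shows "emeasure (interval_measure V) {a<..b} = ennreal (V b - V a)"
  using assms by (intro emeasure_interval_measure_Ioc)
    (auto simp: continuous_on_eq_continuous_within intro: continuous_within_subset)

text \<open>
  With \<open>G = \<integral> g\<close>, both \<open>G + u\<close> and \<open>G - u\<close> are monotone and their Stieltjes measures add up to
  \<open>2 g dx\<close>, so both have densities with respect to it.
\<close>

lemma dominated_increments_density:
  fixes u g :: "real \<Rightarrow> real"
  assumes T: "T \<ge> 0" and g: "g absolutely_integrable_on {0..T}" and nn: "\<And>x. g x \<ge> 0"
    and u: "\<And>x y. 0 \<le> x \<Longrightarrow> x \<le> y \<Longrightarrow> y \<le> T \<Longrightarrow> \<bar>u y - u x\<bar> \<le> integral {x..y} g"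
  obtains w where "has_density u w 0 T" "\<And>x. \<bar>w x\<bar> \<le> g x"
proof -
  \<comment> \<open>Clamping to \<open>{0..T}\<close> extends both functions by constants, since
    Stieltjes measures are built from functions on the whole line.\<close>
  define cl where "cl x = max 0 (min T x)" for x
  have cl: "0 \<le> cl x" "cl x \<le> T" "x \<le> y \<Longrightarrow> cl x \<le> cl y" "x \<in> {0..T} \<Longrightarrow> cl x = x" for x y
    using T by (auto simp: cl_def)
  define G where "G x = integral {0..cl x} g" for x
  define U where "U x = u (cl x)" for x
  have gi: "g integrable_on {x..y}" if "0 \<le> x" "y \<le> T" for x y
    using g that by (auto intro: integrable_subinterval_real simp: absolutely_integrable_on_def)
  have Gd: "G y - G x = integral {cl x..cl y} g" if "x \<le> y" for x y
    using Henstock_Kurzweil_Integration.integral_combine[of 0 "cl x" "cl y" g] gi[of 0 "cl y"] cl[of x] cl[of y] that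
    by (simp add: G_def)
  have UG: "\<bar>U y - U x\<bar> \<le> G y - G x" if "x \<le> y" for x y
    unfolding Gd[OF that] U_def using u[of "cl x" "cl y"] cl[of x] cl[of y] that by simp
  have Gc: "continuous_on UNIV G"
  proof -
    have "continuous_on {0..T} (\<lambda>x. integral {0..x} g)"
      by (rule indefinite_integral_continuous_1[OF gi]) auto
    moreover have "continuous_on UNIV cl" unfolding cl_def by (intro continuous_intros)
    ultimately show ?thesis unfolding G_def[abs_def] by (rule continuous_on_compose2) (use cl in auto)
  qed
  have Uc: "continuous_on UNIV U"
    unfolding continuous_on_def
  proof
    fix x :: real
    have UG': "\<bar>U y - U x\<bar> \<le> \<bar>G y - G x\<bar>" for y
      using UG[of x y] UG[of y x] by (cases "x \<le> y") (auto simp: abs_minus_commute)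
    have "((\<lambda>y. \<bar>G y - G x\<bar>) \<longlongrightarrow> \<bar>G x - G x\<bar>) (at x)"
      using Gc by (intro tendsto_intros) (simp add: continuous_on_def)
    then have "((\<lambda>y. \<bar>G y - G x\<bar>) \<longlongrightarrow> 0) (at x)" by simp
    then have "((\<lambda>y. U y - U x) \<longlongrightarrow> 0) (at x)"
      by (rule Lim_null_comparison[rotated]) (use UG' in auto)
    then show "(U \<longlongrightarrow> U x) (at x within UNIV)" using LIM_zero_cancel by blast
  qed
  define m1 m2 where "m1 = interval_measure (\<lambda>x. G x + U x)" and "m2 = interval_measure (\<lambda>x. G x - U x)"
  have s[simp]: "sets m1 = sets borel" "sets m2 = sets borel" "space m1 = UNIV" "space m2 = UNIV"
    by (simp_all add: m1_def m2_def)
  have mono: "G x + U x \<le> G y + U y" "G x - U x \<le> G y - U y" if "x \<le> y" for x y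
    using UG[OF that] by (simp_all add: abs_le_iff)
  have m1: "emeasure m1 {a<..b} = ennreal ((G b + U b) - (G a + U a))" if "a \<le> b" for a b
    unfolding m1_def by (intro emeasure_interval_measure_cont continuous_intros Gc Uc mono that)
  have m2: "emeasure m2 {a<..b} = ennreal ((G b - U b) - (G a - U a))" if "a \<le> b" for a b
    unfolding m2_def by (intro emeasure_interval_measure_cont continuous_intros Gc Uc mono that)
  have g2: "(\<lambda>x. 2 * g x) absolutely_integrable_on {0..T}" using g by (rule set_integrable_mult_right)
  define nu where "nu = density_measure (\<lambda>x. 2 * g x) T"
  have [simp]: "sets nu = sets borel" "space nu = UNIV" by (simp_all add: nu_def)
  have nu: "emeasure nu B = ennreal (integral (B \<inter> {0..T}) (\<lambda>x. 2 * g x))" if "B \<in> sets borel" for B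
    unfolding nu_def using nn by (intro emeasure_density_measure g2 that) auto
  have nuI: "emeasure nu {a<..b} = ennreal (2 * (G b - G a))" if ab: "a \<le> b" for a b
  proof -
    have "integral ({a<..b} \<inter> {0..T}) (\<lambda>x. 2 * g x) = integral {cl a..cl b} (\<lambda>x. 2 * g x)"
      by (rule integral_spike_set; rule negligible_subset[of "{a, b, 0, T}"]) (auto simp: cl_def max_def min_def split: if_splits)
    then show ?thesis using nu[of "{a<..b}"] Gd[OF ab] by simp
  qed
  define S where "S = measure_of UNIV (sets borel) (\<lambda>A. emeasure m1 A + emeasure m2 A)"
  have sS: "sets S = sets borel" "space S = UNIV"
    unfolding S_def by (simp_all add: sets.sigma_sets_eq[of borel, simplified])
  have S: "emeasure S A = emeasure m1 A + emeasure m2 A" if "A \<in> sets borel" for A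
  proof (rule emeasure_measure_of[OF S_def])
    show "countably_additive (sets S) (\<lambda>A. emeasure m1 A + emeasure m2 A)"
    proof (rule countably_additiveI)
      fix A :: "nat \<Rightarrow> real set" assume A: "range A \<subseteq> sets S" "disjoint_family A"
      then show "(\<Sum>i. emeasure m1 (A i) + emeasure m2 (A i)) = emeasure m1 (\<Union> (range A)) + emeasure m2 (\<Union> (range A))"
        using suminf_emeasure[of A m1] suminf_emeasure[of A m2] sS
        by (simp add: suminf_add[symmetric])
    qed
  qed (use that sS in \<open>auto simp: positive_def\<close>)
  \<comment> \<open>On half-open intervals the contributions of \<open>U\<close> cancel, and these
    intervals form an intersection-stable generator of the Borel sets.\<close>
  have "S = nu"
  proof (rule measure_eqI_generator_eq[where E="range (\<lambda>(a, b). {a<..b})" and \<Omega>=UNIV and A="\<lambda>n. {- real n<..real n}"])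
    show "Int_stable (range (\<lambda>(a, b). {a<..b::real}))" by (auto simp: Int_stable_def)
    show "sets S = sigma_sets UNIV (range (\<lambda>(a, b). {a<..b}))" "sets nu = sigma_sets UNIV (range (\<lambda>(a, b). {a<..b}))"
      by (simp_all add: sS borel_sigma_sets_Ioc)
    have eq: "emeasure S {a<..b} = emeasure nu {a<..b}" for a b
    proof (cases "a \<le> b")
      case True
      have "emeasure S {a<..b} = ennreal ((G b + U b) - (G a + U a)) + ennreal ((G b - U b) - (G a - U a))"
        by (simp only: S[OF greaterThanAtMost_borel] m1[OF True] m2[OF True])
      also have "\<dots> = ennreal (2 * (G b - G a))"
        using mono[OF True] by (simp flip: ennreal_plus)
      finally show ?thesis by (simp only: nuI[OF True])
    qed simp
    show "emeasure S X = emeasure nu X" if "X \<in> range (\<lambda>(a, b). {a<..b})" for X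
      using that
    proof (rule rangeE)
      fix p assume "X = (case p of (a, b) \<Rightarrow> {a<..b})"
      then have "X = {fst p<..snd p}" by (simp only: case_prod_beta)
      then show ?thesis by (simp only: eq)
    qed
    show "(\<Union>n. {- real n<..real n}) = UNIV"
    proof -
      have "\<exists>n. x \<in> {- real n<..real n}" for x :: real
      proof -
        obtain n where "\<bar>x\<bar> < real n" using reals_Archimedean2 by blast
        then have "x \<in> {- real n<..real n}" by auto
        then show ?thesis by blast
      qed
      then show ?thesis by blast
    qed
    show "emeasure S {- real n<..real n} \<noteq> \<infinity>" for n
      using m1[of "- real n" "real n"] m2[of "- real n" "real n"] by (simp add: S)
  qed (auto simp: image_subset_iff)
  then have sum: "emeasure m1 A + emeasure m2 A = emeasure nu A" if "A \<in> sets borel" for A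
    using S[OF that] by simp
  have "finite_measure nu" by (rule finite_measureI) (simp add: nu)
  then interpret nu: finite_measure nu .
  have ac: "absolutely_continuous nu m1" "absolutely_continuous nu m2"
    unfolding absolutely_continuous_def null_sets_def using sum by (auto, (metis add_eq_0_iff_both_eq_0)+)
  obtain h1 where h1: "h1 \<in> borel_measurable nu" "density nu h1 = m1"
    using nu.Radon_Nikodym[OF ac(1)] by auto
  obtain h2 where h2: "h2 \<in> borel_measurable nu" "density nu h2 = m2"
    using nu.Radon_Nikodym[OF ac(2)] by auto
  have "density nu (\<lambda>x. h1 x + h2 x) = density nu (\<lambda>x. 1)"
  proof (rule measure_eqI)
    fix A assume "A \<in> sets (density nu (\<lambda>x. h1 x + h2 x))"
    then have A: "A \<in> sets nu" by simp
    have "emeasure (density nu (\<lambda>x. h1 x + h2 x)) A = emeasure (density nu h1) A + emeasure (density nu h2) A"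
    proof -
      note [measurable] = h1(1) h2(1) A
      show ?thesis
        using A by (subst (1 2 3) emeasure_density) (auto simp: distrib_right intro!: nn_integral_add)
    qed
    then show "emeasure (density nu (\<lambda>x. h1 x + h2 x)) A = emeasure (density nu (\<lambda>x. 1)) A"
      using A sum[of A] unfolding h1(2) h2(2) by (simp add: emeasure_density)
  qed simp
  then have "AE x in nu. h1 x + h2 x = 1"
    using h1(1) h2(1) nu.emeasure_finite[of UNIV]
    by (subst (asm) eq_commute, subst (asm) finite_density_unique) (auto elim: eventually_mono)
  \<comment> \<open>The Radon-Nikodym density of \<open>m1\<close> is at most 1 only almost
    everywhere. Cutting it off at 1 gives a bound for \<open>w\<close> at every point.\<close>
  define r where "r x = enn2real (min 1 (h1 x))" for x
  have r01: "0 \<le> r x" "r x \<le> 1" for x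
    unfolding r_def by (auto intro!: enn2real_leI)
  have rm: "r \<in> borel_measurable borel"
  proof -
    have [measurable]: "h1 \<in> borel_measurable borel"
      using h1(1) by (subst (asm) measurable_cong_sets[of nu borel borel borel]) simp_all
    show ?thesis unfolding r_def by measurable
  qed
  have "AE x in nu. ennreal (r x) = h1 x"
    using \<open>AE x in nu. h1 x + h2 x = 1\<close>
  proof eventually_elim
    fix x assume "h1 x + h2 x = 1"
    moreover have "h1 x \<le> h1 x + h2 x" by simp
    ultimately have "h1 x \<le> 1" by simp
    then show "ennreal (r x) = h1 x" unfolding r_def
      by (simp add: min_absorb2 ennreal_enn2real_if top_unique) (metis ennreal_one_less_top leD)
  qed
  moreover have rn: "(\<lambda>x. ennreal (r x)) \<in> borel_measurable nu"
    using measurable_compose[OF rm measurable_ennreal]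
    by (subst measurable_cong_sets[of nu borel borel borel]) simp_all
  ultimately have m1r: "m1 = density nu (\<lambda>x. ennreal (r x))"
    using h1 by (subst h1(2)[symmetric], intro density_cong) auto
  \<comment> \<open>\<open>G + u\<close> has density \<open>2 * g * r\<close>; removing the density
    \<open>g\<close> of \<open>G\<close> leaves that of \<open>u\<close>.\<close>
  define w where "w x = g x * (2 * r x - 1)" for x
  have rg: "(\<lambda>x. r x * g x) absolutely_integrable_on {0..T}"
  proof (rule absolutely_integrable_bounded_measurable_product_real)
    show "r \<in> borel_measurable (lebesgue_on {0..T})"
      using rm by (intro measurable_restrict_space1 measurable_completion) simp
    show "bounded (r ` {0..T})" using r01 by (auto simp: bounded_iff intro!: exI[of _ 1])
  qed (use g in auto)
  have w_ai: "w absolutely_integrable_on {0..T}"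
    using set_integral_diff(1)[OF set_integrable_mult_right[OF rg, of 2] g]
    by (simp add: w_def[abs_def] algebra_simps)
  show thesis
  proof
    show "\<bar>w x\<bar> \<le> g x" for x
    proof -
      have "\<bar>2 * r x - 1\<bar> \<le> 1" using r01[of x] by (simp add: abs_le_iff)
      then have "g x * \<bar>2 * r x - 1\<bar> \<le> g x * 1" using nn by (intro mult_left_mono)
      then show ?thesis using nn[of x] by (simp add: w_def abs_mult)
    qed
    show "has_density u w 0 T"
    proof (rule has_densityI[OF w_ai])
      fix x assume x: "x \<in> {0..T}"
      have x0: "(0::real) \<le> x" using x by simp
      have "{0<..x} \<inter> {0..T} = {0<..x}" using x by auto
      have rgx: "(\<lambda>y. r y * (2 * g y)) absolutely_integrable_on {0<..x}"
        by (rule set_integrable_subset[OF set_integrable_mult_right[OF rg, of 2, simplified mult.left_commute]]) (use x in auto)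
      have "emeasure m1 {0<..x} = (\<integral>\<^sup>+y. ennreal (r y) * indicator {0<..x} y \<partial>nu)"
        unfolding m1r using rn by (subst emeasure_density) auto
      also have "\<dots> = (\<integral>\<^sup>+y. ennreal (r y) * indicator {0<..x} y
          \<partial>density lebesgue (\<lambda>y. ennreal (indicator {0..T} y * (2 * g y))))"
        unfolding nu_def density_measure_def using rm
        by (subst nn_integral_distr) (auto simp: measurable_completion)
      also have "\<dots> = (\<integral>\<^sup>+y. ennreal (indicator {0..T} y * (2 * g y)) * (ennreal (r y) * indicator {0<..x} y) \<partial>lebesgue)"
      proof (rule nn_integral_density)
        show "(\<lambda>y. ennreal (indicator {0..T} y * (2 * g y))) \<in> borel_measurable lebesgue"
          using g2 by (auto simp: set_integrable_def)
        show "(\<lambda>y. ennreal (r y) * indicator {0<..x} y) \<in> borel_measurable lebesgue"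
          using rm by (auto intro!: measurable_completion)
      qed
      also have "\<dots> = (\<integral>\<^sup>+y. ennreal (indicator {0<..x} y * (r y * (2 * g y))) \<partial>lebesgue)"
        using x r01 nn by (intro nn_integral_cong) (auto simp: indicator_def ennreal_mult'[symmetric] mult.commute)
      also have "\<dots> = ennreal (LINT y|lebesgue. indicator {0<..x} y * (r y * (2 * g y)))"
        using rgx nn r01 by (intro nn_integral_eq_integral) (auto simp: set_integrable_def)
      also have "(LINT y|lebesgue. indicator {0<..x} y * (r y * (2 * g y))) = integral {0<..x} (\<lambda>y. r y * (2 * g y))"
        using set_lebesgue_integral_eq_integral(2)[OF rgx] by (simp add: set_lebesgue_integral_def)
      also have "\<dots> = integral {0..x} (\<lambda>y. r y * (2 * g y))"
        by (rule integral_spike_set; rule negligible_subset[of "{0}"]) auto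
      finally have "ennreal ((G x + U x) - (G 0 + U 0)) = ennreal (integral {0..x} (\<lambda>y. r y * (2 * g y)))"
        using m1[OF x0] by simp
      moreover have "(G x + U x) - (G 0 + U 0) \<ge> 0" using UG[OF x0] by (simp add: abs_le_iff)
      moreover have i2: "(\<lambda>y. r y * (2 * g y)) integrable_on {0..x}"
        using absolutely_integrable_on_subinterval[OF set_integrable_mult_right[OF rg, of 2, simplified mult.left_commute], of 0 x] x
        by (auto simp: absolutely_integrable_on_def)
      then have "integral {0..x} (\<lambda>y. r y * (2 * g y)) \<ge> 0" by (rule integral_nonneg) (use nn r01 in auto)
      ultimately have "(G x + U x) - (G 0 + U 0) = integral {0..x} (\<lambda>y. r y * (2 * g y))" by simp
      then have "u x - u 0 = integral {0..x} (\<lambda>y. r y * (2 * g y)) - integral {0..x} g"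
        using x T by (simp add: U_def G_def cl)
      also have "\<dots> = integral {0..x} (\<lambda>y. r y * (2 * g y) - g y)"
        using x by (intro Henstock_Kurzweil_Integration.integral_diff[symmetric] i2 gi) auto
      finally show "u x - u 0 = integral {0..x} w" by (simp add: w_def[abs_def] algebra_simps)
    qed
  qed
qed

section \<open>The boundary of the convex hull of a closed curve\<close>

locale closed_unit_curve =
  fixes L :: real and \<alpha> \<alpha>' :: "real \<Rightarrow> complex"
  assumes L_pos: "L > 0"
    and periodic: "periodic L \<alpha>"
    and deriv: "(\<alpha> has_vector_derivative \<alpha>' s) (at s)"
    and deriv_cont: "continuous_on UNIV \<alpha>'"
    and unit: "norm (\<alpha>' s) = 1"
begin

lemma cont: "continuous_on S \<alpha>"
  using deriv by (meson continuous_at_imp_continuous_on has_vector_derivative_continuous)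

lemma periodic_int: "\<alpha> (s + of_int m * L) = \<alpha> s"
proof -
  have P: "\<alpha> (t + real n * L) = \<alpha> t" for t n
  proof (induction n)
    case (Suc n)
    have "\<alpha> (t + real (Suc n) * L) = \<alpha> ((t + real n * L) + L)" by (simp add: algebra_simps)
    then show ?case using periodic Suc by (simp add: periodic_def)
  qed simp
  show ?thesis
  proof (cases "m \<ge> 0")
    case True then show ?thesis using P[of s "nat m"] by simp
  next
    case False
    then show ?thesis using P[of "s + of_int m * L" "nat (- m)"] by (simp add: algebra_simps)
  qed
qed

lemma range_eq: "range \<alpha> = \<alpha> ` {0..<L}"
proof -
  have "\<exists>t\<in>{0..<L}. \<alpha> t = \<alpha> s" for s
  proof
    have "of_int \<lfloor>s / L\<rfloor> \<le> s / L" "s / L < of_int \<lfloor>s / L\<rfloor> + 1" by linarith+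
    then have "of_int \<lfloor>s / L\<rfloor> * L \<le> s" "s < (of_int \<lfloor>s / L\<rfloor> + 1) * L"
      using L_pos by (simp_all only: pos_le_divide_eq pos_divide_less_eq)
    then show "s - of_int \<lfloor>s / L\<rfloor> * L \<in> {0..<L}" by (simp add: algebra_simps)
    show "\<alpha> (s - of_int \<lfloor>s / L\<rfloor> * L) = \<alpha> s"
      using periodic_int[of s "- \<lfloor>s / L\<rfloor>"] by simp
  qed
  then show ?thesis by (metis (mono_tags, lifting) image_iff rangeE rangeI subsetI subset_antisym)
qed

definition C :: "complex set" where "C = convex hull (range \<alpha>)"

lemma compact_range: "compact (range \<alpha>)"
proof -
  have "range \<alpha> = \<alpha> ` {0..L}"
    using range_eq by (metis atLeastLessThan_subseteq_atLeastAtMost_iff image_mono order_refl subset_UNIV subset_antisym)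
  then show ?thesis by (metis compact_Icc compact_continuous_image cont)
qed

lemma compact_C: "compact C" and convex_C: "convex C"
  unfolding C_def by (simp_all add: compact_range compact_convex_hull)

lemma curve_in_C: "\<alpha> s \<in> C"
  unfolding C_def by (simp add: hull_inc)

text \<open>Otherwise the curve lies on a line with normal \<open>a\<close>. Where the coordinate
  along this line is maximal, the velocity has no component along the line, and it never has one
  across it, which contradicts unit speed.\<close>

lemma interior_C_nonempty: "interior C \<noteq> {}"
proof
  assume "interior C = {}"
  then obtain a b where ab: "a \<noteq> 0" "C \<subseteq> {x. a \<bullet> x = b}"
    using empty_interior_subset_hyperplane[OF convex_C] by metis
  have d: "((\<lambda>s. v \<bullet> \<alpha> s) has_real_derivative v \<bullet> \<alpha>' s) (at s)" for v s
    using bounded_linear.has_vector_derivative[OF bounded_linear_inner_right deriv]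
    by (simp add: has_real_derivative_iff_has_vector_derivative)
  have "continuous_on {0..L} (\<lambda>s. (\<i> * a) \<bullet> \<alpha> s)" by (intro continuous_intros cont)
  then obtain m where m: "m \<in> {0..L}" "\<And>s. s \<in> {0..L} \<Longrightarrow> (\<i> * a) \<bullet> \<alpha> s \<le> (\<i> * a) \<bullet> \<alpha> m"
    using continuous_attains_sup[of "{0..L}" "\<lambda>s. (\<i> * a) \<bullet> \<alpha> s"] L_pos by force
  have "(\<i> * a) \<bullet> \<alpha> s \<le> (\<i> * a) \<bullet> \<alpha> m" for s
  proof -
    obtain t where "t \<in> {0..<L}" "\<alpha> s = \<alpha> t" using range_eq by (metis imageE rangeI)
    then show ?thesis using m(2)[of t] by simp
  qed
  then have "(\<i> * a) \<bullet> \<alpha>' m = 0"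
    using DERIV_local_max[OF d[of "\<i> * a" m], of 1] by simp
  moreover have "a \<bullet> \<alpha>' m = 0"
  proof -
    have "(\<lambda>s. a \<bullet> \<alpha> s) = (\<lambda>s. b)" using ab(2) curve_in_C by (intro ext) blast
    then show ?thesis using d[of a m] by (metis DERIV_const DERIV_unique)
  qed
  ultimately have "Re a * Im (\<alpha>' m) = Im a * Re (\<alpha>' m)" "Re a * Re (\<alpha>' m) = - Im a * Im (\<alpha>' m)"
    by (simp_all add: inner_complex_def)
  then have "((Re a)\<^sup>2 + (Im a)\<^sup>2) * ((Re (\<alpha>' m))\<^sup>2 + (Im (\<alpha>' m))\<^sup>2) = 0" by algebra
  then show False using ab(1) unit[of m] by (simp add: cmod_power2[symmetric])
qed

end

text \<open>Translation achieves this for any closed curve, because the hull has interior points.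
  The origin becomes the centre of polar coordinates.\<close>

locale hull_curve = closed_unit_curve +
  assumes zero_interior: "0 \<in> interior C"
begin

text \<open>
  Outer normals are normalized by \<open>x \<bullet> \<nu> = 1\<close> on the supporting line, which makes them points
  of the boundary of the polar set.
\<close>

definition dual :: "complex \<Rightarrow> complex \<Rightarrow> bool" where
  "dual p \<nu> \<longleftrightarrow> (\<forall>x\<in>C. x \<bullet> \<nu> \<le> 1) \<and> p \<bullet> \<nu> = 1"

text \<open>A supporting functional at \<open>p\<close> separates it strictly from the interior
  point 0, so its value at \<open>p\<close> is nonzero and can be scaled to 1.\<close>

lemma dual_exists:
  assumes "p \<in> frontier C" shows "\<exists>\<nu>. dual p \<nu>"
proof -
  have rel: "rel_interior C = interior C"
    using zero_interior by (intro rel_interior_nonempty_interior) auto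
  have "p \<in> C" "p \<notin> rel_interior C"
    using assms compact_C by (auto simp: frontier_def rel compact_imp_closed)
  then obtain a where a: "a \<noteq> 0" "\<And>y. y \<in> C \<Longrightarrow> a \<bullet> p \<le> a \<bullet> y"
      "\<And>y. y \<in> rel_interior C \<Longrightarrow> a \<bullet> p < a \<bullet> y"
    using supporting_hyperplane_rel_boundary[OF convex_C] by metis
  have neg: "a \<bullet> p < 0" using a(3)[of 0] zero_interior rel by simp
  have "dual p (a /\<^sub>R (a \<bullet> p))"
    unfolding dual_def
  proof (intro conjI ballI)
    show "x \<bullet> (a /\<^sub>R (a \<bullet> p)) \<le> 1" if "x \<in> C" for x
      using a(2)[OF that] neg by (simp add: divide_simps inner_commute)
    show "p \<bullet> (a /\<^sub>R (a \<bullet> p)) = 1" using neg by (simp add: inner_commute)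
  qed
  then show ?thesis by blast
qed

lemma dual_interior:
  assumes "x \<in> interior C" "dual p \<nu>" shows "x \<bullet> \<nu> < 1"
proof -
  obtain e where e: "e > 0" "cball x e \<subseteq> C" using assms(1) mem_interior_cball by blast
  have "\<nu> \<noteq> 0" using assms(2) by (auto simp: dual_def)
  then have "x + (e / norm \<nu>) *\<^sub>R \<nu> \<in> cball x e" using e(1) by (simp add: dist_norm)
  then have "(x + (e / norm \<nu>) *\<^sub>R \<nu>) \<bullet> \<nu> \<le> 1" using e assms(2) by (auto simp: dual_def)
  moreover have "(e / norm \<nu>) * (\<nu> \<bullet> \<nu>) > 0" using e \<open>\<nu> \<noteq> 0\<close> by simp
  ultimately show ?thesis by (simp add: inner_add_left)
qed

lemma dual_frontier:
  assumes "p \<in> C" "dual p \<nu>" shows "p \<in> frontier C"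
proof -
  have "p \<notin> interior C" using dual_interior[of p p \<nu>] assms by (auto simp: dual_def)
  then show ?thesis using assms(1) closure_subset by (auto simp: frontier_def)
qed

lemma frontier_in_C: "p \<in> frontier C \<Longrightarrow> p \<in> C"
  using compact_C by (simp add: frontier_def compact_imp_closed)

lemma dual_tangent:
  assumes "dual (\<alpha> s) \<nu>" shows "\<alpha>' s \<bullet> \<nu> = 0"
proof -
  have "((\<lambda>s. \<nu> \<bullet> \<alpha> s) has_real_derivative \<nu> \<bullet> \<alpha>' s) (at s)"
    using bounded_linear.has_vector_derivative[OF bounded_linear_inner_right deriv]
    by (simp add: has_real_derivative_iff_has_vector_derivative)
  moreover have "\<nu> \<bullet> \<alpha> t \<le> \<nu> \<bullet> \<alpha> s" for t
    using assms curve_in_C[of t] by (auto simp: dual_def inner_commute[of \<nu>])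
  ultimately have "\<nu> \<bullet> \<alpha>' s = 0"
    using DERIV_local_max[of "\<lambda>s. \<nu> \<bullet> \<alpha> s" "\<nu> \<bullet> \<alpha>' s" s 1] by simp
  then show ?thesis by (simp add: inner_commute)
qed

text \<open>Extreme points of an exposed face are extreme in \<open>C\<close>, and extreme points of
  a hull belong to the generating set. So the curve meets every supporting line, and its tangent
  there is known.\<close>

lemma face_extreme:
  assumes p: "p \<in> C" and \<nu>: "dual p \<nu>"
  defines "F \<equiv> C \<inter> {x. x \<bullet> \<nu> = 1}"
  shows "compact F" "convex F" "F face_of C" "p \<in> F"
    and "\<And>x. x extreme_point_of F \<Longrightarrow> x \<in> range \<alpha> \<and> dual x \<nu>"
proof -
  have "(C \<inter> {x. \<nu> \<bullet> x = 1}) face_of C"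
    using \<nu> by (intro face_of_Int_supporting_hyperplane_le[OF convex_C]) (simp add: dual_def inner_commute)
  then show F: "F face_of C" unfolding F_def by (simp add: inner_commute)
  then show "compact F" "convex F" using compact_C convex_C face_of_imp_compact face_of_imp_convex by blast+
  show "p \<in> F" using p \<nu> by (simp add: F_def dual_def)
  show "x \<in> range \<alpha> \<and> dual x \<nu>" if "x extreme_point_of F" for x
  proof -
    have x: "x extreme_point_of C" "x \<in> F" using extreme_point_of_face[OF F] that by blast+
    then have "x \<in> range \<alpha>" unfolding C_def by (intro extreme_point_of_convex_hull)
    then show ?thesis using x(2) \<nu> by (simp add: F_def dual_def)
  qed
qed

lemma face_contact:
  assumes "p \<in> C" "dual p \<nu>" obtains s where "dual (\<alpha> s) \<nu>"
proof -
  define F where "F = C \<inter> {x. x \<bullet> \<nu> = 1}"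
  note F = face_extreme[OF assms, folded F_def]
  then have "{x. x extreme_point_of F} \<noteq> {}"
    by (metis Krein_Milman_Minkowski convex_hull_empty empty_iff)
  then show thesis using F(5) that by blast
qed

lemma dual_unique:
  assumes p: "p \<in> C" and \<nu>: "dual p \<nu>" "dual p \<nu>'" shows "\<nu> = \<nu>'"
proof -
  text \<open>The midpoint of two dual vectors cuts out the common face.\<close>
  define \<mu> where "\<mu> = (1/2) *\<^sub>R (\<nu> + \<nu>')"
  have \<mu>: "dual p \<mu>"
    using \<nu> unfolding dual_def \<mu>_def by (fastforce simp: inner_add_right)
  obtain s where s: "dual (\<alpha> s) \<mu>" by (rule face_contact[OF p \<mu>])
  have "\<alpha> s \<bullet> \<nu> \<le> 1" "\<alpha> s \<bullet> \<nu>' \<le> 1" "\<alpha> s \<bullet> \<mu> = 1"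
    using \<nu> s curve_in_C by (auto simp: dual_def)
  then have "\<alpha> s \<bullet> \<nu> = 1" "\<alpha> s \<bullet> \<nu>' = 1" by (simp_all add: \<mu>_def inner_add_right)
  then have d: "dual (\<alpha> s) \<nu>" "dual (\<alpha> s) \<nu>'" using \<nu> by (simp_all add: dual_def)
  \<comment> \<open>A dual vector at \<open>\<alpha> s\<close> satisfies two linear equations: it is
    orthogonal to the velocity and has product 1 with the point. These are independent, since a
    point parallel to the velocity would have product 0.\<close>
  define a b c d x y z w where "a = Re (\<alpha>' s)" and "b = Im (\<alpha>' s)" and "c = Re (\<alpha> s)" and "d = Im (\<alpha> s)"
    and "x = Re \<nu>" and "y = Im \<nu>" and "z = Re \<nu>'" and "w = Im \<nu>'"
  note defs = a_def b_def c_def d_def x_def y_def z_def w_def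
  have "a\<^sup>2 + b\<^sup>2 = 1" using unit[of s] unfolding defs by (simp flip: cmod_power2)
  moreover have "a * x + b * y = 0" "a * z + b * w = 0"
    using dual_tangent[OF d(1)] dual_tangent[OF d(2)] unfolding defs by (simp_all add: inner_complex_def)
  moreover have "c * x + d * y = 1" "c * z + d * w = 1"
    using d unfolding defs by (simp_all add: inner_complex_def dual_def)
  ultimately have "x = z" "y = w" by algebra+
  then show ?thesis unfolding defs by (simp add: complex_eq_iff)
qed

definition nu :: "complex \<Rightarrow> complex" where "nu p = (SOME \<nu>. dual p \<nu>)"

lemma dual_nu: "p \<in> frontier C \<Longrightarrow> dual p (nu p)"
  unfolding nu_def using dual_exists by (rule someI_ex)

lemma nu_eq: "p \<in> C \<Longrightarrow> dual p \<nu> \<Longrightarrow> nu p = \<nu>"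
  using dual_unique dual_frontier dual_nu by blast

text \<open>A ball of radius \<open>e\<close> about 0 inside \<open>C\<close> confines the polar set
  to the ball of radius \<open>1 / e\<close>.\<close>

lemma dual_bound: obtains M where "M > 0" "\<And>p \<nu>. dual p \<nu> \<Longrightarrow> norm \<nu> \<le> M"
proof -
  obtain e where e: "e > 0" "cball 0 e \<subseteq> C" using zero_interior mem_interior_cball by blast
  show thesis
  proof
    show "1 / e > 0" using e by simp
    fix p \<nu> assume \<nu>: "dual p \<nu>"
    then have "\<nu> \<noteq> 0" by (auto simp: dual_def)
    then have "(e / norm \<nu>) *\<^sub>R \<nu> \<in> cball 0 e" using e(1) by simp
    then have "((e / norm \<nu>) *\<^sub>R \<nu>) \<bullet> \<nu> \<le> 1" using e(2) \<nu> unfolding dual_def by blast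
    then have "e * norm \<nu> \<le> 1" using \<open>\<nu> \<noteq> 0\<close> by (simp add: dot_square_norm power2_eq_square)
    then show "norm \<nu> \<le> 1 / e" using e by (simp add: field_simps)
  qed
qed

text \<open>By uniqueness of dual vectors the graph of \<open>nu\<close> is cut out by closed
  conditions, and a map into a compact set with closed graph is continuous.\<close>

lemma nu_continuous: "continuous_on (frontier C) nu"
proof -
  obtain M where M: "\<And>p \<nu>. dual p \<nu> \<Longrightarrow> norm \<nu> \<le> M" using dual_bound by metis
  have "(\<lambda>p. (p, nu p)) ` frontier C =
      {z. fst z \<in> frontier C} \<inter> {z. fst z \<bullet> snd z = 1} \<inter> (\<Inter>x\<in>C. {z. x \<bullet> snd z \<le> 1})"
  proof (intro set_eqI iffI)
    fix z assume "z \<in> (\<lambda>p. (p, nu p)) ` frontier C"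
    then show "z \<in> {z. fst z \<in> frontier C} \<inter> {z. fst z \<bullet> snd z = 1} \<inter> (\<Inter>x\<in>C. {z. x \<bullet> snd z \<le> 1})"
      using dual_nu by (auto simp: dual_def)
  next
    fix z assume z: "z \<in> {z. fst z \<in> frontier C} \<inter> {z. fst z \<bullet> snd z = 1} \<inter> (\<Inter>x\<in>C. {z. x \<bullet> snd z \<le> 1})"
    then have "dual (fst z) (snd z)" by (auto simp: dual_def)
    then have "nu (fst z) = snd z" using z nu_eq frontier_in_C by blast
    then show "z \<in> (\<lambda>p. (p, nu p)) ` frontier C" using z by (metis (no_types, lifting) IntD1 image_iff mem_Collect_eq prod.collapse)
  qed
  moreover have "closed {z :: complex \<times> complex. fst z \<in> frontier C}"
    using closed_vimage_fst[OF frontier_closed[of C]] by (simp add: vimage_def)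
  moreover have "closed {z :: complex \<times> complex. fst z \<bullet> snd z = 1}"
    by (intro closed_Collect_eq continuous_intros)
  moreover have "closed (\<Inter>x\<in>C. {z :: complex \<times> complex. x \<bullet> snd z \<le> 1})"
    by (intro closed_INT ballI closed_Collect_le continuous_intros)
  ultimately have "closed ((\<lambda>p. (p, nu p)) ` frontier C)" by (simp add: closed_Int)
  moreover have "nu \<in> frontier C \<rightarrow> cball 0 M" using M[OF dual_nu] by simp
  ultimately show ?thesis by (intro continuous_from_closed_graph[OF compact_cball])
qed

end

section \<open>The unit circle\<close>

lemma cis_has_vector_derivative: "(cis has_vector_derivative \<i> * cis x) (at x)"
  unfolding has_vector_derivative_def
  by (rule has_derivative_eq_rhs, rule has_derivative_cis, rule has_derivative_ident)
     (simp add: scaleR_conv_of_real mult_ac)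

lemma norm_cis_diff_le: "norm (cis s - cis t) \<le> \<bar>s - t\<bar>"
proof -
  have "norm (cis s - cis t) \<le> 1 * norm (s - t)"
  proof (rule differentiable_bound[of UNIV cis "\<lambda>x h. h *\<^sub>R (\<i> * cis x)"])
    show "(cis has_derivative (\<lambda>h. h *\<^sub>R (\<i> * cis x))) (at x within UNIV)" for x
      using cis_has_vector_derivative[of x] by (simp add: has_vector_derivative_def)
    show "onorm (\<lambda>h. h *\<^sub>R (\<i> * cis x)) \<le> 1" for x
      by (rule onorm_le) (simp add: norm_mult)
  qed simp_all
  then show ?thesis by simp
qed

lemma complex_eq_orthonormal: "z = (cis t \<bullet> z) *\<^sub>R cis t + ((\<i> * cis t) \<bullet> z) *\<^sub>R (\<i> * cis t)"
proof -
  have "(cos t)\<^sup>2 + (sin t)\<^sup>2 = 1" by simp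
  then have "Re z = (cos t * Re z + sin t * Im z) * cos t + (- sin t * Re z + cos t * Im z) * (- sin t)"
    and "Im z = (cos t * Re z + sin t * Im z) * sin t + (- sin t * Re z + cos t * Im z) * cos t"
    by algebra+
  then show ?thesis by (simp add: complex_eq_iff inner_complex_def)
qed

section \<open>The boundary of the hull in polar coordinates\<close>

context hull_curve begin

definition radius :: "real \<Rightarrow> real" where
  "radius t = (SOME d. d > 0 \<and> d *\<^sub>R cis t \<in> frontier C)"

definition rad :: "real \<Rightarrow> complex" where "rad t = radius t *\<^sub>R cis t"
definition nrm :: "real \<Rightarrow> complex" where "nrm t = nu (rad t)"
text \<open>The Minkowski gauge of \<open>C\<close> on the unit circle, which is also the support
  function of the polar set. It is the reciprocal of the radius.\<close>

definition gauge_at :: "real \<Rightarrow> real" where "gauge_at t = cis t \<bullet> nrm t"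

lemma rad_frontier: "rad t \<in> frontier C" and radius_pos: "radius t > 0"
proof -
  obtain d where "0 < d" "(0 + d *\<^sub>R cis t) \<in> frontier C"
    using ray_to_frontier[OF compact_imp_bounded[OF compact_C] zero_interior, of "cis t"] by auto
  then have "\<exists>d. d > 0 \<and> d *\<^sub>R cis t \<in> frontier C" by auto
  from someI_ex[OF this] show "rad t \<in> frontier C" "radius t > 0"
    unfolding rad_def radius_def by auto
qed

lemma rad_in_C: "rad t \<in> C" by (rule frontier_in_C[OF rad_frontier])

lemma dual_nrm: "dual (rad t) (nrm t)"
  unfolding nrm_def by (rule dual_nu[OF rad_frontier])

lemma nrm_nonzero: "nrm t \<noteq> 0" using dual_nrm[of t] by (auto simp: dual_def)

lemma gauge_at_eq: "gauge_at t = 1 / radius t"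
  using dual_nrm[of t] radius_pos[of t] by (simp add: dual_def rad_def gauge_at_def field_simps)

lemma gauge_at_pos: "gauge_at t > 0" by (simp add: gauge_at_eq radius_pos)

lemma rad_eq: "rad t = (1 / gauge_at t) *\<^sub>R cis t"
  by (simp add: rad_def gauge_at_eq)

text \<open>The dual vector of each of two boundary points on the ray bounds the distance of the
  other, so the distances agree.\<close>

lemma rad_unique:
  assumes "d > 0" "d *\<^sub>R cis t \<in> frontier C" shows "rad t = d *\<^sub>R cis t"
proof -
  have "d * gauge_at t \<le> 1"
    using dual_nrm[of t] frontier_in_C[OF assms(2)] by (auto simp: dual_def gauge_at_def)
  moreover obtain \<nu> where \<nu>: "dual (d *\<^sub>R cis t) \<nu>" using dual_exists[OF assms(2)] by blast
  then have "radius t * (cis t \<bullet> \<nu>) \<le> 1" "d * (cis t \<bullet> \<nu>) = 1"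
    using rad_in_C[of t] by (auto simp: dual_def rad_def)
  then have "cis t \<bullet> \<nu> = 1 / d" using assms(1) by (simp add: field_simps)
  then have "radius t \<le> d"
    using \<open>radius t * (cis t \<bullet> \<nu>) \<le> 1\<close> assms(1) by (simp add: pos_divide_le_eq)
  ultimately have "radius t = d"
    using radius_pos[of t] assms(1) by (simp add: gauge_at_eq field_simps)
  then show ?thesis by (simp add: rad_def)
qed

lemma rad_Arg:
  assumes "p \<in> frontier C" shows "rad (Arg2pi p) = p"
proof -
  have "p \<noteq> 0" using assms zero_interior by (auto simp: frontier_def)
  moreover have "p = norm p *\<^sub>R cis (Arg2pi p)"
    using Arg2pi_eq[of p] by (simp add: cis_conv_exp scaleR_conv_of_real)
  ultimately show ?thesis using rad_unique[of "norm p" "Arg2pi p"] assms by simp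
qed

lemma rad_periodic: "rad (t + 2 * pi) = rad t"
  by (simp add: rad_def radius_def cis_mult[symmetric])

lemma nrm_periodic: "nrm (t + 2 * pi) = nrm t" by (simp add: nrm_def rad_periodic)

lemma gauge_at_le: "cis s \<bullet> nrm t \<le> gauge_at s"
proof -
  have "rad s \<bullet> nrm t \<le> 1" using dual_nrm[of t] rad_in_C by (auto simp: dual_def)
  then show ?thesis using gauge_at_pos[of s] by (simp add: rad_eq field_simps)
qed

text \<open>The gauge is a maximum of the linear functionals given by the normals, which are
  therefore its subgradients.\<close>

lemma gauge_at_diff_le:
  "(cis s - cis t) \<bullet> nrm t \<le> gauge_at s - gauge_at t"
  "gauge_at s - gauge_at t \<le> (cis s - cis t) \<bullet> nrm s"
  using gauge_at_le[of s t] gauge_at_le[of t s] by (simp_all add: inner_diff_left gauge_at_def)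

lemma gauge_at_continuous: "continuous_on S gauge_at"
proof -
  obtain M where M: "M > 0" "\<And>p \<nu>. dual p \<nu> \<Longrightarrow> norm \<nu> \<le> M" using dual_bound by metis
  have b: "\<bar>(cis s - cis t) \<bullet> nrm u\<bar> \<le> \<bar>s - t\<bar> * M" for s t u
    using norm_cis_diff_le[of s t] M dual_nrm[of u]
    by (intro order_trans[OF Cauchy_Schwarz_ineq2] mult_mono) auto
  have "M-lipschitz_on UNIV gauge_at"
  proof (rule lipschitz_onI)
    fix s t show "dist (gauge_at s) (gauge_at t) \<le> M * dist s t"
      using gauge_at_diff_le[where s=s and t=t] b[of s t t] b[of s t s] by (simp add: dist_real_def mult.commute)
  qed (use M in simp)
  then show ?thesis using lipschitz_on_continuous_on continuous_on_subset by blast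
qed

lemma cis_cont: "continuous_on S cis"
  by (intro continuous_at_imp_continuous_on ballI has_vector_derivative_continuous[OF cis_has_vector_derivative])

lemma rad_continuous: "continuous_on S rad"
  unfolding rad_eq[abs_def] using gauge_at_pos
  by (intro continuous_intros gauge_at_continuous cis_cont) (metis less_irrefl)

lemma nrm_continuous: "continuous_on S nrm"
  unfolding nrm_def[abs_def]
  using rad_frontier by (intro continuous_on_compose2[OF nu_continuous rad_continuous]) auto

text \<open>The increment lies between its linearizations with the normals at \<open>t\<close> and
  at \<open>s\<close>. Their gap is at most \<open>\<bar>s - t\<bar>\<close> times the change of the
  normal, which tends to 0 by continuity.\<close>

lemma gauge_at_deriv: "(gauge_at has_real_derivative (\<i> * cis t) \<bullet> nrm t) (at t)"
proof -
  define g where "g s = (cis s - cis t) \<bullet> nrm t" for s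
  have g: "(g has_real_derivative (\<i> * cis t) \<bullet> nrm t) (at t)"
  proof -
    have "((\<lambda>s. cis s - cis t) has_vector_derivative \<i> * cis t) (at t)"
      using has_vector_derivative_diff[OF cis_has_vector_derivative[of t] has_vector_derivative_const[of "cis t"]] by simp
    then show ?thesis
      unfolding g_def has_real_derivative_iff_has_vector_derivative
      by (rule bounded_linear.has_vector_derivative[OF bounded_linear_inner_left])
  qed
  have b: "\<bar>(gauge_at s - gauge_at t) - g s\<bar> \<le> \<bar>s - t\<bar> * norm (nrm s - nrm t)" for s
  proof -
    have "\<bar>(cis s - cis t) \<bullet> (nrm s - nrm t)\<bar> \<le> norm (cis s - cis t) * norm (nrm s - nrm t)"
      by (rule Cauchy_Schwarz_ineq2)
    also have "\<dots> \<le> \<bar>s - t\<bar> * norm (nrm s - nrm t)"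
      by (intro mult_right_mono norm_cis_diff_le norm_ge_zero)
    finally show ?thesis
      using gauge_at_diff_le[where s=s and t=t] unfolding g_def by (simp add: inner_diff_right)
  qed
  have "((\<lambda>s. norm (nrm s - nrm t)) \<longlongrightarrow> norm (nrm t - nrm t)) (at t)"
    using nrm_continuous[of UNIV] by (intro tendsto_intros) (simp add: continuous_on_def)
  then have lim: "((\<lambda>s. norm (nrm s - nrm t)) \<longlongrightarrow> 0) (at t)" by simp
  have "((\<lambda>s. ((gauge_at s - gauge_at t) - g s) / (s - t)) \<longlongrightarrow> 0) (at t)"
  proof (rule Lim_null_comparison[OF _ lim])
    show "\<forall>\<^sub>F s in at t. norm (((gauge_at s - gauge_at t) - g s) / (s - t)) \<le> norm (nrm s - nrm t)"
      unfolding eventually_at_filter using b by (intro always_eventually allI) (simp add: abs_divide divide_le_eq mult.commute)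
  qed
  moreover have "((\<lambda>s. (g s - g t) / (s - t)) \<longlongrightarrow> (\<i> * cis t) \<bullet> nrm t) (at t)"
    using g by (simp add: has_field_derivative_iff)
  ultimately have "((\<lambda>s. ((gauge_at s - gauge_at t) - g s) / (s - t) + (g s - g t) / (s - t)) \<longlongrightarrow> 0 + (\<i> * cis t) \<bullet> nrm t) (at t)"
    by (rule tendsto_add)
  then show ?thesis
    unfolding has_field_derivative_iff by (simp add: g_def diff_divide_distrib[symmetric] add_divide_distrib[symmetric])
qed

definition speed :: "real \<Rightarrow> real" where "speed t = norm (nrm t) / (gauge_at t)\<^sup>2"
definition tang :: "real \<Rightarrow> complex" where "tang t = \<i> * sgn (nrm t)"

lemma speed_pos: "speed t > 0"
  unfolding speed_def using gauge_at_pos nrm_nonzero by (intro divide_pos_pos zero_less_power) auto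

lemma norm_tang: "norm (tang t) = 1" by (simp add: tang_def norm_mult norm_sgn nrm_nonzero)

lemma speed_tang: "speed t *\<^sub>R tang t = (1 / (gauge_at t)\<^sup>2) *\<^sub>R (\<i> * nrm t)"
  by (simp add: speed_def tang_def sgn_div_norm nrm_nonzero scaleR_conv_of_real field_simps)

text \<open>In the orthonormal frame \<open>cis t\<close>, \<open>\<i> * cis t\<close> the
  coordinates of the normal are the gauge and its derivative. The quotient rule for
  \<open>cis\<close> divided by the gauge therefore yields the rotated normal over the squared
  gauge.\<close>

lemma rad_deriv: "(rad has_vector_derivative speed t *\<^sub>R tang t) (at t)"
proof -
  define q' where "q' = (\<i> * cis t) \<bullet> nrm t"
  have g0: "gauge_at t \<noteq> 0" using gauge_at_pos[of t] by simp
  have "((\<lambda>s. 1 / gauge_at s) has_real_derivative - q' / (gauge_at t)\<^sup>2) (at t)"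
    using gauge_at_deriv[of t] g0 unfolding q'_def
    by (auto intro!: derivative_eq_intros simp: power2_eq_square)
  from has_vector_derivative_scaleR[OF this cis_has_vector_derivative]
  have "(rad has_vector_derivative (1 / gauge_at t) *\<^sub>R (\<i> * cis t) + (- q' / (gauge_at t)\<^sup>2) *\<^sub>R cis t) (at t)"
    by (simp add: rad_eq[abs_def])
  moreover have "\<i> * nrm t = gauge_at t *\<^sub>R (\<i> * cis t) - q' *\<^sub>R cis t"
  proof -
    have "nrm t = gauge_at t *\<^sub>R cis t + q' *\<^sub>R (\<i> * cis t)"
      using complex_eq_orthonormal[of "nrm t" t] by (simp only: gauge_at_def q'_def)
    then have "\<i> * nrm t = \<i> * (gauge_at t *\<^sub>R cis t + q' *\<^sub>R (\<i> * cis t))" by simp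
    then show ?thesis by (simp add: algebra_simps scaleR_conv_of_real)
  qed
  then have "speed t *\<^sub>R tang t = (1 / gauge_at t) *\<^sub>R (\<i> * cis t) + (- q' / (gauge_at t)\<^sup>2) *\<^sub>R cis t"
    unfolding speed_tang using g0
    by (simp add: scaleR_diff_right power2_eq_square)
  ultimately show ?thesis by simp
qed

lemma speed_continuous: "continuous_on S speed"
  unfolding speed_def[abs_def] using gauge_at_pos
  by (intro continuous_intros nrm_continuous gauge_at_continuous) (metis less_irrefl power_not_zero)

lemma tang_continuous: "continuous_on S tang"
  unfolding tang_def[abs_def] using nrm_nonzero
  by (intro continuous_intros nrm_continuous) auto

lemma contact_tangent:
  assumes "rad t = \<alpha> s" shows "\<alpha>' s = tang t \<or> \<alpha>' s = - tang t"
proof -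
  define a b x y where "a = Re (\<alpha>' s)" and "b = Im (\<alpha>' s)" and "x = Re (sgn (nrm t))" and "y = Im (sgn (nrm t))"
  note defs = a_def b_def x_def y_def
  have "dual (\<alpha> s) (nrm t)" using dual_nrm[of t] assms by simp
  then have "\<alpha>' s \<bullet> nrm t = 0" by (rule dual_tangent)
  then have "\<alpha>' s \<bullet> sgn (nrm t) = 0" by (simp add: sgn_div_norm)
  then have 0: "a * x + b * y = 0" unfolding defs by (simp add: inner_complex_def)
  have 1: "a\<^sup>2 + b\<^sup>2 = 1" using unit[of s] unfolding defs by (simp flip: cmod_power2)
  have 2: "x\<^sup>2 + y\<^sup>2 = 1"
    using cmod_power2[of "sgn (nrm t)"] nrm_nonzero[of t] unfolding x_def y_def norm_sgn by simp
  \<comment> \<open>The inner product of the velocity with \<open>tang t\<close>; both are unit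
    vectors orthogonal to the normal.\<close>
  define e where "e = b * x - a * y"
  have "e\<^sup>2 = 1" "a = - (e * y)" "b = e * x" using 0 1 2 unfolding e_def by algebra+
  then have "(a = - y \<and> b = x) \<or> (a = y \<and> b = - x)" by (auto simp: power2_eq_1_iff)
  then show ?thesis unfolding defs by (auto simp: tang_def complex_eq_iff)
qed

text \<open>
  A boundary point that is not on the curve is not an extreme point of its face, hence lies inside
  a segment of the boundary, along which the normal is constant.
\<close>

lemma nrm_locally_constant:
  assumes "rad t0 \<notin> range \<alpha>" shows "\<forall>\<^sub>F t in nhds t0. nrm t = nrm t0"
proof -
  define \<nu> p where "\<nu> = nrm t0" and "p = rad t0"
  have \<nu>: "dual p \<nu>" unfolding \<nu>_def p_def by (rule dual_nrm)
  have pC: "p \<in> C" unfolding p_def by (rule rad_in_C)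
  define F where "F = C \<inter> {x. x \<bullet> \<nu> = 1}"
  note F = face_extreme[OF pC \<nu>, folded F_def]
  have "\<not> p extreme_point_of F" using F(5) assms by (auto simp: p_def)
  then obtain a b where ab: "a \<in> F" "b \<in> F" "p \<in> open_segment a b"
    using F(4) by (auto simp: extreme_point_of_def)
  then obtain u where u: "0 < u" "u < 1" "p = (1 - u) *\<^sub>R a + u *\<^sub>R b" and "a \<noteq> b"
    by (auto simp: in_segment)
  define w where "w = b - a"
  have w0: "w \<noteq> 0" using \<open>a \<noteq> b\<close> by (simp add: w_def)
  have w\<nu>: "w \<bullet> \<nu> = 0" using ab by (simp add: w_def F_def inner_diff_left)
  have gp: "cis t0 \<bullet> \<nu> > 0" using gauge_at_pos[of t0] by (simp add: gauge_at_def \<nu>_def)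
  \<comment> \<open>\<open>y t\<close> is the intersection of the ray at angle \<open>t\<close> with
    the supporting line at \<open>p\<close>, and \<open>c t\<close> is its affine coordinate on the
    segment from \<open>a\<close> to \<open>b\<close>. As \<open>p\<close> lies strictly inside, so
    does \<open>y t\<close> for nearby angles.\<close>
  define y where "y t = (1 / (cis t \<bullet> \<nu>)) *\<^sub>R cis t" for t
  define c where "c t = u + ((y t - p) \<bullet> w) / (w \<bullet> w)" for t
  have "y t0 = p" by (simp add: y_def p_def rad_eq gauge_at_def \<nu>_def)
  then have "c t0 = u" by (simp add: c_def)
  have cis_t: "(cis \<longlongrightarrow> cis t0) (nhds t0)"
    using has_vector_derivative_continuous[OF cis_has_vector_derivative, of t0]
    unfolding isCont_def tendsto_at_iff_tendsto_nhds .
  have "((\<lambda>t. cis t \<bullet> \<nu>) \<longlongrightarrow> cis t0 \<bullet> \<nu>) (nhds t0)" by (intro tendsto_intros cis_t)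
  then have ev1: "\<forall>\<^sub>F t in nhds t0. cis t \<bullet> \<nu> > 0" using gp by (rule order_tendstoD)
  have "(c \<longlongrightarrow> c t0) (nhds t0)"
    unfolding c_def[abs_def] y_def using gp w0 by (intro tendsto_intros cis_t) auto
  then have "(c \<longlongrightarrow> u) (nhds t0)" using \<open>c t0 = u\<close> by simp
  then have "\<forall>\<^sub>F t in nhds t0. 0 < c t" "\<forall>\<^sub>F t in nhds t0. c t < 1"
    using u by (auto intro: order_tendstoD)
  with ev1 show ?thesis
  proof eventually_elim
    fix t assume t: "cis t \<bullet> \<nu> > 0" "0 < c t" "c t < 1"
    have y\<nu>: "y t \<bullet> \<nu> = 1" using t(1) by (simp add: y_def)
    \<comment> \<open>In the plane, two vectors orthogonal to the nonzero \<nu> are parallel, so the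
      projection to \<open>w\<close> loses nothing.\<close>
    have "y t - p = (((y t - p) \<bullet> w) / (w \<bullet> w)) *\<^sub>R w"
    proof -
      define x1 x2 w1 w2 n1 n2 where "x1 = Re (y t - p)" and "x2 = Im (y t - p)" and "w1 = Re w" and "w2 = Im w"
        and "n1 = Re \<nu>" and "n2 = Im \<nu>"
      note defs = x1_def x2_def w1_def w2_def n1_def n2_def
      have "(y t - p) \<bullet> \<nu> = 0" using y\<nu> \<nu> by (simp add: inner_diff_left dual_def)
      then have 1: "x1 * n1 + x2 * n2 = 0" unfolding defs by (simp add: inner_complex_def)
      have 2: "w1 * n1 + w2 * n2 = 0" using w\<nu> unfolding defs by (simp add: inner_complex_def)
      have "n1\<^sup>2 + n2\<^sup>2 \<noteq> 0"
        using nrm_nonzero[of t0] unfolding defs \<nu>_def by (simp flip: cmod_power2)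
      moreover have "(n1\<^sup>2 + n2\<^sup>2) * (x1 * w2 - x2 * w1) = 0" using 1 2 by algebra
      ultimately have "x1 * w2 - x2 * w1 = 0" using mult_eq_0_iff by blast
      then have det: "x1 * w2 = x2 * w1" by simp
      have ww: "w1 * w1 + w2 * w2 \<noteq> 0" using w0 unfolding defs
        by (metis complex_eq_0 power2_eq_square)
      have "x1 * (w1 * w1 + w2 * w2) = (x1 * w1 + x2 * w2) * w1"
        "x2 * (w1 * w1 + w2 * w2) = (x1 * w1 + x2 * w2) * w2" using det by algebra+
      then have "x1 = (x1 * w1 + x2 * w2) / (w1 * w1 + w2 * w2) * w1"
        "x2 = (x1 * w1 + x2 * w2) / (w1 * w1 + w2 * w2) * w2"
        using ww by (simp_all add: nonzero_eq_divide_eq)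
      then show ?thesis unfolding complex_eq_iff inner_complex_def scaleR_complex.sel defs by (rule conjI)
    qed
    then have "y t = p + (c t - u) *\<^sub>R w" by (simp add: c_def algebra_simps)
    also have "\<dots> = (1 - c t) *\<^sub>R a + c t *\<^sub>R b" unfolding u(3) w_def by (simp add: algebra_simps)
    finally have "y t \<in> F" using convexD[OF F(2) ab(1,2), of "1 - c t" "c t"] t by simp
    then have yC: "y t \<in> C" and yd: "dual (y t) \<nu>" using \<nu> y\<nu> by (auto simp: F_def dual_def)
    then have "y t \<in> frontier C" by (rule dual_frontier)
    then have "rad t = y t" using rad_unique[of "1 / (cis t \<bullet> \<nu>)" t] t(1) by (simp add: y_def)
    then show "nrm t = nrm t0" using nu_eq[OF yC yd] by (simp add: nrm_def \<nu>_def)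
  qed
qed

section \<open>The boundary of the hull by arc length\<close>

definition ell :: "real \<Rightarrow> real" where "ell u = (LBINT t=ereal 0..ereal u. speed t)"

lemma ell_deriv: "(ell has_real_derivative speed x) (at x)"
proof -
  have "(ell has_vector_derivative speed x) (at x within {- \<bar>x\<bar> - 1..\<bar>x\<bar> + 1})"
    unfolding ell_def by (rule interval_integral_FTC2[OF _ _ speed_continuous]) auto
  then show ?thesis
    by (simp add: at_within_Icc_at has_real_derivative_iff_has_vector_derivative)
qed

lemma ell_0: "ell 0 = 0" by (simp add: ell_def)

lemma ell_mono: "s < t \<Longrightarrow> ell s < ell t"
  by (rule DERIV_pos_imp_increasing) (blast intro: ell_deriv speed_pos)+

definition bdry_len :: real where "bdry_len = ell (2 * pi)"

lemma bdry_len_pos: "bdry_len > 0" using ell_mono[of 0 "2 * pi"] by (simp add: bdry_len_def ell_0)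

lemma speed_periodic: "speed (t + 2 * pi) = speed t"
  by (simp add: speed_def gauge_at_def nrm_periodic cis_mult[symmetric])

lemma ell_shift: "ell (t + 2 * pi) = ell t + bdry_len"
proof -
  have "((\<lambda>t. ell (t + 2 * pi) - ell t) has_real_derivative 0) (at t)" for t
  proof -
    have "((\<lambda>t. ell (t + 2 * pi)) has_real_derivative speed t) (at t)"
      using ell_deriv[of "t + 2 * pi"] by (simp add: DERIV_shift speed_periodic)
    then show ?thesis using DERIV_diff[OF _ ell_deriv[of t]] by fastforce
  qed
  then have "ell (t + 2 * pi) - ell t = ell (0 + 2 * pi) - ell 0"
    using DERIV_isconst_all[of "\<lambda>t. ell (t + 2 * pi) - ell t" t 0] by blast
  then show ?thesis by (simp add: bdry_len_def ell_0)
qed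

lemma ell_nat: "ell (real n * (2 * pi)) = real n * bdry_len" "ell (- (real n * (2 * pi))) = - (real n * bdry_len)"
proof (induction n)
  case (Suc n)
  { case 1 show ?case using ell_shift[of "real n * (2 * pi)"] Suc(1) by (simp add: algebra_simps) }
  { case 2 show ?case using ell_shift[of "- (real (Suc n) * (2 * pi))"] Suc(2) by (simp add: algebra_simps) }
qed (simp_all add: ell_0)

lemma ell_surj: "\<exists>t. ell t = y"
proof -
  obtain n :: nat where n: "\<bar>y\<bar> < real n * bdry_len" using bdry_len_pos ex_less_of_nat_mult by blast
  have "\<exists>t\<ge>- (real n * (2 * pi)). t \<le> real n * (2 * pi) \<and> ell t = y"
    by (rule IVT) (use n ell_nat[of n] DERIV_isCont[OF ell_deriv] in auto)
  then show ?thesis by blast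
qed

definition ang :: "real \<Rightarrow> real" where "ang = inv ell"

lemma ell_ang: "ell (ang y) = y" unfolding ang_def by (rule f_inv_into_f) (metis ell_surj rangeI)

lemma ang_ell: "ang (ell t) = t"
  by (metis ell_ang ell_mono less_irrefl linorder_neqE)

lemma ang_deriv: "(ang has_real_derivative 1 / speed (ang y)) (at y)"
proof -
  have "isCont ang (ell (ang y))"
    by (rule isCont_inverse_function[of 1]) (auto simp: ang_ell intro: DERIV_isCont[OF ell_deriv])
  then have "(ang has_real_derivative inverse (speed (ang y))) (at y)"
    using speed_pos[of "ang y"] ell_ang
    by (intro DERIV_inverse_function[of ell _ _ _ "y - 1" "y + 1"] ell_deriv) auto
  then show ?thesis by (simp add: inverse_eq_divide)
qed

lemma ang_shift: "ang (y + bdry_len) = ang y + 2 * pi"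
  by (metis ang_ell ell_ang ell_shift)

lemma ang_mono: "x < y \<Longrightarrow> ang x < ang y"
  by (metis ell_ang ell_mono linorder_neqE order_less_asym)

definition bdry :: "real \<Rightarrow> complex" where "bdry y = rad (ang y)"
definition bdry' :: "real \<Rightarrow> complex" where "bdry' y = tang (ang y)"

lemma bdry_deriv: "(bdry has_vector_derivative bdry' y) (at y)"
proof -
  have "((rad \<circ> ang) has_vector_derivative (1 / speed (ang y)) *\<^sub>R (speed (ang y) *\<^sub>R tang (ang y))) (at y)"
    using ang_deriv[of y] rad_deriv[of "ang y"]
    by (intro vector_diff_chain_at) (simp_all add: has_real_derivative_iff_has_vector_derivative)
  then show ?thesis using speed_pos[of "ang y"] by (simp add: bdry_def[abs_def] bdry'_def o_def)
qed

lemma ang_continuous: "continuous_on S ang"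
  by (intro continuous_at_imp_continuous_on ballI DERIV_isCont[OF ang_deriv])

lemma bdry'_continuous: "continuous_on S bdry'"
  unfolding bdry'_def[abs_def]
  by (rule continuous_on_compose2[OF tang_continuous[of UNIV] ang_continuous]) simp

lemma bdry_periodic: "Defs.periodic bdry_len bdry"
  by (simp add: Defs.periodic_def bdry_def ang_shift rad_periodic)

lemma norm_bet': "norm (bdry' y) = 1" by (simp add: bdry'_def norm_tang)

lemma ang_less_iff: "ang x < ang y \<longleftrightarrow> x < y"
  using ang_mono[of x y] ang_mono[of y x] by (cases x y rule: linorder_cases) auto

lemma ang_range: "0 \<le> ang y \<and> ang y < 2 * pi \<longleftrightarrow> 0 \<le> y \<and> y < bdry_len"
proof -
  have "ang 0 = 0" "ang bdry_len = 2 * pi" using ang_ell[of 0] ang_ell[of "2 * pi"] by (simp_all add: ell_0 bdry_len_def)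
  then show ?thesis using ang_less_iff[of y 0] ang_less_iff[of y bdry_len] by (simp add: not_less[symmetric])
qed

lemma Arg2pi_rad: "0 \<le> t \<Longrightarrow> t < 2 * pi \<Longrightarrow> Arg2pi (rad t) = t"
  using radius_pos[of t] by (intro Arg2pi_unique[of "radius t"])
    (simp_all add: rad_def cis_conv_exp scaleR_conv_of_real)

lemma bdry_inj:
  assumes "x \<in> {0..<bdry_len}" "y \<in> {0..<bdry_len}" "bdry x = bdry y" shows "x = y"
proof -
  have r: "0 \<le> ang x" "ang x < 2 * pi" "0 \<le> ang y" "ang y < 2 * pi"
    using ang_range[of x] ang_range[of y] assms(1,2) by simp_all
  have "Arg2pi (rad (ang x)) = Arg2pi (rad (ang y))"
    using assms(3) unfolding bdry_def by (rule arg_cong)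
  then have "ang x = ang y" by (simp only: Arg2pi_rad[OF r(1,2)] Arg2pi_rad[OF r(3,4)])
  then show ?thesis by (metis ell_ang)
qed

section \<open>From parameters of the curve to arc length on the boundary\<close>

definition bdry_param :: "real \<Rightarrow> real" where "bdry_param s = ell (Arg2pi (\<alpha> s))"

lemma bdry_at_param: "\<alpha> s \<in> frontier C \<Longrightarrow> bdry (bdry_param s) = \<alpha> s"
  by (simp add: bdry_def bdry_param_def ang_ell rad_Arg)

lemma bdry_param_bounds: "0 \<le> bdry_param s" "bdry_param s < bdry_len"
  using ang_range[of "bdry_param s"] Arg2pi_ge_0 Arg2pi_lt_2pi by (auto simp: bdry_param_def ang_ell)

lemma bdry_param_pos: "Arg2pi (\<alpha> s) \<noteq> 0 \<Longrightarrow> 0 < bdry_param s"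
  using ell_mono[of 0 "Arg2pi (\<alpha> s)"] Arg2pi_ge_0[of "\<alpha> s"] by (simp add: bdry_param_def ell_0)

text \<open>\<open>bdry_param\<close> is radial projection followed by arc length and is defined off
  the contact set too, so a two-sided derivative makes sense at any contact parameter. There the
  curve and the boundary share a tangent line and both have unit speed, which leaves only the
  sign.\<close>

lemma bdry_param_deriv:
  assumes s: "\<alpha> s \<in> frontier C" "Arg2pi (\<alpha> s) \<noteq> 0"
  obtains e where "e = 1 \<or> e = -1" "\<alpha>' s = e *\<^sub>R bdry' (bdry_param s)" "(bdry_param has_real_derivative e) (at s)"
proof -
  define t where "t = Arg2pi (\<alpha> s)"
  have rt: "rad t = \<alpha> s" using rad_Arg[OF s(1)] by (simp add: t_def)
  have angt: "ang (bdry_param s) = t" by (simp add: bdry_param_def ang_ell t_def)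
  obtain e :: real where e: "e = 1 \<or> e = -1" "\<alpha>' s = e *\<^sub>R tang t"
    using contact_tangent[OF rt]
  proof
    assume "\<alpha>' s = tang t" then show ?thesis using that[of 1] by simp
  next
    assume "\<alpha>' s = - tang t" then show ?thesis using that[of "-1"] by simp
  qed
  \<comment> \<open>Away from the positive real axis \<open>Arg2pi\<close> is the imaginary part of
    \<open>Ln\<close> at the opposite point plus \<open>pi\<close>, which moves the branch cut away
    and makes the angle differentiable.\<close>
  have nR: "- \<alpha> s \<notin> \<real>\<^sub>\<le>\<^sub>0"
    using s(2) by (auto simp: Arg2pi_eq_0 complex_nonpos_Reals_iff complex_is_Real_iff)
  have "((\<lambda>u. Ln (- \<alpha> u)) has_vector_derivative (- \<alpha>' s) * inverse (- \<alpha> s)) (at s)"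
    using field_vector_diff_chain_at[OF has_vector_derivative_minus[OF deriv] has_field_derivative_Ln[OF nR]]
    by (simp add: o_def)
  then have "((\<lambda>u. Im (Ln (- \<alpha> u))) has_real_derivative Im (\<alpha>' s / \<alpha> s)) (at s)"
    using bounded_linear.has_vector_derivative[OF bounded_linear_Im]
    by (fastforce simp: has_real_derivative_iff_has_vector_derivative divide_inverse)
  from DERIV_add[OF this DERIV_const[of pi]]
  have "((\<lambda>u. Im (Ln (- \<alpha> u)) + pi) has_real_derivative Im (\<alpha>' s / \<alpha> s)) (at s)"
    by simp
  moreover have pos: "0 < Arg2pi (\<alpha> s)" using s(2) Arg2pi_ge_0[of "\<alpha> s"] by simp
  then have "Im (Ln (- \<alpha> s)) + pi = t" using Arg2pi_Ln by (simp add: t_def)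
  ultimately have d: "((\<lambda>u. ell (Im (Ln (- \<alpha> u)) + pi)) has_real_derivative speed t * Im (\<alpha>' s / \<alpha> s)) (at s)"
    using DERIV_chain2[OF ell_deriv] by metis
  have "Im (\<alpha>' s / \<alpha> s) = e * Im (tang t / rad t)" unfolding e(2) rt
    by (simp add: scaleR_conv_of_real flip: times_divide_eq_right)
  \<comment> \<open>\<open>Im (tang t / rad t)\<close> is the change of angle per unit of boundary
    length, so its product with \<open>speed\<close> is 1. In the computation the inner product of
    \<open>cis t\<close> and the normal reappears as the gauge and cancels.\<close>
  moreover have "speed t * Im (tang t / rad t) = 1"
  proof -
    have "speed t *\<^sub>R tang t / rad t = (\<i> * nrm t * cnj (cis t)) / of_real (gauge_at t)"
      using gauge_at_pos[of t] cis_mult[of "- t" t] unfolding speed_tang rad_eq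
      by (simp add: scaleR_conv_of_real power2_eq_square divide_simps cis_cnj)
    then have "Im (speed t *\<^sub>R tang t / rad t) = Im (\<i> * nrm t * cnj (cis t)) / gauge_at t" by simp
    also have "\<dots> = 1" using gauge_at_pos[of t] by (simp add: gauge_at_def inner_complex_def)
    finally show ?thesis by (simp add: scaleR_conv_of_real flip: times_divide_eq_right)
  qed
  ultimately have "speed t * Im (\<alpha>' s / \<alpha> s) = e" by (metis mult.left_commute mult.right_neutral)
  with d have d: "((\<lambda>u. ell (Im (Ln (- \<alpha> u)) + pi)) has_real_derivative e) (at s)" by simp
  have "isCont \<alpha> s" using deriv has_vector_derivative_continuous by blast
  then have "\<forall>\<^sub>F u in nhds s. - \<alpha> u \<in> - \<real>\<^sub>\<le>\<^sub>0"
    using nR by (intro topological_tendstoD[of "\<lambda>u. - \<alpha> u" "- \<alpha> s"] open_Compl closed_nonpos_Reals_complex)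
      (auto intro!: tendsto_intros simp: isCont_def tendsto_at_iff_tendsto_nhds)
  then have "\<forall>\<^sub>F u in nhds s. bdry_param u = ell (Im (Ln (- \<alpha> u)) + pi)"
  proof eventually_elim
    fix u assume "- \<alpha> u \<in> - \<real>\<^sub>\<le>\<^sub>0"
    then have "Arg2pi (\<alpha> u) \<noteq> 0"
      by (auto simp: Arg2pi_eq_0 complex_nonpos_Reals_iff complex_is_Real_iff)
    then have "0 < Arg2pi (\<alpha> u)" using Arg2pi_ge_0[of "\<alpha> u"] by simp
    from Arg2pi_Ln[OF this] show "bdry_param u = ell (Im (Ln (- \<alpha> u)) + pi)"
      unfolding bdry_param_def by (rule arg_cong)
  qed
  then have "(bdry_param has_real_derivative e) (at s)"
    using d by (simp add: DERIV_cong_ev)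
  with e angt show thesis using that[of e] by (simp add: bdry'_def)
qed

lemma bdry'_locally_constant:
  assumes "bdry y \<notin> range \<alpha>" shows "\<forall>\<^sub>F x in nhds y. bdry' x = bdry' y"
proof -
  have "\<forall>\<^sub>F t in nhds (ang y). nrm t = nrm (ang y)"
    using nrm_locally_constant assms by (simp add: bdry_def)
  moreover have "filterlim ang (nhds (ang y)) (nhds y)"
    using DERIV_isCont[OF ang_deriv[of y]] unfolding isCont_def tendsto_at_iff_tendsto_nhds .
  ultimately have "\<forall>\<^sub>F x in nhds y. nrm (ang x) = nrm (ang y)"
    by (rule eventually_compose_filterlim)
  then show ?thesis by eventually_elim (simp add: bdry'_def tang_def)
qed

end

section \<open>Densities of components and continuous preimages\<close>

lemma has_density_bounded_linear:
  assumes F: "has_density F k a b" and f: "bounded_linear f"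
  shows "has_density (\<lambda>x. f (F x)) (\<lambda>x. f (k x)) a b"
proof (rule has_densityI)
  show "(\<lambda>x. f (k x)) absolutely_integrable_on {a..b}"
    using absolutely_integrable_linear[OF has_density_abs_integrable[OF F] f] by (simp add: o_def)
  fix x assume x: "x \<in> {a..b}"
  have "f (F x) - f (F a) = f (integral {a..x} k)"
    using has_density_diff[OF F, of a x] x by (simp add: linear_diff[OF bounded_linear.linear[OF f], symmetric])
  also have "\<dots> = integral {a..x} (\<lambda>x. f (k x))"
    using integral_linear[OF has_density_integrable(1)[OF F, of a x] f] x by (simp add: o_def)
  finally show "f (F x) - f (F a) = integral {a..x} (\<lambda>x. f (k x))" .
qed

lemma has_density_complexI:
  assumes r: "has_density (\<lambda>x. Re (F x)) v a b" and i: "has_density (\<lambda>x. Im (F x)) w a b"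
  shows "has_density F (\<lambda>x. Complex (v x) (w x)) a b"
proof (rule has_densityI)
  have eq: "Complex x y = of_real x + \<i> * of_real y" for x y by (simp add: complex_eq_iff)
  have "(\<lambda>x. of_real (v x) :: complex) absolutely_integrable_on {a..b}"
    using absolutely_integrable_linear[OF has_density_abs_integrable[OF r] bounded_linear_of_real] by (simp add: o_def)
  moreover have "(\<lambda>x. \<i> * of_real (w x)) absolutely_integrable_on {a..b}"
    using absolutely_integrable_linear[OF has_density_abs_integrable[OF i]
        bounded_linear_compose[OF bounded_linear_mult_right[of \<i>] bounded_linear_of_real]] by (simp add: o_def)
  ultimately show ai: "(\<lambda>x. Complex (v x) (w x)) absolutely_integrable_on {a..b}"
    unfolding eq by (rule set_integral_add)
  fix x assume x: "x \<in> {a..b}"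
  have "(\<lambda>x. Complex (v x) (w x)) integrable_on {a..x}"
    using ai x by (auto intro: integrable_subinterval_real simp: absolutely_integrable_on_def)
  from integral_linear[OF this bounded_linear_Re] integral_linear[OF this bounded_linear_Im]
  have "Re (integral {a..x} (\<lambda>x. Complex (v x) (w x))) = integral {a..x} v"
    "Im (integral {a..x} (\<lambda>x. Complex (v x) (w x))) = integral {a..x} w"
    by (simp_all add: o_def)
  then show "F x - F a = integral {a..x} (\<lambda>x. Complex (v x) (w x))"
    using has_density_diff[OF r, of a x] has_density_diff[OF i, of a x] x by (simp add: complex_eq_iff)
qed

lemma borel_preimage_continuous_on:
  assumes "continuous_on E f" "E \<in> sets borel" "closed D"
  shows "{s \<in> E. f s \<in> D} \<in> sets borel"
proof -
  obtain A where A: "closed A" "A \<inter> E = f -` D \<inter> E"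
    using assms(1,3) unfolding continuous_on_closed_invariant by blast
  have "{s \<in> E. f s \<in> D} = A \<inter> E" using A(2) by blast
  then show ?thesis using A(1) assms(2) by simp
qed

section \<open>The energy of the boundary of the convex hull\<close>

locale hull_density = hull_curve +
  fixes k :: "real \<Rightarrow> complex"
  assumes dens: "has_density \<alpha>' k 0 L"
    and L2: "(\<lambda>s. (norm (k s))\<^sup>2) integrable_on {0..L}"
begin

text \<open>
  Only the first parameter of each contact point is kept, so that overlapping branches are counted
  once. The point \<open>bdry 0\<close> is left out because of the jump of \<open>Arg2pi\<close>.
\<close>

definition E :: "real set" where
  "E = {s \<in> {0..L}. \<alpha> s \<in> frontier C \<and> Arg2pi (\<alpha> s) \<noteq> 0 \<and> (\<forall>r\<in>{0..<s}. \<alpha> r \<noteq> \<alpha> s)}"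

lemma vimage_closed: "closed S \<Longrightarrow> closed (\<alpha> -` S)"
  by (rule continuous_closed_vimage) (auto intro: has_vector_derivative_continuous[OF deriv])

lemma E_sub: "E \<subseteq> {0..L}" by (auto simp: E_def)

text \<open>Parameters with an earlier visit at distance at least \<open>1 / real (Suc n)\<close>
  form the projection of a compact set of pairs. Repeated parameters are thus a countable union of
  closed sets, removed from a Borel set.\<close>

lemma E_borel: "E \<in> sets borel"
proof -
  define Z where "Z n = snd ` {p \<in> {0..L} \<times> {0..L}. fst p \<le> snd p - 1 / real (Suc n) \<and> \<alpha> (fst p) = \<alpha> (snd p)}" for n
  have "closed (Z n)" for n
  proof -
    have "closed ({0..L} \<times> {0..L} \<inter> ({p :: real \<times> real. fst p \<le> snd p - 1 / real (Suc n)} \<inter> {p. \<alpha> (fst p) = \<alpha> (snd p)}))"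
      by (intro closed_Int closed_Times closed_atLeastAtMost closed_Collect_le closed_Collect_eq continuous_intros
          continuous_on_compose2[OF cont[of UNIV]]) auto
    then have "closed {p \<in> {0..L} \<times> {0..L}. fst p \<le> snd p - 1 / real (Suc n) \<and> \<alpha> (fst p) = \<alpha> (snd p)}"
      by (rule back_subst[of closed]) auto
    moreover have "bounded {p \<in> {0..L} \<times> {0..L}. fst p \<le> snd p - 1 / real (Suc n) \<and> \<alpha> (fst p) = \<alpha> (snd p)}"
      by (rule bounded_subset[of "{0..L} \<times> {0..L}"]) (auto intro: bounded_Times)
    ultimately have "compact {p \<in> {0..L} \<times> {0..L}. fst p \<le> snd p - 1 / real (Suc n) \<and> \<alpha> (fst p) = \<alpha> (snd p)}"
      by (simp add: compact_eq_bounded_closed)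
    then show ?thesis unfolding Z_def by (intro compact_imp_closed compact_continuous_image continuous_intros)
  qed
  then have Zb: "(\<Union>n. Z n) \<in> sets borel" by (intro sets.countable_UN) auto
  have A: "closed (\<alpha> -` frontier C)"
    by (rule vimage_closed[OF frontier_closed])
  have R: "closed (\<alpha> -` \<real>\<^sub>\<ge>\<^sub>0)"
    by (rule vimage_closed[OF closed_nonneg_Reals_complex])
  have "E = ({0..L} \<inter> \<alpha> -` frontier C - \<alpha> -` \<real>\<^sub>\<ge>\<^sub>0) - (\<Union>n. Z n)"
  proof (intro set_eqI iffI)
    fix s assume s: "s \<in> E"
    have "s \<notin> Z n" for n
    proof
      assume "s \<in> Z n"
      then obtain r where r: "r \<in> {0..L}" "r \<le> s - 1 / real (Suc n)" "\<alpha> r = \<alpha> s" by (auto simp: Z_def)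
      have "1 / real (Suc n) > 0" by simp
      then have "r < s" using r(2) by linarith
      then have "r \<in> {0..<s}" using r(1) by simp
      then show False using s r(3) by (auto simp: E_def)
    qed
    then show "s \<in> ({0..L} \<inter> \<alpha> -` frontier C - \<alpha> -` \<real>\<^sub>\<ge>\<^sub>0) - (\<Union>n. Z n)"
      using s by (auto simp: E_def Arg2pi_eq_0 complex_nonneg_Reals_iff complex_is_Real_iff)
  next
    fix s assume s: "s \<in> ({0..L} \<inter> \<alpha> -` frontier C - \<alpha> -` \<real>\<^sub>\<ge>\<^sub>0) - (\<Union>n. Z n)"
    have "\<alpha> r \<noteq> \<alpha> s" if r: "r \<in> {0..<s}" for r
    proof
      assume eq: "\<alpha> r = \<alpha> s"
      obtain n where "1 / real (Suc n) < s - r" using r nat_approx_posE[of "s - r"] by auto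
      then have "(r, s) \<in> {p \<in> {0..L} \<times> {0..L}. fst p \<le> snd p - 1 / real (Suc n) \<and> \<alpha> (fst p) = \<alpha> (snd p)}"
        using r s eq by auto
      then have "s \<in> Z n" unfolding Z_def by (metis (no_types, lifting) imageI snd_conv)
      then show False using s by blast
    qed
    then show "s \<in> E"
      using s by (auto simp: E_def Arg2pi_eq_0 complex_nonneg_Reals_iff complex_is_Real_iff)
  qed
  then show ?thesis using Zb A R by simp
qed

lemma bdry_param_inj: "inj_on bdry_param E"
proof (rule inj_onI)
  fix s r assume s: "s \<in> E" and r: "r \<in> E" and eq: "bdry_param s = bdry_param r"
  have "\<alpha> s = bdry (bdry_param s)" "\<alpha> r = bdry (bdry_param r)" using s r by (simp_all add: E_def bdry_at_param)
  then have "\<alpha> s = \<alpha> r" using eq by simp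
  then show "s = r" using s r unfolding E_def by (cases s r rule: linorder_cases) auto
qed

lemma bdry_param_image: "bdry_param ` E = {y \<in> {0<..<bdry_len}. bdry y \<in> range \<alpha>}"
proof (intro set_eqI iffI)
  fix y assume "y \<in> bdry_param ` E"
  then obtain s where s: "s \<in> E" "y = bdry_param s" by blast
  then have "bdry y = \<alpha> s" by (simp add: E_def bdry_at_param)
  moreover have "0 < y" "y < bdry_len" using s bdry_param_pos[of s] bdry_param_bounds[of s] by (auto simp: E_def)
  ultimately show "y \<in> {y \<in> {0<..<bdry_len}. bdry y \<in> range \<alpha>}" by auto
next
  fix y assume y: "y \<in> {y \<in> {0<..<bdry_len}. bdry y \<in> range \<alpha>}"
  \<comment> \<open>The parameters of one point within \<open>{0..L}\<close> form a compact set, so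
    a first one exists.\<close>
  define K where "K = {0..L} \<inter> \<alpha> -` {bdry y}"
  have "closed (\<alpha> -` {bdry y})"
    by (rule vimage_closed[OF closed_singleton])
  then have "compact K" unfolding K_def by (simp add: compact_Int_closed)
  obtain r where "r \<in> {0..<L}" "\<alpha> r = bdry y" using y range_eq by (metis (no_types, lifting) imageE mem_Collect_eq)
  then have "r \<in> K" by (simp add: K_def)
  then have "K \<noteq> {}" by blast
  then obtain s where s: "s \<in> K" "\<And>r. r \<in> K \<Longrightarrow> s \<le> r"
    using compact_attains_inf[OF \<open>compact K\<close>] by blast
  have eq: "\<alpha> s = bdry y" using s(1) by (simp add: K_def)
  have ang: "0 < ang y" "ang y < 2 * pi"
    using y ang_less_iff[of 0 y] ang_range[of y] ang_ell[of 0] by (auto simp: ell_0)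
  then have Arg: "Arg2pi (\<alpha> s) = ang y" unfolding eq bdry_def by (intro Arg2pi_rad) auto
  have "s \<in> E"
    unfolding E_def
  proof (intro CollectI conjI ballI)
    show "s \<in> {0..L}" using s(1) by (simp add: K_def)
    show "\<alpha> s \<in> frontier C" unfolding eq bdry_def by (rule rad_frontier)
    show "Arg2pi (\<alpha> s) \<noteq> 0" using Arg ang by simp
    show "\<alpha> r \<noteq> \<alpha> s" if "r \<in> {0..<s}" for r
      using s(2)[of r] that eq s(1) by (auto simp: K_def)
  qed
  moreover have "bdry_param s = y" by (simp add: bdry_param_def Arg ell_ang)
  ultimately show "y \<in> bdry_param ` E" by blast
qed

lemma bdry_param_deriv_E:
  assumes "s \<in> E"
  obtains e where "e = 1 \<or> e = -1" "\<alpha>' s = e *\<^sub>R bdry' (bdry_param s)" "(bdry_param has_real_derivative e) (at s)"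
  using assms bdry_param_deriv[of s] unfolding E_def by blast

lemma bdry_param_continuous: "continuous_on E bdry_param"
  by (intro continuous_at_imp_continuous_on ballI) (metis DERIV_isCont bdry_param_deriv_E)

lemma bdry_param_transfer:
  fixes f :: "real \<Rightarrow> 'a::euclidean_space"
  assumes S: "S \<subseteq> E" "S \<in> sets borel" and f: "(\<lambda>s. f (bdry_param s)) absolutely_integrable_on S"
  shows "f absolutely_integrable_on bdry_param ` S" "integral (bdry_param ` S) f = integral S (\<lambda>s. f (bdry_param s))"
proof -
  \<comment> \<open>Off \<open>E\<close> the derivative may have any value or fail to exist; the
    value 1 makes the Jacobian factor 1 everywhere.\<close>
  define h where "h s = (if s \<in> E then deriv bdry_param s else 1)" for s
  have h: "\<bar>h s\<bar> = 1" "s \<in> E \<Longrightarrow> (bdry_param has_real_derivative h s) (at s)" for s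
  proof -
    have *: "\<bar>deriv bdry_param s\<bar> = 1 \<and> (bdry_param has_real_derivative deriv bdry_param s) (at s)" if "s \<in> E"
    proof -
      obtain e where "e = 1 \<or> e = -1" "(bdry_param has_real_derivative e) (at s)" using bdry_param_deriv_E[OF \<open>s \<in> E\<close>] by metis
      then show ?thesis using DERIV_imp_deriv[of bdry_param e s] by auto
    qed
    show "\<bar>h s\<bar> = 1" using * by (simp add: h_def)
    show "(bdry_param has_real_derivative h s) (at s)" if "s \<in> E" using *[OF that] that by (simp add: h_def)
  qed
  have "f absolutely_integrable_on bdry_param ` S \<and> integral (bdry_param ` S) f = integral S (\<lambda>s. f (bdry_param s))"
  proof (subst has_absolute_integral_change_of_variables_real[of S bdry_param h f, symmetric])
    show "(bdry_param has_real_derivative h x) (at x within S)" if "x \<in> S" for x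
      using h(2) that S(1) has_field_derivative_at_within by blast
  qed (use S f h(1) inj_on_subset[OF bdry_param_inj] in auto)
  then show "f absolutely_integrable_on bdry_param ` S" "integral (bdry_param ` S) f = integral S (\<lambda>s. f (bdry_param s))" by blast+
qed

text \<open>The curvature vector of the curve carried over to the boundary. Reversing a unit speed
  curve does not change its second derivative, so no sign is attached where the curve runs against
  the boundary.\<close>

definition bdry_k :: "real \<Rightarrow> complex" where
  "bdry_k y = (if y \<in> bdry_param ` E then k (the_inv_into E bdry_param y) else 0)"

lemma bdry_k_par: "s \<in> E \<Longrightarrow> bdry_k (bdry_param s) = k s"
  by (simp add: bdry_k_def the_inv_into_f_f[OF bdry_param_inj])

text \<open>Off the contact set \<open>bdry_k\<close> is 0 and \<open>f 0 = 0\<close>, so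
  \<open>T\<close> may be a whole interval although only its contact points correspond to parameters
  in \<open>S\<close>.\<close>

lemma bdry_k_integrals:
  fixes f :: "complex \<Rightarrow> 'a::euclidean_space"
  assumes f: "(\<lambda>s. f (k s)) absolutely_integrable_on {0..L}" and f0: "f 0 = 0" and S: "S \<subseteq> E" "S \<in> sets borel"
    and T: "bdry_param ` S = T \<inter> bdry_param ` E"
  shows "(\<lambda>y. f (bdry_k y)) absolutely_integrable_on T" "integral T (\<lambda>y. f (bdry_k y)) = integral S (\<lambda>s. f (k s))"
proof -
  have "(\<lambda>s. f (k s)) absolutely_integrable_on S"
    by (rule set_integrable_subset[OF f]) (use S E_sub in auto)
  moreover have "indicator S s *\<^sub>R f (k s) = indicator S s *\<^sub>R f (bdry_k (bdry_param s))" for s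
    using S(1) bdry_k_par[of s] by (auto simp: indicator_def)
  ultimately have i: "(\<lambda>s. f (bdry_k (bdry_param s))) absolutely_integrable_on S"
    unfolding set_integrable_def by simp
  note t = bdry_param_transfer[OF S, of "\<lambda>y. f (bdry_k y)", OF i]
  have eq: "(\<lambda>y. indicator (bdry_param ` S) y *\<^sub>R f (bdry_k y)) = (\<lambda>y. indicator T y *\<^sub>R f (bdry_k y))"
    using T f0 by (auto simp: indicator_def bdry_k_def)
  show "(\<lambda>y. f (bdry_k y)) absolutely_integrable_on T"
    using t(1) unfolding set_integrable_def eq .
  have "integral T (\<lambda>y. f (bdry_k y)) = integral T (\<lambda>y. if y \<in> bdry_param ` E then f (bdry_k y) else 0)"
    by (rule integral_cong) (simp add: bdry_k_def f0)
  also have "\<dots> = integral (bdry_param ` S) (\<lambda>y. f (bdry_k y))"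
    unfolding T by (subst Int_commute) (rule integral_restrict_Int)
  also have "\<dots> = integral S (\<lambda>s. f (k s))"
    unfolding t(2) by (rule integral_cong) (use S(1) bdry_k_par in auto)
  finally show "integral T (\<lambda>y. f (bdry_k y)) = integral S (\<lambda>s. f (k s))" .
qed

text \<open>The open sets on which the tangent is constant have a countable subfamily with the same
  union, and each contributes one value. The parameters themselves need not be countable.\<close>

lemma countable_noncontact: "countable (bdry' ` ({0..bdry_len} - bdry_param ` E))"
proof -
  define F where "F = {V. open V \<and> (\<exists>c. \<forall>x\<in>V. bdry' x = c)}"
  obtain F' where F': "F' \<subseteq> F" "countable F'" "\<Union>F' = \<Union>F"
    using Lindelof[of F] by (auto simp: F_def)
  have "countable (\<Union>V\<in>F'. bdry' ` V)"
  proof (rule countable_UN[OF F'(2)])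
    fix V assume "V \<in> F'"
    then obtain c where "\<forall>x\<in>V. bdry' x = c" using F'(1) by (auto simp: F_def)
    then have "bdry' ` V \<subseteq> {c}" by auto
    then show "countable (bdry' ` V)" by (meson countable_empty countable_insert countable_subset)
  qed
  \<comment> \<open>The ends 0 and \<open>bdry_len\<close> are outside the image of \<open>E\<close>
    even if the boundary point there is a contact point, so their values are added by hand.\<close>
  moreover have "bdry' ` ({0..bdry_len} - bdry_param ` E) \<subseteq> (\<Union>V\<in>F'. bdry' ` V) \<union> {bdry' 0, bdry' bdry_len}"
  proof
    fix z assume "z \<in> bdry' ` ({0..bdry_len} - bdry_param ` E)"
    then obtain y where y: "y \<in> {0..bdry_len}" "y \<notin> bdry_param ` E" "z = bdry' y" by blast
    show "z \<in> (\<Union>V\<in>F'. bdry' ` V) \<union> {bdry' 0, bdry' bdry_len}"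
    proof (cases "y = 0 \<or> y = bdry_len")
      case False
      then have "bdry y \<notin> range \<alpha>" using y by (auto simp: bdry_param_image)
      from bdry'_locally_constant[OF this] obtain V where V: "open V" "y \<in> V" "\<forall>x\<in>V. bdry' x = bdry' y"
        unfolding eventually_nhds by blast
      then have "y \<in> \<Union>F'" unfolding F'(3) by (auto simp: F_def)
      then show ?thesis using y(3) by auto
    qed (use y in auto)
  qed
  ultimately show ?thesis by (meson countable_Un countable_empty countable_insert countable_subset)
qed

lemma bdry'_increment:
  fixes \<phi> :: "complex \<Rightarrow> real"
  assumes \<phi>: "bounded_linear \<phi>" and ab: "0 \<le> a" "a \<le> b" "b \<le> bdry_len"
  shows "\<bar>\<phi> (bdry' b) - \<phi> (bdry' a)\<bar> \<le> integral {a..b} (\<lambda>y. \<bar>\<phi> (bdry_k y)\<bar>)"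
proof -
  define u where "u y = \<phi> (bdry' y)" for y
  define B where "B = {s \<in> E. bdry_param s \<in> {a..b}}"
  \<comment> \<open>On \<open>B1\<close> the curve runs along the boundary, on \<open>B2\<close>
    against it. Writing equality as membership of a continuous function in \<open>{0}\<close> makes
    \<open>B1\<close> Borel.\<close>
  define B1 where "B1 = {s \<in> B. \<alpha>' s - bdry' (bdry_param s) \<in> {0}}"
  define B2 where "B2 = B - B1"
  have Bb: "B \<in> sets borel" unfolding B_def
    by (intro borel_preimage_continuous_on bdry_param_continuous E_borel closed_atLeastAtMost)
  have BE: "B \<subseteq> E" by (auto simp: B_def)
  have "continuous_on B (\<lambda>s. \<alpha>' s - bdry' (bdry_param s))"
    by (intro continuous_intros continuous_on_compose2[OF bdry'_continuous[of UNIV]]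
        continuous_on_subset[OF bdry_param_continuous BE] continuous_on_subset[OF deriv_cont]) auto
  then have B1b: "B1 \<in> sets borel" unfolding B1_def by (intro borel_preimage_continuous_on Bb closed_singleton)
  have B2b: "B2 \<in> sets borel" unfolding B2_def using Bb B1b by simp
  have B12: "B1 \<subseteq> {0..L}" "B2 \<subseteq> {0..L}" using E_sub BE by (auto simp: B1_def B2_def)
  have \<alpha>1: "\<alpha>' s = bdry' (bdry_param s)" if "s \<in> B1" for s using that by (simp add: B1_def)
  have \<alpha>2: "\<alpha>' s = - bdry' (bdry_param s)" if s: "s \<in> B2" for s
  proof -
    have "s \<in> E" using s BE by (auto simp: B2_def)
    then obtain e :: real where "e = 1 \<or> e = -1" "\<alpha>' s = e *\<^sub>R bdry' (bdry_param s)" using bdry_param_deriv_E by metis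
    moreover have "\<alpha>' s \<noteq> bdry' (bdry_param s)" using s by (auto simp: B1_def B2_def)
    ultimately show ?thesis by auto
  qed
  note F1 = has_density_bounded_linear[OF dens \<phi>]
  \<comment> \<open>On \<open>B2\<close> the boundary component is
    \<open>- \<phi> (\<alpha>' s)\<close>; this density has the same modulus, so both parts
    contribute to one integral.\<close>
  note F2 = has_density_bounded_linear[OF dens bounded_linear_minus[OF \<phi>]]
  have lin: "\<phi> (- z) = - \<phi> z" for z using \<phi> by (simp add: linear_neg bounded_linear.linear)
  have ai: "(\<lambda>s. \<bar>\<phi> (k s)\<bar>) absolutely_integrable_on {0..L}"
    using set_integrable_abs[OF has_density_abs_integrable[OF F1]] .
  have ai': "(\<lambda>s. \<bar>\<phi> (k s)\<bar>) integrable_on X" if "X \<subseteq> {0..L}" "X \<in> sets borel" for X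
    using set_lebesgue_integral_eq_integral(1)[OF set_integrable_subset[OF ai _ that(1)]] that(2) by simp
  have sum: "integral B1 (\<lambda>s. \<bar>\<phi> (k s)\<bar>) + integral B2 (\<lambda>s. \<bar>\<phi> (k s)\<bar>) = integral B (\<lambda>s. \<bar>\<phi> (k s)\<bar>)"
  proof -
    have "B1 \<union> B2 = B" "B1 \<inter> B2 = {}" by (auto simp: B1_def B2_def)
    then show ?thesis
      using Henstock_Kurzweil_Integration.integral_Un[OF ai'[OF B12(1) B1b] ai'[OF B12(2) B2b]] by simp
  qed
  have le: "\<bar>u b - u a\<bar> \<le> integral B (\<lambda>s. \<bar>\<phi> (k s)\<bar>)"
  proof (rule field_le_epsilon)
    fix e :: real assume e: "e > 0"
    obtain W1 where W1: "W1 \<in> sets lebesgue" "(\<lambda>s. \<phi> (\<alpha>' s)) ` B1 \<subseteq> W1"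
        "emeasure lebesgue W1 \<le> ennreal (integral B1 (\<lambda>s. \<bar>\<phi> (k s)\<bar>) + e / 2)"
      using has_density_image_cover[OF F1 B1b B12(1), of "e / 2"] e by auto
    obtain W2 where W2: "W2 \<in> sets lebesgue" "(\<lambda>s. - \<phi> (\<alpha>' s)) ` B2 \<subseteq> W2"
        "emeasure lebesgue W2 \<le> ennreal (integral B2 (\<lambda>s. \<bar>\<phi> (k s)\<bar>) + e / 2)"
      using has_density_image_cover[OF F2 B2b B12(2), of "e / 2"] e by auto
    define W3 where "W3 = \<phi> ` bdry' ` ({0..bdry_len} - bdry_param ` E)"
    have "countable W3" unfolding W3_def by (intro countable_image countable_noncontact)
    then have W3: "W3 \<in> null_sets lebesgue" by (intro null_sets_completionI countable_imp_null_set_lborel)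
    have cov: "u ` {a..b} \<subseteq> W1 \<union> W2 \<union> W3"
    proof
      fix z assume "z \<in> u ` {a..b}"
      then obtain y where y: "y \<in> {a..b}" "z = \<phi> (bdry' y)" by (auto simp: u_def)
      show "z \<in> W1 \<union> W2 \<union> W3"
      proof (cases "y \<in> bdry_param ` E")
        case False
        then show ?thesis using y ab by (auto simp: W3_def)
      next
        case True
        then obtain s where s: "s \<in> E" "y = bdry_param s" by blast
        then have "s \<in> B" using y by (simp add: B_def)
        show ?thesis
        proof (cases "s \<in> B1")
          case True
          then show ?thesis using W1(2) \<alpha>1[OF True] y s by auto
        next
          case False
          then have B2: "s \<in> B2" using \<open>s \<in> B\<close> by (simp add: B2_def)
          have "z = - \<phi> (\<alpha>' s)" using \<alpha>2[OF B2] y s by (simp add: lin)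
          then show ?thesis using W2(2) B2 by auto
        qed
      qed
    qed
    have "continuous_on {a..b} u" unfolding u_def
      by (rule continuous_on_compose2[OF linear_continuous_on[OF \<phi>] bdry'_continuous]) auto
    \<comment> \<open>By connectedness the image contains the interval between the end values, so
      the increment is at most the measure of any cover of the image.\<close>
    then have "connected (u ` {a..b})" by (intro connected_continuous_image) auto
    moreover have "u a \<in> u ` {a..b}" "u b \<in> u ` {a..b}" using ab by auto
    ultimately have "{min (u a) (u b)..max (u a) (u b)} \<subseteq> u ` {a..b}"
      by (simp add: connected_contains_Icc max_def min_def)
    then have "{min (u a) (u b)..max (u a) (u b)} \<subseteq> W1 \<union> W2 \<union> W3" using cov by blast
    moreover have "emeasure lebesgue {min (u a) (u b)..max (u a) (u b)} = ennreal \<bar>u b - u a\<bar>"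
      by (simp add: max_def min_def)
    ultimately have "ennreal \<bar>u b - u a\<bar> \<le> emeasure lebesgue (W1 \<union> W2 \<union> W3)"
      using emeasure_mono[of "{min (u a) (u b)..max (u a) (u b)}" "W1 \<union> W2 \<union> W3" lebesgue] W1(1) W2(1) W3 by auto
    also have "\<dots> \<le> emeasure lebesgue (W1 \<union> W2) + emeasure lebesgue W3"
      using W1(1) W2(1) W3 by (intro emeasure_subadditive) auto
    also have "\<dots> = emeasure lebesgue (W1 \<union> W2)" using W3 by auto
    also have "\<dots> \<le> emeasure lebesgue W1 + emeasure lebesgue W2"
      using W1(1) W2(1) by (intro emeasure_subadditive) auto
    also have "\<dots> \<le> ennreal (integral B1 (\<lambda>s. \<bar>\<phi> (k s)\<bar>) + e / 2) + ennreal (integral B2 (\<lambda>s. \<bar>\<phi> (k s)\<bar>) + e / 2)"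
      using W1(3) W2(3) by (rule add_mono)
    also have "\<dots> = ennreal (integral B (\<lambda>s. \<bar>\<phi> (k s)\<bar>) + e)"
    proof -
      have "integral B1 (\<lambda>s. \<bar>\<phi> (k s)\<bar>) \<ge> 0" "integral B2 (\<lambda>s. \<bar>\<phi> (k s)\<bar>) \<ge> 0"
        by (intro integral_nonneg ai' B12 B1b B2b, simp)+
      then show ?thesis unfolding sum[symmetric] using e by (simp flip: ennreal_plus)
    qed
    finally have "ennreal \<bar>u b - u a\<bar> \<le> ennreal (integral B (\<lambda>s. \<bar>\<phi> (k s)\<bar>) + e)" .
    moreover have "integral B (\<lambda>s. \<bar>\<phi> (k s)\<bar>) \<ge> 0"
      using E_sub BE by (intro integral_nonneg ai' Bb) auto
    ultimately show "\<bar>u b - u a\<bar> \<le> integral B (\<lambda>s. \<bar>\<phi> (k s)\<bar>) + e"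
      using e by (subst (asm) ennreal_le_iff) auto
  qed
  have "bdry_param ` B = {a..b} \<inter> bdry_param ` E" by (auto simp: B_def)
  moreover have "\<phi> 0 = 0" using \<phi> by (simp add: linear_0 bounded_linear.linear)
  ultimately have "integral {a..b} (\<lambda>y. \<bar>\<phi> (bdry_k y)\<bar>) = integral B (\<lambda>s. \<bar>\<phi> (k s)\<bar>)"
    using bdry_k_integrals(2)[of "\<lambda>z. \<bar>\<phi> z\<bar>", OF ai _ BE Bb] by simp
  then show ?thesis using le by (simp add: u_def)
qed

text \<open>Real and imaginary part are treated separately with their own dominating functions.
  Adding the squares gives \<open>norm (w y) \<le> norm (bdry_k y)\<close> pointwise, with no
  constant in front.\<close>

lemma boundary_density:
  obtains w where "has_density bdry' w 0 bdry_len" "(\<lambda>y. (norm (w y))\<^sup>2) integrable_on {0..bdry_len}"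
    "integral {0..bdry_len} (\<lambda>y. (norm (w y))\<^sup>2) \<le> integral E (\<lambda>s. (norm (k s))\<^sup>2)"
proof -
  have image: "bdry_param ` E = {0..bdry_len} \<inter> bdry_param ` E" by (auto simp: bdry_param_image)
  have lin: "\<exists>v. has_density (\<lambda>y. \<phi> (bdry' y)) v 0 bdry_len \<and> (\<forall>y. \<bar>v y\<bar> \<le> \<bar>\<phi> (bdry_k y)\<bar>)"
    if \<phi>: "bounded_linear \<phi>" for \<phi> :: "complex \<Rightarrow> real"
  proof -
    have "(\<lambda>s. \<bar>\<phi> (k s)\<bar>) absolutely_integrable_on {0..L}"
      using set_integrable_abs[OF has_density_abs_integrable[OF has_density_bounded_linear[OF dens \<phi>]]] .
    moreover have "\<phi> 0 = 0" using \<phi> by (simp add: linear_0 bounded_linear.linear)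
    ultimately have "(\<lambda>y. \<bar>\<phi> (bdry_k y)\<bar>) absolutely_integrable_on {0..bdry_len}"
      using bdry_k_integrals(1)[of "\<lambda>z. \<bar>\<phi> z\<bar>" E "{0..bdry_len}"] E_borel image by simp
    then show ?thesis
      using dominated_increments_density[of bdry_len "\<lambda>y. \<bar>\<phi> (bdry_k y)\<bar>" "\<lambda>y. \<phi> (bdry' y)"] bdry'_increment[OF \<phi>] bdry_len_pos
      by (metis abs_ge_zero less_imp_le)
  qed
  obtain v1 where v1: "has_density (\<lambda>y. Re (bdry' y)) v1 0 bdry_len" "\<And>y. \<bar>v1 y\<bar> \<le> \<bar>Re (bdry_k y)\<bar>"
    using lin[OF bounded_linear_Re] by blast
  obtain v2 where v2: "has_density (\<lambda>y. Im (bdry' y)) v2 0 bdry_len" "\<And>y. \<bar>v2 y\<bar> \<le> \<bar>Im (bdry_k y)\<bar>"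
    using lin[OF bounded_linear_Im] by blast
  define w where "w y = Complex (v1 y) (v2 y)" for y
  have w: "has_density bdry' w 0 bdry_len" unfolding w_def by (rule has_density_complexI[OF v1(1) v2(1)])
  have le: "(norm (w y))\<^sup>2 \<le> (norm (bdry_k y))\<^sup>2" for y
    using v1(2)[of y] v2(2)[of y] unfolding cmod_power2 w_def by (simp add: add_mono abs_le_square_iff)
  have "(\<lambda>s. (norm (k s))\<^sup>2) absolutely_integrable_on {0..L}"
    by (rule nonnegative_absolutely_integrable_1[OF L2]) simp
  note bk2 = bdry_k_integrals[of "\<lambda>z. (norm z)\<^sup>2", OF this _ order_refl E_borel image]
  have ki: "(\<lambda>y. (norm (bdry_k y))\<^sup>2) integrable_on {0..bdry_len}"
    using bk2(1) by (simp add: absolutely_integrable_on_def)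
  have "w \<in> borel_measurable (lebesgue_on {0..bdry_len})"
    using has_density_abs_integrable[OF w] absolutely_integrable_measurable[of "{0..bdry_len}" w] by simp
  then have "(\<lambda>y. (norm (w y))\<^sup>2) \<in> borel_measurable (lebesgue_on {0..bdry_len})" by simp
  then have wi: "(\<lambda>y. (norm (w y))\<^sup>2) integrable_on {0..bdry_len}"
    by (rule measurable_bounded_by_integrable_imp_integrable[OF _ ki]) (use le in auto)
  have "integral {0..bdry_len} (\<lambda>y. (norm (w y))\<^sup>2) \<le> integral {0..bdry_len} (\<lambda>y. (norm (bdry_k y))\<^sup>2)"
    by (rule integral_le[OF wi ki le])
  also have "\<dots> = integral E (\<lambda>s. (norm (k s))\<^sup>2)" using bk2(2) by simp
  finally show thesis using that[OF w wi] by blast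
qed

end

text \<open>For every \<open>d > 0\<close> the norm is at most \<open>d\<close> plus its square over
  \<open>d\<close>; the square contributes nothing and \<open>d\<close> is arbitrary.\<close>

lemma square_integral_zero_imp_norm:
  fixes k :: "real \<Rightarrow> complex"
  assumes "(\<lambda>t. norm (k t)) integrable_on {x..y}" "(\<lambda>t. (norm (k t))\<^sup>2) integrable_on {x..y}" "x \<le> y"
    and z: "integral {x..y} (\<lambda>t. (norm (k t))\<^sup>2) \<le> 0"
  shows "integral {x..y} (\<lambda>t. norm (k t)) \<le> 0"
proof (rule field_le_epsilon)
  fix e :: real assume e: "e > 0"
  \<comment> \<open>The summand 1 keeps the denominator positive when \<open>x = y\<close>.\<close>
  define d where "d = e / (y - x + 1)"
  have d: "d > 0" using e assms(3) by (simp add: d_def)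
  have i: "(\<lambda>t. d + (1 / d) * (norm (k t))\<^sup>2) integrable_on {x..y}"
    using integrable_on_cmult_left[OF assms(2), of "1 / d"] by (intro integrable_add) auto
  have "integral {x..y} (\<lambda>t. norm (k t)) \<le> integral {x..y} (\<lambda>t. d + (1 / d) * (norm (k t))\<^sup>2)"
  proof (rule integral_le[OF assms(1) i])
    fix t
    have "0 \<le> (norm (k t) - d)\<^sup>2" by simp
    then have "2 * d * norm (k t) \<le> d\<^sup>2 + (norm (k t))\<^sup>2" by (simp add: power2_diff algebra_simps)
    moreover have "0 \<le> d * norm (k t)" using d by simp
    ultimately have "d * norm (k t) \<le> d\<^sup>2 + (norm (k t))\<^sup>2" by linarith
    then show "norm (k t) \<le> d + (1 / d) * (norm (k t))\<^sup>2"
      using d by (simp add: field_simps power2_eq_square)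
  qed
  also have "\<dots> = d * (y - x) + (1 / d) * integral {x..y} (\<lambda>t. (norm (k t))\<^sup>2)"
    using integrable_on_cmult_left[OF assms(2), of "1 / d"] assms(3)
    by (subst Henstock_Kurzweil_Integration.integral_add) auto
  also have "\<dots> \<le> d * (y - x)" using z d by (simp add: mult_nonneg_nonpos divide_nonpos_pos)
  also have "\<dots> \<le> e" using e assms(3) by (simp add: d_def field_simps)
  finally show "integral {x..y} (\<lambda>t. norm (k t)) \<le> 0 + e" by simp
qed

section \<open>Rigidity and the surrounded set\<close>

context hull_density begin

lemma deriv_constant_off_contact:
  assumes min: "integral {0..L} (\<lambda>s. (norm (k s))\<^sup>2) \<le> integral E (\<lambda>s. (norm (k s))\<^sup>2)"
    and xy: "0 \<le> x" "x \<le> y" "y \<le> L" and off: "\<And>s. x < s \<Longrightarrow> s < y \<Longrightarrow> \<alpha> s \<notin> frontier C"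
  shows "\<alpha>' y = \<alpha>' x"
proof -
  let ?q = "\<lambda>s. (norm (k s))\<^sup>2"
  have q: "?q absolutely_integrable_on {0..L}" by (rule nonnegative_absolutely_integrable_1[OF L2]) simp
  have qi: "?q integrable_on X" if "X \<subseteq> {0..L}" "X \<in> sets borel" for X
    using set_lebesgue_integral_eq_integral(1)[OF set_integrable_subset[OF q _ that(1)]] that(2) by simp
  have sub: "{x<..<y} \<subseteq> {0..L}" using xy by auto
  \<comment> \<open>The open interval is disjoint from \<open>E\<close> although its ends may be
    contact parameters. The whole energy already sits on \<open>E\<close>, so none is left for this
    interval.\<close>
  have "integral {x<..<y} ?q + integral E ?q = integral ({x<..<y} \<union> E) ?q"
  proof (rule Henstock_Kurzweil_Integration.integral_Un[symmetric])
    have "{x<..<y} \<inter> E = {}" using off by (auto simp: E_def)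
    then show "negligible ({x<..<y} \<inter> E)" by simp
  qed (use qi sub E_sub E_borel in auto)
  also have "\<dots> \<le> integral {0..L} ?q"
    using sub E_sub E_borel by (intro integral_subset_le qi) auto
  finally have "integral {x<..<y} ?q \<le> 0" using min by simp
  then have z: "integral {x..y} ?q \<le> 0" by (simp add: integral_open_interval_real[symmetric])
  have "norm (\<alpha>' y - \<alpha>' x) \<le> integral {x..y} (\<lambda>t. norm (k t))"
    by (rule has_density_diff_le[OF dens xy])
  also have "\<dots> \<le> 0"
    using xy by (intro square_integral_zero_imp_norm z qi has_density_integrable(2)[OF dens]) auto
  finally show ?thesis by simp
qed

text \<open>
  Off the contact set the curve is straight, so from a contact point on it stays in the supporting
  line, where it never leaves the boundary.
\<close>

lemma contact_everywhere:
  assumes min: "integral {0..L} (\<lambda>s. (norm (k s))\<^sup>2) \<le> integral E (\<lambda>s. (norm (k s))\<^sup>2)"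
  shows "\<alpha> s \<in> frontier C"
proof -
  have step: "\<alpha> s \<in> frontier C" if a: "\<alpha> a \<in> frontier C" "0 \<le> a" and s: "a \<le> s" "s \<le> L" for a s
  proof (rule ccontr)
    assume ns: "\<alpha> s \<notin> frontier C"
    \<comment> \<open>The last contact parameter \<open>b\<close> up to \<open>s\<close> is the
      place where the curve would leave the boundary.\<close>
    define K where "K = {a..s} \<inter> \<alpha> -` frontier C"
    have "compact K" unfolding K_def by (intro compact_Int_closed compact_Icc vimage_closed frontier_closed)
    moreover have "a \<in> K" using a s by (simp add: K_def)
    ultimately obtain b where b: "b \<in> K" "\<And>r. r \<in> K \<Longrightarrow> r \<le> b"
      using compact_attains_sup[of K] by blast
    have bf: "\<alpha> b \<in> frontier C" and bb: "a \<le> b" "b \<le> s" using b(1) by (auto simp: K_def)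
    have const: "\<alpha>' r = \<alpha>' b" if "r \<in> {b..s}" for r
    proof (rule deriv_constant_off_contact[OF min])
      fix t assume "b < t" "t < r"
      then show "\<alpha> t \<notin> frontier C" using b(2)[of t] bb that by (auto simp: K_def)
    qed (use that a s bb in auto)
    have "((\<lambda>r. \<alpha>' b) has_integral \<alpha> s - \<alpha> b) {b..s}"
    proof (rule has_integral_eq)
      show "(\<alpha>' has_integral \<alpha> s - \<alpha> b) {b..s}"
        by (intro fundamental_theorem_of_calculus bb(2) has_vector_derivative_at_within[OF deriv])
      show "\<alpha>' r = \<alpha>' b" if "r \<in> {b..s}" for r by (rule const[OF that])
    qed
    moreover have "((\<lambda>r. \<alpha>' b) has_integral (s - b) *\<^sub>R \<alpha>' b) {b..s}"
      using has_integral_const_real[of "\<alpha>' b" b s] bb by simp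
    ultimately have "\<alpha> s - \<alpha> b = (s - b) *\<^sub>R \<alpha>' b" by (rule has_integral_unique)
    then have eq: "\<alpha> s = \<alpha> b + (s - b) *\<^sub>R \<alpha>' b" by (simp add: algebra_simps)
    have d: "dual (\<alpha> b) (nu (\<alpha> b))" by (rule dual_nu[OF bf])
    then have "\<alpha> s \<bullet> nu (\<alpha> b) = 1"
      using dual_tangent[OF d] unfolding eq by (simp add: inner_add_left dual_def)
    then have "dual (\<alpha> s) (nu (\<alpha> b))" using d by (simp add: dual_def)
    then show False using ns dual_frontier curve_in_C by blast
  qed
  \<comment> \<open>Any supporting line of the hull touches the curve, which gives a first contact
    parameter.\<close>
  obtain a where a: "a \<in> {0..<L}" "\<alpha> a \<in> frontier C"
  proof -
    obtain r where "dual (\<alpha> r) (nrm 0)" by (rule face_contact[OF rad_in_C dual_nrm])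
    then have "\<alpha> r \<in> frontier C" by (rule dual_frontier[OF curve_in_C])
    moreover obtain a where "a \<in> {0..<L}" "\<alpha> r = \<alpha> a" using range_eq by (metis imageE rangeI)
    ultimately show ?thesis using that by simp
  qed
  \<comment> \<open>The argument runs only forwards, from \<open>a\<close> to \<open>L\<close>.
    Periodicity moves the contact from \<open>L\<close> to 0, and a second run reaches every
    parameter.\<close>
  have "\<alpha> L \<in> frontier C" by (rule step[OF a(2)]) (use a(1) in auto)
  moreover have "\<alpha> L = \<alpha> 0" using periodic unfolding Defs.periodic_def by (metis add_0)
  ultimately have 0: "\<alpha> 0 \<in> frontier C" by simp
  obtain r where "r \<in> {0..<L}" "\<alpha> s = \<alpha> r" using range_eq by (metis imageE rangeI)
  then show ?thesis using step[OF 0, of r] by simp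
qed

text \<open>The expression is the cross product of \<open>\<alpha> s - z\<close> and the velocity.
  If it vanished, \<open>z\<close> would lie on the tangent line at \<open>\<alpha> s\<close>, which
  is a supporting line and misses the interior.\<close>

lemma rotation_nonzero:
  assumes s: "\<alpha> s \<in> frontier C" and z: "z \<in> interior C"
  shows "Im (\<alpha>' s * cnj (\<alpha> s - z)) \<noteq> 0"
proof
  assume 0: "Im (\<alpha>' s * cnj (\<alpha> s - z)) = 0"
  define a b p q x y where "a = Re (\<alpha>' s)" and "b = Im (\<alpha>' s)" and "p = Re (\<alpha> s - z)" and "q = Im (\<alpha> s - z)"
    and "x = Re (nu (\<alpha> s))" and "y = Im (nu (\<alpha> s))"
  note defs = a_def b_def p_def q_def x_def y_def
  have d: "dual (\<alpha> s) (nu (\<alpha> s))" by (rule dual_nu[OF s])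
  have "a\<^sup>2 + b\<^sup>2 = 1" using unit[of s] unfolding defs by (simp flip: cmod_power2)
  moreover have "a * x + b * y = 0" using dual_tangent[OF d] unfolding defs by (simp add: inner_complex_def)
  moreover have "b * p - a * q = 0" using 0 unfolding defs by (simp add: algebra_simps)
  ultimately have "p * x + q * y = 0" by algebra
  moreover have "p * x + q * y = (\<alpha> s - z) \<bullet> nu (\<alpha> s)" unfolding defs by (simp add: inner_complex_def)
  moreover have "(\<alpha> s - z) \<bullet> nu (\<alpha> s) > 0"
    using dual_interior[OF z d] d by (simp add: inner_diff_left dual_def)
  ultimately show False by simp
qed

text \<open>Undoes the translation that moved an interior point to 0 and returns to the parameter
  circle of length 1, so that the given curve is recovered.\<close>

definition loop :: "complex \<Rightarrow> real \<Rightarrow> complex" where "loop c t = \<alpha> (L * t) + c"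

lemma loop_deriv: "(loop c has_vector_derivative L *\<^sub>R \<alpha>' (L * t)) (at t)"
proof -
  have "((\<alpha> \<circ> (\<lambda>t. L * t)) has_vector_derivative L *\<^sub>R \<alpha>' (L * t)) (at t)"
    using deriv[of "L * t"] by (intro vector_diff_chain_at) (auto intro!: derivative_eq_intros)
  from has_vector_derivative_add[OF this has_vector_derivative_const[of c]]
  show ?thesis by (simp add: loop_def[abs_def] o_def)
qed

lemma loop_C1: "loop c C1_differentiable_on S"
  unfolding C1_differentiable_on_def
proof (intro exI conjI ballI)
  show "continuous_on S (\<lambda>t. L *\<^sub>R \<alpha>' (L * t))"
    by (intro continuous_intros continuous_on_compose2[OF deriv_cont]) auto
qed (rule loop_deriv)

lemma loop_path: "valid_path (loop c)" "path (loop c)" "pathfinish (loop c) = pathstart (loop c)"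
proof -
  show v: "valid_path (loop c)"
    unfolding valid_path_def by (rule C1_differentiable_imp_piecewise[OF loop_C1])
  show "path (loop c)" by (rule valid_path_imp_path[OF v])
  have "\<alpha> L = \<alpha> 0" using periodic unfolding Defs.periodic_def by (metis add_0)
  then show "pathfinish (loop c) = pathstart (loop c)"
    by (simp add: pathfinish_def pathstart_def loop_def)
qed

lemma loop_image: "path_image (loop c) = (\<lambda>x. x + c) ` range \<alpha>"
proof -
  have "range \<alpha> = \<alpha> ` {0..L}"
    using range_eq by (metis atLeastLessThan_subseteq_atLeastAtMost_iff image_mono order_refl subset_UNIV subset_antisym)
  also have "{0..L} = (\<lambda>t. L * t) ` {0..1}" using L_pos by (simp add: image_mult_atLeastAtMost)
  finally show ?thesis by (simp add: path_image_def loop_def image_image)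
qed

text \<open>The rotation about \<open>z\<close> is continuous and never zero, so it keeps one sign,
  and compactness bounds it away from 0. The accumulated angle is then nonzero.\<close>

lemma winding_number_interior:
  assumes all: "\<And>s. \<alpha> s \<in> frontier C" and z: "z \<in> interior C"
  shows "z + c \<notin> path_image (loop c)" "winding_number (loop c) (z + c) \<noteq> 0"
proof -
  show zn: "z + c \<notin> path_image (loop c)"
    using all z unfolding loop_image by (auto simp: frontier_def)
  define h where "h s = Im (\<alpha>' s * cnj (\<alpha> s - z))" for s
  have hc: "continuous_on X h" for X
    unfolding h_def by (intro continuous_intros cont continuous_on_subset[OF deriv_cont]) auto
  have h0: "h s \<noteq> 0" for s unfolding h_def by (rule rotation_nonzero[OF all z])
  have "continuous_on {0..L} (\<lambda>s. \<bar>h s\<bar>)" by (intro continuous_intros hc)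
  then obtain m where m: "m \<in> {0..L}" "\<And>s. s \<in> {0..L} \<Longrightarrow> \<bar>h m\<bar> \<le> \<bar>h s\<bar>"
    using continuous_attains_inf[of "{0..L}" "\<lambda>s. \<bar>h s\<bar>"] L_pos by force
  define e where "e = L * \<bar>h m\<bar>"
  have e: "e > 0" using h0 L_pos by (simp add: e_def)
  have rot: "Im (L *\<^sub>R \<alpha>' (L * t) * cnj (loop c t - (z + c))) = L * h (L * t)" for t
    unfolding loop_def h_def by (simp add: algebra_simps)
  have conn: "is_interval (h ` UNIV)"
    using connected_continuous_image[OF hc connected_UNIV] by (simp add: is_interval_connected_1)
  show "winding_number (loop c) (z + c) \<noteq> 0"
  proof (cases "h 0 > 0")
    case True
    have "h s > 0" for s
    proof (rule ccontr)
      assume "\<not> h s > 0"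
      then have "0 \<in> h ` UNIV" using conn True by (meson is_interval_1 less_imp_le not_less rangeI)
      then show False using h0 by auto
    qed
    then have "e \<le> Im (vector_derivative (loop c) (at t) * cnj (loop c t - (z + c)))" if "0 < t" "t < 1" for t
      using m(2)[of "L * t"] that L_pos unfolding vector_derivative_at[OF loop_deriv] rot e_def
      by (intro mult_left_mono) (auto simp: abs_of_pos)
    from winding_number_pos_lt[OF loop_path(1) zn e this] show ?thesis by auto
  next
    case False
    have neg: "h s < 0" for s
    proof (rule ccontr)
      assume "\<not> h s < 0"
      then have "0 \<in> h ` UNIV" using conn False by (meson is_interval_1 less_imp_le not_less rangeI)
      then show False using h0 by auto
    qed
    \<comment> \<open>Clockwise rotation becomes counterclockwise on the reversed path, whose
      winding number is the negative.\<close>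
    have rd: "(reversepath (loop c) has_vector_derivative - (L *\<^sub>R \<alpha>' (L * (1 - t)))) (at t)" for t
      using vector_diff_chain_at[of "\<lambda>t. 1 - t" "-1" t "loop c" "L *\<^sub>R \<alpha>' (L * (1 - t))"] loop_deriv[of c "1 - t"]
      by (force simp: reversepath_def o_def intro!: derivative_eq_intros)
    have "e \<le> Im (vector_derivative (reversepath (loop c)) (at t) * cnj (reversepath (loop c) t - (z + c)))"
      if "0 < t" "t < 1" for t
    proof -
      have "L * \<bar>h m\<bar> \<le> L * \<bar>h (L * (1 - t))\<bar>" using m(2)[of "L * (1 - t)"] that L_pos by (intro mult_left_mono) auto
      also have "\<dots> = - (L * h (L * (1 - t)))" using neg[of "L * (1 - t)"] by simp
      finally show ?thesis
        unfolding vector_derivative_at[OF rd] e_def rot[of "1 - t", symmetric] by (simp add: reversepath_def)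
    qed
    then have "0 < Re (winding_number (reversepath (loop c)) (z + c))"
      using loop_path(1) zn e by (intro winding_number_pos_lt[of _ _ e]) (auto simp: valid_path_reversepath)
    then show ?thesis using winding_number_reversepath[OF loop_path(2) zn] by auto
  qed
qed

lemma surrounded_loop:
  assumes all: "\<And>s. \<alpha> s \<in> frontier C"
  shows "surrounded_set (loop c) = (\<lambda>x. x + c) ` C"
proof (intro set_eqI iffI)
  fix w assume w: "w \<in> surrounded_set (loop c)"
  show "w \<in> (\<lambda>x. x + c) ` C"
  proof (rule ccontr)
    assume nw: "w \<notin> (\<lambda>x. x + c) ` C"
    have sub: "path_image (loop c) \<subseteq> (\<lambda>x. x + c) ` C" unfolding loop_image using curve_in_C by auto
    have "convex ((\<lambda>x. x + c) ` C)" using convex_translation[OF convex_C, of c] by (simp add: add.commute)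
    then have "winding_number (loop c) w = 0"
      \<comment> \<open>The translated hull is a convex set containing the curve, so no point
        outside it is encircled.\<close>
      using winding_number_zero_outside[OF loop_path(2) _ loop_path(3) nw sub] by blast
    then show False using w sub nw by (auto simp: surrounded_set_def)
  qed
next
  fix w assume "w \<in> (\<lambda>x. x + c) ` C"
  then obtain z where z: "w = z + c" "z \<in> C" by blast
  show "w \<in> surrounded_set (loop c)"
  proof (cases "w \<in> path_image (loop c)")
    case False
    have "closed (path_image (loop c))" using closed_path_image[OF loop_path(2)] .
    then obtain e where e: "e > 0" "ball w e \<inter> path_image (loop c) = {}"
      using False open_contains_ball[of "- path_image (loop c)"] by (metis ComplI disjoint_eq_subset_Compl open_Compl)
    \<comment> \<open>A point off the curve might still be a boundary point of \<open>C\<close>. An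
      interior point in a ball that misses the curve has the same winding number.\<close>
    have "z \<in> closure (interior C)"
      using z(2) convex_closure_interior[OF convex_C interior_C_nonempty] closure_subset by blast
    then obtain y where y: "y \<in> interior C" "dist y z < e" using e(1) closure_approachable by blast
    have "y + c \<in> ball w e" using y(2) z(1) by (simp add: dist_norm norm_minus_commute algebra_simps)
    then have "winding_number (loop c) w = winding_number (loop c) (y + c)"
      using e by (intro winding_number_eq[OF loop_path(2,3) _ _ connected_ball[of w e]]) auto
    then show ?thesis using winding_number_interior[OF all y(1), of c] False by (simp add: surrounded_set_def)
  qed (simp add: surrounded_set_def)
qed

end

section \<open>Unit speed curves as admissible curves\<close>

lemma unit_speed_loop:
  fixes \<alpha> \<alpha>' k :: "real \<Rightarrow> complex"
  assumes curve: "closed_unit_curve L \<alpha> \<alpha>'"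
    and dens: "has_density \<alpha>' k 0 L" and L2: "(\<lambda>s. (norm (k s))\<^sup>2) integrable_on {0..L}"
  defines "\<gamma> \<equiv> \<lambda>t. \<alpha> (L * t)"
  shows "regular_closed_curve \<gamma>" "bending_energy \<gamma> = integral {0..L} (\<lambda>s. (norm (k s))\<^sup>2)"
    and "velocity \<gamma> t = L *\<^sub>R \<alpha>' (L * t)"
proof -
  interpret closed_unit_curve L \<alpha> \<alpha>' by (rule curve)
  have d: "(\<gamma> has_vector_derivative L *\<^sub>R \<alpha>' (L * t)) (at t)" for t
  proof -
    have "((\<alpha> \<circ> (\<lambda>t. L * t)) has_vector_derivative L *\<^sub>R \<alpha>' (L * t)) (at t)"
      using deriv[of "L * t"] by (intro vector_diff_chain_at) (auto intro!: derivative_eq_intros)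
    then show ?thesis by (simp add: \<gamma>_def o_def)
  qed
  have c: "continuous_on UNIV (\<lambda>t. L *\<^sub>R \<alpha>' (L * t))"
    by (intro continuous_intros continuous_on_compose2[OF deriv_cont]) auto
  have per: "Defs.periodic 1 \<gamma>"
    using periodic by (simp add: Defs.periodic_def \<gamma>_def distrib_left)
  have v: "velocity \<gamma> t = L *\<^sub>R \<alpha>' (L * t)" for t by (rule vector_derivative_at[OF d])
  then show "velocity \<gamma> t = L *\<^sub>R \<alpha>' (L * t)" .
  have dens': "has_density (\<lambda>t. L *\<^sub>R \<alpha>' (L * t)) (\<lambda>t. (L * L) *\<^sub>R k (L * t)) 0 1"
    using has_density_rescale[OF dens L_pos, of L] L_pos by simp
  have "(\<lambda>t. (norm (k (L * t)))\<^sup>2) integrable_on {0..1}"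
    using square_integrable_rescale[OF L2 _ L_pos] L_pos by simp
  from integrable_on_cmult_left[OF this, of "(L * L)\<^sup>2"]
  have L2': "(\<lambda>t. (norm ((L * L) *\<^sub>R k (L * t)))\<^sup>2) integrable_on {0..1}"
    by (simp add: power_mult_distrib)
  have "H2_circle 1 \<gamma>" by (rule H2_circle_of_density[OF _ per d c dens' L2']) simp
  moreover have "\<gamma> C1_differentiable_on UNIV"
    unfolding C1_differentiable_on_def
    by (intro exI[of _ "\<lambda>t. L *\<^sub>R \<alpha>' (L * t)"] conjI ballI d c)
  moreover have "norm (velocity \<gamma> t) > 0" for t using L_pos by (simp add: v unit)
  ultimately show "regular_closed_curve \<gamma>" using per by (simp add: regular_closed_curve_def)
  \<comment> \<open>Arc length is a multiple of the parameter, so its inverse is explicit and the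
    arc-length parametrization is \<alpha> itself.\<close>
  have al: "arc_length \<gamma> = (\<lambda>t. L * t)"
    using L_pos by (intro ext) (simp add: arc_length_def v unit)
  have "inv (\<lambda>t. L * t) = (\<lambda>s. s / L)" by (rule inv_equality) (use L_pos in auto)
  then have "arc_length_param \<gamma> = \<alpha>"
    using L_pos unfolding arc_length_param_def al by (simp add: \<gamma>_def o_def)
  moreover have "curve_length \<gamma> = L" by (simp add: curve_length_def al)
  ultimately show "bending_energy \<gamma> = integral {0..L} (\<lambda>s. (norm (k s))\<^sup>2)"
    using energy_density[OF L_pos periodic deriv deriv_cont dens L2] by (simp add: bending_energy_def)
qed

lemma closed_unit_curve_translate:
  assumes "closed_unit_curve L \<alpha> \<alpha>'" shows "closed_unit_curve L (\<lambda>s. \<alpha> s + c) \<alpha>'"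
proof -
  interpret closed_unit_curve L \<alpha> \<alpha>' by (rule assms)
  show ?thesis
  proof
    show "((\<lambda>s. \<alpha> s + c) has_vector_derivative \<alpha>' s) (at s)" for s
      using has_vector_derivative_add[OF deriv has_vector_derivative_const[of c]] by simp
  qed (use L_pos periodic deriv_cont unit in \<open>auto simp: Defs.periodic_def\<close>)
qed

lemma constant_speed_unit_curve:
  assumes reg: "regular_closed_curve \<gamma>" and cs: "constant_speed \<gamma>"
  obtains L \<alpha> \<alpha>' k where "closed_unit_curve L \<alpha> \<alpha>'" "has_density \<alpha>' k 0 L"
    "(\<lambda>s. (norm (k s))\<^sup>2) integrable_on {0..L}" "\<gamma> = (\<lambda>t. \<alpha> (L * t))"
proof -
  have per: "Defs.periodic 1 \<gamma>" and H2: "H2_circle 1 \<gamma>" and C1: "\<gamma> C1_differentiable_on UNIV"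
    and pos: "\<And>t. norm (velocity \<gamma> t) > 0"
    using reg by (simp_all add: regular_closed_curve_def)
  obtain L where L: "\<And>t. norm (velocity \<gamma> t) = L" using cs by (auto simp: constant_speed_def)
  have L_pos: "L > 0" using pos[of 0] L[of 0] by simp
  obtain D where D: "\<And>t. (\<gamma> has_vector_derivative D t) (at t)" "continuous_on UNIV D"
    using C1 unfolding C1_differentiable_on_def by auto
  have vD: "velocity \<gamma> t = D t" for t by (rule vector_derivative_at[OF D(1)])
  obtain g h where gh: "has_weak_deriv 1 \<gamma> g" "has_weak_deriv 1 g h" "L2_circle 1 h"
    using H2 by (auto simp: H2_circle_def)
  \<comment> \<open>The classical velocity of the continuously differentiable representative has the
    second weak derivative as its density.\<close>
  have h: "has_density D h 0 1" by (rule weak_deriv_twice_density[OF _ per D gh(1,2)]) simp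
  have hi: "(\<lambda>s. (norm (h s))\<^sup>2) integrable_on {0..1}"
    using gh(3) by (simp add: L2_circle_def integrable_lebesgue_on_iff absolutely_integrable_on_def)
  define \<alpha> where "\<alpha> s = \<gamma> ((1 / L) * s)" for s
  define \<alpha>' where "\<alpha>' s = (1 / L) *\<^sub>R D ((1 / L) * s)" for s
  define k where "k s = (1 / L * (1 / L)) *\<^sub>R h ((1 / L) * s)" for s
  have "closed_unit_curve L \<alpha> \<alpha>'"
  proof
    show "L > 0" by (rule L_pos)
    show "Defs.periodic L \<alpha>"
      using per L_pos by (simp add: Defs.periodic_def \<alpha>_def add_divide_distrib)
    show "(\<alpha> has_vector_derivative \<alpha>' s) (at s)" for s
    proof -
      have "((\<gamma> \<circ> (\<lambda>s. (1 / L) * s)) has_vector_derivative (1 / L) *\<^sub>R D ((1 / L) * s)) (at s)"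
        by (intro vector_diff_chain_at D(1)) (auto intro!: derivative_eq_intros)
      then show ?thesis by (simp only: \<alpha>_def[abs_def] \<alpha>'_def o_def)
    qed
    show "continuous_on UNIV \<alpha>'" unfolding \<alpha>'_def[abs_def]
      by (intro continuous_intros continuous_on_compose2[OF D(2)]) auto
    show "norm (\<alpha>' s) = 1" for s
      using L[of "(1 / L) * s"] L_pos by (simp add: \<alpha>'_def vD)
  qed
  moreover have "has_density \<alpha>' k 0 L"
    using has_density_rescale[OF h, of "1 / L" "1 / L"] L_pos by (simp add: \<alpha>'_def[abs_def] k_def[abs_def])
  moreover have "(\<lambda>s. (norm (k s))\<^sup>2) integrable_on {0..L}"
  proof -
    have "(\<lambda>s. (norm (h ((1 / L) * s)))\<^sup>2) integrable_on {0..L}"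
      using square_integrable_rescale[OF hi, of "1 / L"] L_pos by simp
    from integrable_on_cmult_left[OF this, of "(1 / L * (1 / L))\<^sup>2"]
    show ?thesis by (simp add: k_def power_mult_distrib power_divide)
  qed
  moreover have "\<gamma> = (\<lambda>t. \<alpha> (L * t))" using L_pos by (simp add: \<alpha>_def)
  ultimately show thesis by (rule that)
qed

theorem theorem6p5:
  fixes \<Omega> :: "complex set" and \<gamma> :: "real \<Rightarrow> complex"
  assumes "open \<Omega>" and "bounded \<Omega>" and "lipschitz_boundary \<Omega>"
    and "convex \<Omega>"
    and "minimal_curve \<Omega> \<gamma>"
    and "constant_speed \<gamma>" and "noncrossing \<gamma>"
  shows "convex (surrounded_set \<gamma>)"
proof -
  have adm: "regular_closed_curve \<gamma>" "path_image \<gamma> \<subseteq> closure \<Omega>"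
    and min: "\<And>\<gamma>'. \<gamma>' \<in> admissible \<Omega> \<Longrightarrow> bending_energy \<gamma> \<le> bending_energy \<gamma>'"
    using assms(5) by (auto simp: minimal_curve_def admissible_def)
  obtain L \<beta> \<beta>' k where \<beta>: "closed_unit_curve L \<beta> \<beta>'" "has_density \<beta>' k 0 L"
      "(\<lambda>s. (norm (k s))\<^sup>2) integrable_on {0..L}" "\<gamma> = (\<lambda>t. \<beta> (L * t))"
    using constant_speed_unit_curve[OF adm(1) assms(6)] by blast
  \<comment> \<open>This interior point of the hull is moved to the origin; the energy and the shape
    of the curve are unaffected.\<close>
  obtain c where c: "c \<in> interior (convex hull range \<beta>)"
    using closed_unit_curve.interior_C_nonempty[OF \<beta>(1)]
    unfolding closed_unit_curve.C_def[OF \<beta>(1)] by blast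
  define \<alpha> where "\<alpha> s = \<beta> s + (- c)" for s
  have \<alpha>: "closed_unit_curve L \<alpha> \<beta>'" unfolding \<alpha>_def[abs_def] by (rule closed_unit_curve_translate[OF \<beta>(1)])
  have hull: "convex hull range \<alpha> = (\<lambda>x. - c + x) ` (convex hull range \<beta>)"
    unfolding convex_hull_translation[symmetric] by (simp add: \<alpha>_def[abs_def] image_image add.commute)
  interpret hull_density L \<alpha> \<beta>' k
  proof (intro hull_density.intro hull_curve.intro hull_curve_axioms.intro hull_density_axioms.intro \<alpha> \<beta>(2,3))
    show "0 \<in> interior (closed_unit_curve.C \<alpha>)"
      unfolding closed_unit_curve.C_def[OF \<alpha>] hull interior_translation using c by force
  qed
  have \<gamma>: "\<gamma> = loop c" unfolding \<beta>(4) by (simp add: loop_def[abs_def] \<alpha>_def)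
  have \<gamma>W: "bending_energy \<gamma> = integral {0..L} (\<lambda>s. (norm (k s))\<^sup>2)"
    unfolding \<beta>(4) by (rule unit_speed_loop(2)[OF \<beta>(1-3)])
  obtain w where w: "has_density bdry' w 0 bdry_len" "(\<lambda>y. (norm (w y))\<^sup>2) integrable_on {0..bdry_len}"
      "integral {0..bdry_len} (\<lambda>y. (norm (w y))\<^sup>2) \<le> integral E (\<lambda>s. (norm (k s))\<^sup>2)"
    by (rule boundary_density)
  have bdry: "closed_unit_curve bdry_len bdry bdry'"
    by unfold_locales (rule bdry_len_pos bdry_periodic bdry_deriv bdry'_continuous norm_bet')+
  define \<eta> where "\<eta> t = bdry (bdry_len * t) + c" for t
  note \<eta> = unit_speed_loop[OF closed_unit_curve_translate[OF bdry, of c] w(1,2), folded \<eta>_def]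
  have "\<eta> \<in> admissible \<Omega>"
    unfolding admissible_def
  proof (intro CollectI conjI)
    show "regular_closed_curve \<eta>" by (rule \<eta>(1))
    have "range \<beta> \<subseteq> closure \<Omega>"
    proof -
      have "range \<beta> = (\<lambda>x. x + c) ` range \<alpha>" by (simp add: \<alpha>_def image_image)
      then show ?thesis using adm(2) unfolding \<gamma> loop_image by simp
    qed
    \<comment> \<open>Convexity of \<Omega> enters here: the competitor traces the boundary of a
      hull and must not leave the closure of \<Omega>.\<close>
    then have "convex hull range \<beta> \<subseteq> closure \<Omega>" by (intro hull_minimal convex_closure assms(4))
    moreover have "\<eta> t \<in> convex hull range \<beta>" for t
    proof -
      have "bdry (bdry_len * t) \<in> C" unfolding bdry_def by (rule rad_in_C)
      then show ?thesis unfolding C_def hull \<eta>_def by auto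
    qed
    ultimately show "path_image \<eta> \<subseteq> closure \<Omega>" by (auto simp: path_image_def)
    show "tangential_self_intersections \<eta>"
      unfolding tangential_self_intersections_def
    proof (intro ballI impI)
      fix s t :: real assume st: "s \<in> {0..<1}" "t \<in> {0..<1}" "s \<noteq> t \<and> \<eta> s = \<eta> t"
      \<comment> \<open>The boundary is injective over one period, so the assumed self-intersection
        is impossible.\<close>
      have "bdry_len * s = bdry_len * t" using st bdry_len_pos by (intro bdry_inj) (auto simp: \<eta>_def)
      then show "\<exists>c. velocity \<eta> s = c *\<^sub>R velocity \<eta> t" using st bdry_len_pos by simp
    qed
  qed
  \<comment> \<open>The energy of \<gamma> is at most that of the competitor, which is at most the
    part of the energy of \<gamma> on \<open>E\<close>. This is the inequality that rigidity starts
    from.\<close>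
  then have "integral {0..L} (\<lambda>s. (norm (k s))\<^sup>2) \<le> integral E (\<lambda>s. (norm (k s))\<^sup>2)"
    using min[of \<eta>] w(3) \<eta>(2) \<gamma>W by simp
  then have "surrounded_set \<gamma> = (\<lambda>x. x + c) ` C"
    unfolding \<gamma> by (intro surrounded_loop contact_everywhere)
  moreover have "convex ((\<lambda>x. x + c) ` C)" using convex_translation[OF convex_C, of c] by (simp add: add.commute)
  ultimately show ?thesis by simp
qed

end
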